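(* Consider the Latent Block Model of the context. The matrices $\Sigma_{\boldsymbol\pi^\star}=\mathrm{Diag}(\boldsymbol\pi^\star)-\boldsymbol\pi^\star(\boldsymbol\pi^\star)^T$ and $\Sigma_{\boldsymbol\rho^\star}=\mathrm{Diag}(\boldsymbol\rho^\star)-\boldsymbol\rho^\star(\boldsymbol\rho^\star)^T$ are positive semi-definite, of rank $g-1$ and $m-1$ respectively, and $\widehat{\boldsymbol\pi}$, $\widehat{\boldsymbol\rho}$ are asymptotically normal: $$\sqrt n\,\bigl(\widehat{\boldsymbol\pi}(\mathbf z^\star)-\boldsymbol\pi^\star\bigr)\xrightarrow[n\to\infty]{\mathcal D}\mathcal N(0,\Sigma_{\boldsymbol\pi^\star}),\qquad \sqrt d\,\bigl(\widehat{\boldsymbol\rho}(\mathbf w^\star)-\boldsymbol\rho^\star\bigr)\xrightarrow[d\to\infty]{\mathcal D}\mathcal N(0,\Sigma_{\boldsymbol\rho^\star}).$$ Similarly, let $V(\boldsymbol\alpha^\star)$ be the $g\times m$ matrix with entries $[V(\boldsymbol\alpha^\star)]_{k\ell}=1/\psi''(\alpha^\star_{k\ell})$ and let $\Sigma_{\boldsymbol\alpha^\star}=\mathrm{Diag}^{-1}(\boldsymbol\pi^\star)\,V(\boldsymbol\alpha^\star)\,\mathrm{Diag}^{-1}(\boldsymbol\rho^\star)$. Then for all $k,\ell$, $$\sqrt{nd}\,\bigl(\widehat\alpha_{k\ell}(\mathbf z^\star,\mathbf w^\star)-\alpha^\star_{k\ell}\bigr)\xrightarrow[n,d\to\infty]{\mathcal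 D}\mathcal N\bigl(0,\Sigma_{\boldsymbol\alpha^\star,k\ell}\bigr),$$ and the components $\widehat\alpha_{k\ell}$ are independent.
   Context: Latent Block Model (LBM). Integers $g,m\ge1$ are fixed and known. Row assignments are $\mathbf z=(z_{ik})\in\{0,1\}^{n\times g}$ with exactly one $1$ in each row; column assignments are $\mathbf w=(w_{j\ell})\in\{0,1\}^{d\times m}$ with exactly one $1$ in each row. A parameter is $\boldsymbol\theta=(\boldsymbol\pi,\boldsymbol\rho,\boldsymbol\alpha)\in\boldsymbol\Theta$ with $\boldsymbol\pi=(\pi_k)_{k\le g}$ and $\boldsymbol\rho=(\rho_\ell)_{\ell\le m}$ probability vectors and $\boldsymbol\alpha=(\alpha_{k\ell})$ a $g\times m$ matrix. Under $\boldsymbol\theta$, the rows of $\mathbf z$ are i.i.d. multinomial $\mathcal M(1,\boldsymbol\pi)$, the rows of $\mathbf w$ are i.i.d. multinomial $\mathcal M(1,\boldsymbol\rho)$, $\mathbf z$ and $\mathbf w$ are independent, and conditionally on $(\mathbf z,\mathbf w)$ the entries $x_{ij}$ of the $n\times d$ data matrix $\mathbf x$ are independent with $x_{ij}\sim\varphi(\cdot,\alpha_{k\ell})$ when $z_{ik}w_{j\ell}=1$. Here $\varphi(x,\alpha)=b(x)\exp(\alpha x-\psi(\alpha))$ is a regular univariate exponential family in canonical form with canonical parameter space $\mathcal A\subset\mathbb R$ (interior $\mathring{\mathcal A}$); its mean is $\psi'(\alpha)$ and its variance $\psi''(\alpha)$. The data are generated under the true parameter $\boldsymbol\theta^\star=(\boldsymbol\pi^\star,\boldsymbol\rho^\star,\boldsymbol\alpha^\star)$,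 with true assignments $(\mathbf z^\star,\mathbf w^\star)$. Standing assumptions: (H1) there are a constant $c>0$ and a compact $C_\alpha\subset\mathring{\mathcal A}$ with $\boldsymbol\Theta\subset[c,1-c]^g\times[c,1-c]^m\times C_\alpha^{g\times m}$; (H2) $\boldsymbol\theta^\star$ lies in the relative interior of $\boldsymbol\Theta$; (H3) $\boldsymbol\theta^\star$ is identifiable up to a permutation of the row-labels and column-labels (in particular $\alpha\mapsto\varphi(\cdot,\alpha)$ is injective and each row and each column of $\boldsymbol\alpha^\star$ is unique). Complete-data maximum likelihood estimators (labels known): $\widehat\pi_k(\mathbf z)=\frac1n\sum_i z_{ik}$, $\widehat\rho_\ell(\mathbf w)=\frac1d\sum_j w_{j\ell}$, $\widehat x_{k\ell}(\mathbf z,\mathbf w)=\dfrac{\sum_{i,j}x_{ij}z_{ik}w_{j\ell}}{(\sum_i z_{ik})(\sum_j w_{j\ell})}$, $\widehat\alpha_{k\ell}(\mathbf z,\mathbf w)=(\psi')^{-1}(\widehat x_{k\ell}(\mathbf z,\mathbf w))$. $\mathrm{Diag}(v)$ is the diagonal matrix with diagonal $v$, and $\mathrm{Diag}^{-1}(v)$ its inverse.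
   Formalization: "The components are independent" is proved as independence conditionally on the labels (z*, w* ) for all n, d, and as asymptotic joint independence (product normal limit); unconditional finite-sample independence fails, as the components share the random class counts. *)

theory Defs
  imports "HOL-Probability.Probability"
begin

section \<open>Matrices\<close>

definition diag_mat :: "real^'k \<Rightarrow> real^'k^'k" where
  "diag_mat v = (\<chi> i j. if i = j then v $ i else 0)"

definition outer :: "real^'k \<Rightarrow> real^'k^'k" where
  "outer v = (\<chi> i j. v $ i * v $ j)"

definition pos_semidef :: "real^'k^'k \<Rightarrow> bool" where
  "pos_semidef S \<longleftrightarrow> transpose S = S \<and> (\<forall>v. 0 \<le> v \<bullet> (S *v v))"

section \<open>Normal laws and convergence in distribution\<close>

text \<open>The centred univariate normal law, parameterised by its variance \<open>s > 0\<close>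
  (\<open>normal_density\<close> takes the standard deviation).\<close>

definition normal_law :: "real \<Rightarrow> real measure" where
  "normal_law s = density lborel (\<lambda>x. ennreal (normal_density 0 (sqrt s) x))"

text \<open>The centred multivariate normal law, for a possibly singular positive semi-definite
  covariance matrix \<open>S\<close>: the law of \<open>L Y\<close>, where \<open>Y\<close> has independent standard normal
  coordinates and \<open>L L\<^sup>T = S\<close>. The law does not depend on the choice of \<open>L\<close>.\<close>

definition mvn_law :: "real^'k^'k \<Rightarrow> (real^'k) measure" where
  "mvn_law S = distr (\<Pi>\<^sub>M i\<in>(UNIV :: 'k set). normal_law 1) borel
     (\<lambda>y. (SOME L :: real^'k^'k. L ** transpose L = S) *v (\<chi> i. y i))"

text \<open>The random variables need not be indexed by a sequence: the filter \<open>F\<close> may describe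
  \<open>n \<rightarrow> \<infinity>\<close> or \<open>n, d \<rightarrow> \<infinity>\<close>.\<close>

definition conv_in_dist ::
    "'a measure \<Rightarrow> ('i \<Rightarrow> 'a \<Rightarrow> 'b::topological_space) \<Rightarrow> 'i filter \<Rightarrow> 'b measure \<Rightarrow> bool" where
  "conv_in_dist M Y F N \<longleftrightarrow>
     (\<forall>i. Y i \<in> borel_measurable M) \<and>
     (\<forall>f :: 'b \<Rightarrow> real. continuous_on UNIV f \<and> bounded (range f) \<longrightarrow>
        ((\<lambda>i. \<integral>\<omega>. f (Y i \<omega>) \<partial>M) \<longlongrightarrow> (\<integral>y. f y \<partial>N)) F)"

section \<open>Exponential families\<close>

definition ef_density :: "(real \<Rightarrow> real) \<Rightarrow> (real \<Rightarrow> real) \<Rightarrow> real \<Rightarrow> real \<Rightarrow> real" where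
  "ef_density b \<psi> x \<alpha> = b x * exp (\<alpha> * x - \<psi> \<alpha>)"

definition ef_law ::
    "real measure \<Rightarrow> (real \<Rightarrow> real) \<Rightarrow> (real \<Rightarrow> real) \<Rightarrow> real \<Rightarrow> real measure" where
  "ef_law \<mu> b \<psi> \<alpha> = density \<mu> (\<lambda>x. ennreal (ef_density b \<psi> x \<alpha>))"

text \<open>The dominating measure \<open>\<mu>\<close> is arbitrary, e.g. Lebesgue or counting measure on a
  countable set. The identities for mean and variance, and the smoothness and strict convexity
  of \<open>\<psi>\<close> on the interior of the parameter space \<open>A\<close>, are consequences of normalisation on \<open>A\<close>
  and, for strictness, of the injectivity of the parametrisation. \<open>A\<close> need not be the whole
  natural parameter space, nor open: all parameters used below lie in its interior.\<close>

definition exponential_family ::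
    "real measure \<Rightarrow> (real \<Rightarrow> real) \<Rightarrow> (real \<Rightarrow> real) \<Rightarrow> real set \<Rightarrow> bool" where
  "exponential_family \<mu> b \<psi> A \<longleftrightarrow>
     sigma_finite_measure \<mu> \<and> sets \<mu> = sets borel \<and>
     b \<in> borel_measurable borel \<and> (\<forall>x. 0 \<le> b x) \<and>
     (\<forall>\<alpha>\<in>A. prob_space (ef_law \<mu> b \<psi> \<alpha>))"

section \<open>The latent block model\<close>

text \<open>The row labels form the finite type \<open>'g\<close>, the column labels the finite type \<open>'m\<close>, so that
  the numbers of classes are \<open>CARD('g)\<close> and \<open>CARD('m)\<close>. A parameter is a triple
  \<open>(\<pi>, \<rho>, \<alpha>)\<close> with \<open>\<alpha> $ k $ l\<close> the entry in row \<open>k\<close>, column \<open>l\<close>.\<close>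

type_synonym ('g, 'm) lbm_param = "(real^'g) \<times> (real^'m) \<times> (real^'m^'g)"

definition prob_vector :: "real^'k \<Rightarrow> bool" where
  "prob_vector p \<longleftrightarrow> (\<forall>k. 0 \<le> p $ k) \<and> (\<Sum>k\<in>UNIV. p $ k) = 1"

abbreviation onehot :: "'k::finite \<Rightarrow> real^'k" where
  "onehot k \<equiv> axis k 1"

text \<open>The first \<open>n\<close> vectors \<open>Z i\<close> are the rows of a random assignment matrix; they are
  independent with law \<open>\<M>(1, p)\<close>.\<close>

definition iid_assignment ::
    "'a measure \<Rightarrow> nat \<Rightarrow> real^'k \<Rightarrow> (nat \<Rightarrow> 'a \<Rightarrow> real^'k) \<Rightarrow> bool" where
  "iid_assignment M n p Z \<longleftrightarrow>
     (\<forall>i<n. Z i \<in> borel_measurable M \<and> (\<forall>\<omega>\<in>space M. Z i \<omega> \<in> range onehot) \<and>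
        (\<forall>k. measure M {\<omega> \<in> space M. Z i \<omega> = onehot k} = p $ k)) \<and>
     prob_space.indep_vars M (\<lambda>_. borel) Z {..<n}"

text \<open>The \<open>\<sigma>\<close>-algebra generated by the first \<open>n\<close> rows.\<close>

definition assignment_events :: "'a measure \<Rightarrow> nat \<Rightarrow> (nat \<Rightarrow> 'a \<Rightarrow> real^'k) \<Rightarrow> 'a set set" where
  "assignment_events M n Z = sets (vimage_algebra (space M)
     (\<lambda>\<omega>. \<lambda>i\<in>{..<n}. Z i \<omega>) (\<Pi>\<^sub>M i\<in>{..<n}. borel))"

text \<open>\<open>given_labels M Z W n d r c\<close> is \<open>M\<close> conditioned on row \<open>i < n\<close> having label \<open>r i\<close> and
  column \<open>j < d\<close> having label \<open>c j\<close>.\<close>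

definition given_labels ::
    "'a measure \<Rightarrow> (nat \<Rightarrow> 'a \<Rightarrow> real^'g) \<Rightarrow> (nat \<Rightarrow> 'a \<Rightarrow> real^'m) \<Rightarrow> nat \<Rightarrow> nat \<Rightarrow>
     (nat \<Rightarrow> 'g) \<Rightarrow> (nat \<Rightarrow> 'm) \<Rightarrow> 'a measure" where
  "given_labels M Z W n d r c = uniform_measure M
     {\<omega> \<in> space M. (\<forall>i<n. Z i \<omega> = onehot (r i)) \<and> (\<forall>j<d. W j \<omega> = onehot (c j))}"

text \<open>The guard in the last conjunct restricts to label configurations of positive
  probability, for which the conditional law is defined.\<close>

definition lbm ::
    "'a measure \<Rightarrow> real measure \<Rightarrow> (real \<Rightarrow> real) \<Rightarrow> (real \<Rightarrow> real) \<Rightarrow> ('g::finite, 'm::finite) lbm_param \<Rightarrow>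
     nat \<Rightarrow> nat \<Rightarrow> (nat \<Rightarrow> 'a \<Rightarrow> real^'g) \<Rightarrow> (nat \<Rightarrow> 'a \<Rightarrow> real^'m) \<Rightarrow> (nat \<Rightarrow> nat \<Rightarrow> 'a \<Rightarrow> real) \<Rightarrow> bool" where
  "lbm M \<mu> b \<psi> \<theta> n d Z W X \<longleftrightarrow> (case \<theta> of (\<pi>, \<rho>, \<alpha>) \<Rightarrow>
     prob_space M \<and>
     iid_assignment M n \<pi> Z \<and> iid_assignment M d \<rho> W \<and>
     prob_space.indep_set M (assignment_events M n Z) (assignment_events M d W) \<and>
     (\<forall>i<n. \<forall>j<d. X i j \<in> borel_measurable M) \<and>
     (\<forall>r c. (\<forall>i<n. 0 < \<pi> $ r i) \<and> (\<forall>j<d. 0 < \<rho> $ c j) \<longrightarrow>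
        prob_space.indep_vars (given_labels M Z W n d r c)
          (\<lambda>_. borel) (\<lambda>(i, j). X i j) ({..<n} \<times> {..<d}) \<and>
        (\<forall>i<n. \<forall>j<d. distr (given_labels M Z W n d r c) borel (X i j)
           = ef_law \<mu> b \<psi> (\<alpha> $ r i $ c j))))"

text \<open>The law of the \<open>n \<times> d\<close> data matrix alone, with the labels summed out.\<close>

definition observed_law ::
    "real measure \<Rightarrow> (real \<Rightarrow> real) \<Rightarrow> (real \<Rightarrow> real) \<Rightarrow> ('g::finite, 'm::finite) lbm_param \<Rightarrow>
     nat \<Rightarrow> nat \<Rightarrow> (nat \<times> nat \<Rightarrow> real) measure" where
  "observed_law \<mu> b \<psi> \<theta> n d = (case \<theta> of (\<pi>, \<rho>, \<alpha>) \<Rightarrow>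
     density (\<Pi>\<^sub>M p\<in>{..<n} \<times> {..<d}. \<mu>) (\<lambda>x. ennreal
       (\<Sum>r\<in>{..<n} \<rightarrow>\<^sub>E UNIV. \<Sum>c\<in>{..<d} \<rightarrow>\<^sub>E UNIV.
          (\<Prod>i<n. \<pi> $ r i) * (\<Prod>j<d. \<rho> $ c j) *
          (\<Prod>i<n. \<Prod>j<d. ef_density b \<psi> (x (i, j)) (\<alpha> $ r i $ c j)))))"

definition equal_up_to_labels ::
    "('g::finite, 'm::finite) lbm_param \<Rightarrow> ('g, 'm) lbm_param \<Rightarrow> bool" where
  "equal_up_to_labels \<theta> \<theta>' \<longleftrightarrow> (case (\<theta>, \<theta>') of ((\<pi>, \<rho>, \<alpha>), (\<pi>', \<rho>', \<alpha>')) \<Rightarrow>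
     \<exists>s t. bij s \<and> bij t \<and> (\<forall>k. \<pi> $ k = \<pi>' $ s k) \<and> (\<forall>l. \<rho> $ l = \<rho>' $ t l) \<and>
       (\<forall>k l. \<alpha> $ k $ l = \<alpha>' $ s k $ t l))"

definition identifiable ::
    "real measure \<Rightarrow> (real \<Rightarrow> real) \<Rightarrow> (real \<Rightarrow> real) \<Rightarrow> real set \<Rightarrow>
     ('g::finite, 'm::finite) lbm_param set \<Rightarrow> ('g, 'm) lbm_param \<Rightarrow> bool" where
  "identifiable \<mu> b \<psi> A \<Theta> \<theta>' \<longleftrightarrow>
     (\<forall>\<theta>\<in>\<Theta>. (\<forall>n d. observed_law \<mu> b \<psi> \<theta> n d = observed_law \<mu> b \<psi> \<theta>' n d)
        \<longrightarrow> equal_up_to_labels \<theta> \<theta>') \<and>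
     inj_on (ef_law \<mu> b \<psi>) A \<and>
     (case \<theta>' of (\<pi>, \<rho>, \<alpha>) \<Rightarrow> inj (\<lambda>k. row k \<alpha>) \<and> inj (\<lambda>l. column l \<alpha>))"

section \<open>Complete-data maximum likelihood estimators\<close>

text \<open>Used both for \<open>\<pi>\<close> (from \<open>n\<close> rows) and for \<open>\<rho>\<close> (from \<open>d\<close> columns).\<close>

definition prop_hat :: "nat \<Rightarrow> (nat \<Rightarrow> real^'k) \<Rightarrow> real^'k" where
  "prop_hat n z = (\<chi> k. (1 / real n) * (\<Sum>i<n. z i $ k))"

definition x_hat ::
    "nat \<Rightarrow> nat \<Rightarrow> (nat \<Rightarrow> nat \<Rightarrow> real) \<Rightarrow> (nat \<Rightarrow> real^'g) \<Rightarrow> (nat \<Rightarrow> real^'m) \<Rightarrow> 'g \<Rightarrow> 'm \<Rightarrow> real" where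
  "x_hat n d x z w k l =
     (\<Sum>i<n. \<Sum>j<d. x i j * z i $ k * w j $ l) / ((\<Sum>i<n. z i $ k) * (\<Sum>j<d. w j $ l))"

text \<open>When the block \<open>(k, l)\<close> is empty, \<open>x_hat\<close> is \<open>0\<close>; when \<open>x_hat\<close> lies outside the range of
  \<open>\<psi>'\<close>, the estimator takes a fixed default value (the one chosen by \<open>inv_into\<close>).\<close>

definition alpha_hat ::
    "(real \<Rightarrow> real) \<Rightarrow> real set \<Rightarrow> nat \<Rightarrow> nat \<Rightarrow> (nat \<Rightarrow> nat \<Rightarrow> real) \<Rightarrow> (nat \<Rightarrow> real^'g) \<Rightarrow> (nat \<Rightarrow> real^'m) \<Rightarrow>
     'g \<Rightarrow> 'm \<Rightarrow> real" where
  "alpha_hat \<psi> A n d x z w k l = inv_into (interior A) (deriv \<psi>) (x_hat n d x z w k l)"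

section \<open>Asymptotic variances\<close>

definition Sigma_prop :: "real^'k \<Rightarrow> real^'k^'k" where
  "Sigma_prop p = diag_mat p - outer p"

definition V_mat :: "(real \<Rightarrow> real) \<Rightarrow> real^'m^'g \<Rightarrow> real^'m^'g" where
  "V_mat \<psi> \<alpha> = (\<chi> k l. 1 / deriv (deriv \<psi>) (\<alpha> $ k $ l))"

definition Sigma_alpha :: "(real \<Rightarrow> real) \<Rightarrow> ('g::finite, 'm::finite) lbm_param \<Rightarrow> real^'m^'g" where
  "Sigma_alpha \<psi> \<theta> = (case \<theta> of (\<pi>, \<rho>, \<alpha>) \<Rightarrow>
     matrix_inv (diag_mat \<pi>) ** V_mat \<psi> \<alpha> ** matrix_inv (diag_mat \<rho>))"

end

theory Submission
  imports Defs
begin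

text \<open>The class proportions are normalised sums of i.i.d. bounded vectors, so their characteristic
  functions are powers of a fixed one and Levy's theorem applies. Given the labels, the blocks are
  disjoint sets of independent entries, which gives the conditional independence; the conditional
  characteristic function of the rescaled block means is a product over the blocks of powers of
  characteristic functions, and depends on the labels only through the class counts. As the class
  proportions converge in probability, it converges in probability to the characteristic function
  of a product of normal laws, hence so does its expectation. Finally \<open>\<psi>'\<close> is injective with
  positive derivative on the interior of \<open>A\<close>, and the delta method for its inverse passes from
  the block means to \<open>\<alpha>\<close>.\<close>

section \<open>Convergence in distribution\<close>

text \<open>Two obstacles shape the proof. First, vectors require Levy's theorem in several
  dimensions. The one-dimensional theorem supplies only the tightness of each coordinate; tightness
  then reduces bounded continuous test functions to trigonometric polynomials, whose expectations
  are linear in characteristic functions. The argument is sequential and reaches the limit in two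
  indices through arbitrary sequences of pairs. Second, the class counts are random and shared
  between blocks, and a block may be empty. Exact independence is therefore available given the
  labels, while the unconditional statement concerns the joint limit law. The law of the counts is
  never computed: conditional characteristic functions are bounded by 1 and converge along a filter
  of label configurations with nearly correct proportions, so atypical configurations cost only
  their probability. The delta method uses deterministic maps, depending on the two sizes, that
  converge uniformly on balls.\<close>

lemma prob_norm_tail:
  fixes N :: "'b::euclidean_space measure"
  assumes "prob_space N" "sets N = sets borel" "e > 0"
  shows "\<exists>K>0. measure N {x. K < norm x} < e"
proof -
  interpret prob_space N by fact
  define A where "A n = {x::'b. real n < norm x}" for n
  have "(\<lambda>n. measure N (A n)) \<longlonglongrightarrow> measure N (\<Inter>n. A n)"
  proof (rule finite_Lim_measure_decseq)
    have "A n \<in> sets borel" for n unfolding A_def by measurable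
    then show "range A \<subseteq> sets N" unfolding assms(2) by blast
    show "decseq A" by (auto simp: decseq_def A_def)
  qed
  moreover have "(\<Inter>n. A n) = {}"
  proof -
    have "\<exists>n. x \<notin> A n" for x
      using real_arch_simple[of "norm x"] by (auto simp: A_def not_less)
    then show ?thesis by blast
  qed
  ultimately have "(\<lambda>n. measure N (A n)) \<longlonglongrightarrow> 0" by simp
  then have "eventually (\<lambda>n. measure N (A n) < e \<and> 0 < n) sequentially"
    using assms(3) by (intro eventually_conj order_tendstoD(2)[of _ 0] eventually_gt_at_top) auto
  then obtain n where "measure N (A n) < e" "0 < n"
    by (auto simp: eventually_sequentially)
  then show ?thesis by (intro exI[of _ "real n"]) (auto simp: A_def)
qed

lemma conv_in_dist_measurable:
  "conv_in_dist M Y F N \<Longrightarrow> Y i \<in> borel_measurable M"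
  by (auto simp: conv_in_dist_def)

text \<open>Tail indicators are not continuous, so the test function is a ramp that lies below the
  indicator of \<open>K < norm x\<close> and above that of \<open>K + 1 < norm x\<close>. This costs
  1 in the radius.\<close>

lemma conv_in_dist_tight:
  fixes N :: "'b::euclidean_space measure"
  assumes M: "prob_space M" and N: "prob_space N" "sets N = sets borel"
    and conv: "conv_in_dist M Y F N" and e: "e > 0"
  shows "\<exists>K>0. \<forall>\<^sub>F i in F. measure M {\<omega> \<in> space M. K < norm (Y i \<omega>)} < e"
proof -
  interpret M: prob_space M by fact
  interpret N: prob_space N by fact
  obtain K where K: "K > 0" "measure N {x. K < norm x} < e"
    using prob_norm_tail[OF N e] by auto
  define f where "f x = min 1 (max 0 (norm x - K))" for x :: 'b
  have cont: "continuous_on UNIV f"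
    unfolding f_def by (intro continuous_intros)
  have bdd: "0 \<le> f x" "f x \<le> 1" for x by (auto simp: f_def)
  have fm [measurable]: "f \<in> borel_measurable borel"
    using cont by (rule borel_measurable_continuous_onI)
  have fN: "f \<in> borel_measurable N"
    using fm N(2) by (simp cong: measurable_cong_sets)
  have Y [measurable]: "Y i \<in> borel_measurable M" for i
    using conv by (rule conv_in_dist_measurable)
  have "bounded (range f)"
    using bdd by (intro boundedI[of _ 1]) auto
  then have lim: "((\<lambda>i. \<integral>\<omega>. f (Y i \<omega>) \<partial>M) \<longlongrightarrow> (\<integral>y. f y \<partial>N)) F"
    using conv cont by (auto simp: conv_in_dist_def)
  have "(\<integral>y. f y \<partial>N) \<le> (\<integral>y. indicator {x. K < norm x} y \<partial>N)"
  proof (rule integral_mono)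
    show "integrable N f"
      by (intro N.integrable_const_bound[of _ 1]) (use bdd fN in auto)
    show "integrable N (indicator {x. K < norm x} :: 'b \<Rightarrow> real)"
      by (intro N.integrable_const_bound[of _ 1]) (use N(2) in \<open>auto simp: indicator_def cong: measurable_cong_sets\<close>)
    show "f x \<le> indicator {x. K < norm x} x" for x
      by (auto simp: f_def indicator_def)
  qed
  also have "\<dots> < e" using K(2) sets_eq_imp_space_eq[OF N(2)] by simp
  finally have "\<forall>\<^sub>F i in F. (\<integral>\<omega>. f (Y i \<omega>) \<partial>M) < e"
    using lim order_tendstoD(2) by blast
  moreover have "measure M {\<omega> \<in> space M. K + 1 < norm (Y i \<omega>)} \<le> (\<integral>\<omega>. f (Y i \<omega>) \<partial>M)" for i
  proof -
    have "measure M {\<omega> \<in> space M. K + 1 < norm (Y i \<omega>)}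
        = (\<integral>\<omega>. indicator {\<omega> \<in> space M. K + 1 < norm (Y i \<omega>)} \<omega> \<partial>M)"
      by (simp add: Int_absorb2 Collect_conj_eq)
    also have "\<dots> \<le> (\<integral>\<omega>. f (Y i \<omega>) \<partial>M)"
    proof (rule integral_mono)
      show "integrable M (\<lambda>\<omega>. f (Y i \<omega>))"
        by (intro M.integrable_const_bound[of _ 1]) (use bdd in auto)
      show "integrable M (indicator {\<omega> \<in> space M. K + 1 < norm (Y i \<omega>)} :: _ \<Rightarrow> real)"
        by (intro M.integrable_const_bound[of _ 1]) (auto simp: indicator_def)
    qed (auto simp: f_def indicator_def)
    finally show ?thesis .
  qed
  ultimately have "\<forall>\<^sub>F i in F. measure M {\<omega> \<in> space M. K + 1 < norm (Y i \<omega>)} < e"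
    by (elim eventually_mono) (meson le_less_trans)
  then show ?thesis using K by (intro exI[of _ "K + 1"]) auto
qed

text \<open>Its role is to make single coordinates tight in \<open>conv_in_dist_charI\<close>:
  convergent characteristic functions alone do not show directly that no mass escapes.\<close>

lemma conv_in_dist_1d:
  fixes Y :: "nat \<Rightarrow> 'a \<Rightarrow> real" and N :: "real measure"
  assumes M: "prob_space M" and N: "prob_space N" "sets N = sets borel"
    and Y: "\<And>i. Y i \<in> borel_measurable M"
    and cf: "\<And>t. (\<lambda>i. \<integral>\<omega>. cis (t * Y i \<omega>) \<partial>M) \<longlonglongrightarrow> (\<integral>y. cis (t * y) \<partial>N)"
  shows "conv_in_dist M Y sequentially N"
proof -
  interpret M: prob_space M by fact
  interpret N: prob_space N by fact
  have spN: "space N = UNIV" using sets_eq_imp_space_eq[OF N(2)] by simp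
  note [measurable] = Y
  have D: "real_distribution (distr M borel (Y i))" for i
    by (intro M.real_distribution_distr) (rule Y)
  have DN: "real_distribution N"
    using N spN by unfold_locales auto
  have c: "char (distr M borel (Y i)) t = (\<integral>\<omega>. cis (t * Y i \<omega>) \<partial>M)" for i t
    unfolding char_def by (subst integral_distr) (auto simp: cis_conv_exp)
  have cN: "char N t = (\<integral>y. cis (t * y) \<partial>N)" for t
    unfolding char_def by (auto simp: cis_conv_exp)
  have w: "weak_conv_m (\<lambda>i. distr M borel (Y i)) N"
    by (rule levy_continuity[OF D DN]) (unfold c cN, rule cf)
  show ?thesis unfolding conv_in_dist_def
  proof (intro conjI allI impI)
    fix f :: "real \<Rightarrow> real" assume f: "continuous_on UNIV f \<and> bounded (range f)"
    then obtain B where B: "\<And>x. norm (f x) \<le> B" by (auto simp: bounded_iff)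
    have "f \<in> borel_measurable borel"
      using f by (intro borel_measurable_continuous_onI) auto
    then have eq: "integral\<^sup>L (distr M borel (Y i)) f = (\<integral>\<omega>. f (Y i \<omega>) \<partial>M)" for i
      by (subst integral_distr) auto
    have "(\<lambda>i. integral\<^sup>L (distr M borel (Y i)) f) \<longlonglongrightarrow> integral\<^sup>L N f"
      by (rule weak_conv_imp_integral_bdd_continuous_conv[OF D DN w, of f B])
         (use f B in \<open>auto simp: continuous_on_eq_continuous_at\<close>)
    then show "(\<lambda>i. \<integral>\<omega>. f (Y i \<omega>) \<partial>M) \<longlonglongrightarrow> integral\<^sup>L N f"
      by (simp add: eq)
  qed (rule Y)
qed

section \<open>Trigonometric polynomials as test functions\<close>

inductive trig_poly :: "('b::euclidean_space \<Rightarrow> real) \<Rightarrow> bool" where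
  trig_poly_cis: "trig_poly (\<lambda>x. Re (c * cis (t \<bullet> x)))"
| trig_poly_add: "trig_poly f \<Longrightarrow> trig_poly g \<Longrightarrow> trig_poly (\<lambda>x. f x + g x)"

lemma trig_poly_const: "trig_poly (\<lambda>x. a)"
  using trig_poly_cis[of "complex_of_real a" 0] by simp

lemma trig_poly_sin: "trig_poly (\<lambda>x. a * sin (t \<bullet> x))"
  using trig_poly_cis[of "complex_of_real a * (-\<i>)" t] by simp

lemma trig_poly_mult_cis:
  fixes t :: "'b::euclidean_space"
  assumes "trig_poly g"
  shows "trig_poly (\<lambda>x. Re (c * cis (t \<bullet> x)) * g x)"
  using assms
proof (induction g rule: trig_poly.induct)
  case (trig_poly_cis d s)
  \<comment> \<open>Product-to-sum formula: two waves with frequencies \<open>t\<close> and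
    \<open>s\<close> multiply to waves with frequencies \<open>t + s\<close> and
    \<open>t - s\<close>.\<close>
  have e: "Re a * Re b = Re (a * b / 2) + Re (a * cnj b / 2)" for a b
    by (simp add: field_simps)
  have 1: "c * cis (t \<bullet> x) * (d * cis (s \<bullet> x)) / 2 = (c * d / 2) * cis ((t + s) \<bullet> x)" for x :: 'b
    by (simp add: inner_add_left flip: cis_mult)
  have 2: "c * cis (t \<bullet> x) * cnj (d * cis (s \<bullet> x)) / 2 = (c * cnj d / 2) * cis ((t - s) \<bullet> x)" for x :: 'b
    using cis_mult[of "t \<bullet> x" "- (s \<bullet> x)"] by (simp add: inner_diff_left cis_cnj mult_ac)
  show ?case
    unfolding e 1 2 by (intro trig_poly.intros)
next
  case (trig_poly_add f g)
  then show ?case by (simp only: ring_distribs) (intro trig_poly.intros)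
qed

text \<open>Products are derived and not a rule of the inductive definition, because the convergence
  of expectations in \<open>trig_poly_conv\<close> is an induction that passes through sums but not
  through products. The product structure is what lets polynomials be substituted.\<close>

lemma trig_poly_mult:
  assumes "trig_poly f" "trig_poly g"
  shows "trig_poly (\<lambda>x. f x * g x)"
  using assms(1)
proof (induction f rule: trig_poly.induct)
  case (trig_poly_cis c t)
  then show ?case by (rule trig_poly_mult_cis[OF assms(2)])
next
  case (trig_poly_add f g)
  then show ?case by (simp only: ring_distribs) (intro trig_poly.intros)
qed

lemma trig_poly_sum:
  "(\<And>i. i \<in> I \<Longrightarrow> trig_poly (f i)) \<Longrightarrow> trig_poly (\<lambda>x. \<Sum>i\<in>I. f i x)"
  by (induction I rule: infinite_finite_induct) (auto intro: trig_poly_const trig_poly_add)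

lemma trig_poly_measurable: "trig_poly f \<Longrightarrow> f \<in> borel_measurable borel"
proof (induction rule: trig_poly.induct)
  case (trig_poly_cis c t)
  then show ?case 
    by (intro borel_measurable_continuous_onI continuous_intros)
qed auto

lemma trig_poly_bounded: "trig_poly f \<Longrightarrow> \<exists>B. \<forall>x. \<bar>f x\<bar> \<le> B"
proof (induction rule: trig_poly.induct)
  case (trig_poly_cis c t)
  have "\<bar>Re (c * cis (t \<bullet> x))\<bar> \<le> norm c" for x
    by (rule order_trans[OF abs_Re_le_cmod]) (simp add: norm_mult)
  then show ?case by blast
next
  case (trig_poly_add f g)
  then obtain B C where "\<forall>x. \<bar>f x\<bar> \<le> B" "\<forall>x. \<bar>g x\<bar> \<le> C" by blast
  then show ?case
    by (intro exI[of _ "B + C"] allI order_trans[OF abs_triangle_ineq] add_mono) auto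
qed

lemma trig_poly_integrable:
  assumes "prob_space M" "Y \<in> borel_measurable M" "trig_poly f"
  shows "integrable M (\<lambda>\<omega>. f (Y \<omega>))"
proof -
  interpret prob_space M by fact
  from trig_poly_bounded[OF assms(3)] obtain B where "\<forall>x. \<bar>f x\<bar> \<le> B" by blast
  then show ?thesis
    using measurable_compose[OF assms(2) trig_poly_measurable[OF assms(3)]]
    by (intro integrable_const_bound[of _ B]) auto
qed

lemma trig_poly_conv:
  fixes N :: "'b::euclidean_space measure"
  assumes M: "prob_space M" and N: "prob_space N" "sets N = sets borel"
    and Y: "\<And>i. Y i \<in> borel_measurable M"
    and cf: "\<And>t. ((\<lambda>i. \<integral>\<omega>. cis (t \<bullet> Y i \<omega>) \<partial>M) \<longlongrightarrow> (\<integral>y. cis (t \<bullet> y) \<partial>N)) F"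
    and f: "trig_poly f"
  shows "((\<lambda>i. \<integral>\<omega>. f (Y i \<omega>) \<partial>M) \<longlongrightarrow> (\<integral>y. f y \<partial>N)) F"
  using f
proof (induction rule: trig_poly.induct)
  case (trig_poly_cis c t)
  interpret M: prob_space M by fact
  interpret N: prob_space N by fact
  note [measurable] = Y
  have "(\<lambda>y. cis (t \<bullet> y)) \<in> borel_measurable borel"
    by (intro borel_measurable_continuous_onI continuous_intros)
  then have cm: "(\<lambda>y. cis (t \<bullet> y)) \<in> borel_measurable N"
     "(\<lambda>\<omega>. cis (t \<bullet> Y i \<omega>)) \<in> borel_measurable M" for i
    using N(2) measurable_compose[OF Y[of i]] by (auto cong: measurable_cong_sets)
  have ci: "integrable N (\<lambda>y. cis (t \<bullet> y))" "integrable M (\<lambda>\<omega>. cis (t \<bullet> Y i \<omega>))" for i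
    by (auto intro!: N.integrable_const_bound[of _ 1] M.integrable_const_bound[of _ 1] cm)
  have "(\<integral>y. Re (c * cis (t \<bullet> y)) \<partial>N) = Re (c * (\<integral>y. cis (t \<bullet> y) \<partial>N))"
    using ci by (subst integral_Re) auto
  moreover have "(\<integral>\<omega>. Re (c * cis (t \<bullet> Y i \<omega>)) \<partial>M) = Re (c * (\<integral>\<omega>. cis (t \<bullet> Y i \<omega>) \<partial>M))" for i
    using ci by (subst integral_Re) auto
  moreover have "((\<lambda>i. Re (c * (\<integral>\<omega>. cis (t \<bullet> Y i \<omega>) \<partial>M))) \<longlongrightarrow> Re (c * (\<integral>y. cis (t \<bullet> y) \<partial>N))) F"
    by (intro tendsto_Re tendsto_mult tendsto_const cf)
  ultimately show ?case by (simp only:)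
next
  case (trig_poly_add f g)
  have "f \<in> borel_measurable N" "g \<in> borel_measurable N"
    using trig_poly_add(1,2) N(2) by (auto intro: trig_poly_measurable cong: measurable_cong_sets)
  then have "integrable N f" "integrable N g"
    using trig_poly_integrable[OF N(1), of "\<lambda>x. x"] trig_poly_add(1,2) N(2)
    by (auto cong: measurable_cong_sets simp: measurable_ident_sets)
  moreover have "integrable M (\<lambda>\<omega>. f (Y i \<omega>))" "integrable M (\<lambda>\<omega>. g (Y i \<omega>))" for i
    using trig_poly_integrable[OF M Y] trig_poly_add(1,2) by auto
  ultimately show ?case
    using tendsto_add[OF trig_poly_add(3,4)] by simp
qed

text \<open>The shape of the estimates in Levy's theorem and in the mapping theorem:
  \<open>d\<close> is the error on the good event, \<open>C\<close> a crude bound on the tail event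
  \<open>A\<close>.\<close>

lemma (in prob_space) integral_diff_le_off_event:
  fixes f g :: "'a \<Rightarrow> real"
  assumes "integrable M f" "integrable M g" "A \<in> events" "0 \<le> C"
    and "\<And>\<omega>. \<omega> \<in> space M \<Longrightarrow> \<bar>f \<omega> - g \<omega>\<bar> \<le> d + C * indicator A \<omega>"
  shows "\<bar>(\<integral>\<omega>. f \<omega> \<partial>M) - (\<integral>\<omega>. g \<omega> \<partial>M)\<bar> \<le> d + C * prob A"
proof -
  have "\<bar>(\<integral>\<omega>. f \<omega> \<partial>M) - (\<integral>\<omega>. g \<omega> \<partial>M)\<bar> = \<bar>\<integral>\<omega>. f \<omega> - g \<omega> \<partial>M\<bar>"
    using assms by simp
  also have "\<dots> \<le> (\<integral>\<omega>. \<bar>f \<omega> - g \<omega>\<bar> \<partial>M)"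
    by (rule integral_abs_bound)
  also have "\<dots> \<le> (\<integral>\<omega>. d + C * indicator A \<omega> \<partial>M)"
  proof (rule integral_mono)
    have "integrable M (indicator A :: 'a \<Rightarrow> real)"
      using assms(3) by (intro integrable_real_indicator) (auto simp: less_top[symmetric])
    then show "integrable M (\<lambda>\<omega>. d + C * indicator A \<omega>)"
      by (intro Bochner_Integration.integrable_add integrable_const integrable_mult_right)
  qed (use assms in auto)
  also have "\<dots> = d + C * prob A"
    using assms(3) by (subst Bochner_Integration.integral_add)
      (auto simp: prob_space less_top[symmetric] intro!: integrable_mult_right)
  finally show ?thesis .
qed

text \<open>The norm is at most the sum of the absolute coordinates, so a norm above the sum of the
  radii \<open>K b\<close> forces some coordinate above its own radius. A union bound with
  \<open>e\<close> divided by the dimension finishes.\<close>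

lemma tight_of_components:
  fixes Y :: "'i \<Rightarrow> 'a \<Rightarrow> 'b::euclidean_space"
  assumes M: "prob_space M" and Y: "\<And>i. Y i \<in> borel_measurable M"
    and comp: "\<And>b e. b \<in> Basis \<Longrightarrow> e > 0 \<Longrightarrow>
      \<exists>K>0. \<forall>\<^sub>F i in F. measure M {\<omega> \<in> space M. K < \<bar>Y i \<omega> \<bullet> b\<bar>} < e"
    and e: "e > 0"
  shows "\<exists>K>0. \<forall>\<^sub>F i in F. measure M {\<omega> \<in> space M. K < norm (Y i \<omega>)} < e"
proof -
  interpret prob_space M by fact
  note [measurable] = Y
  let ?e = "e / DIM('b)"
  have "?e > 0" using e by simp
  with comp have "\<forall>b\<in>Basis. \<exists>K>0. \<forall>\<^sub>F i in F. measure M {\<omega> \<in> space M. K < \<bar>Y i \<omega> \<bullet> b\<bar>} < ?e"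
    by blast
  from bchoice[OF this] obtain K where K: "\<And>b. b \<in> Basis \<Longrightarrow> K b > 0"
    "\<And>b. b \<in> Basis \<Longrightarrow> \<forall>\<^sub>F i in F. measure M {\<omega> \<in> space M. K b < \<bar>Y i \<omega> \<bullet> b\<bar>} < ?e"
    by blast
  have sub: "{\<omega> \<in> space M. (\<Sum>b\<in>Basis. K b) < norm (Y i \<omega>)}
      \<subseteq> (\<Union>b\<in>Basis. {\<omega> \<in> space M. K b < \<bar>Y i \<omega> \<bullet> b\<bar>})" for i
  proof safe
    fix \<omega> assume *: "\<omega> \<in> space M" "(\<Sum>b\<in>Basis. K b) < norm (Y i \<omega>)"
    have "(\<Sum>b\<in>Basis. K b) < (\<Sum>b\<in>Basis. \<bar>Y i \<omega> \<bullet> b\<bar>)"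
      using *(2) norm_le_l1[of "Y i \<omega>"] by linarith
    then have "\<exists>b\<in>Basis. K b < \<bar>Y i \<omega> \<bullet> b\<bar>"
      by (meson not_less sum_mono)
    then show "\<omega> \<in> (\<Union>b\<in>Basis. {\<omega> \<in> space M. K b < \<bar>Y i \<omega> \<bullet> b\<bar>})"
      using *(1) by auto
  qed
  have "\<forall>\<^sub>F i in F. \<forall>b\<in>Basis. measure M {\<omega> \<in> space M. K b < \<bar>Y i \<omega> \<bullet> b\<bar>} < ?e"
    using K(2) by (intro eventually_ball_finite) auto
  then have "\<forall>\<^sub>F i in F. measure M {\<omega> \<in> space M. (\<Sum>b\<in>Basis. K b) < norm (Y i \<omega>)} < e"
  proof eventually_elim
    case (elim i)
    have "measure M {\<omega> \<in> space M. (\<Sum>b\<in>Basis. K b) < norm (Y i \<omega>)}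
        \<le> measure M (\<Union>b\<in>Basis. {\<omega> \<in> space M. K b < \<bar>Y i \<omega> \<bullet> b\<bar>})"
      by (intro finite_measure_mono sub sets.finite_UN) auto
    also have "\<dots> \<le> (\<Sum>b\<in>Basis. measure M {\<omega> \<in> space M. K b < \<bar>Y i \<omega> \<bullet> b\<bar>})"
      by (intro finite_measure_subadditive_finite) auto
    also have "\<dots> < (\<Sum>b\<in>(Basis::'b set). ?e)"
      using elim by (intro sum_strict_mono) auto
    also have "\<dots> = e" by simp
    finally show ?case .
  qed
  moreover have "(\<Sum>b\<in>Basis. K b) > 0" using K(1) by (intro sum_pos) auto
  ultimately show ?thesis by blast
qed

text \<open>Turns the polynomial provided by Stone-Weierstrass, evaluated at coordinatewise sines,
  into a trigonometric polynomial.\<close>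

lemma trig_poly_real_polynomial:
  fixes s :: "'b::euclidean_space \<Rightarrow> 'c::euclidean_space"
  assumes "real_polynomial_function p" "\<And>b. b \<in> Basis \<Longrightarrow> trig_poly (\<lambda>x. s x \<bullet> b)"
  shows "trig_poly (\<lambda>x. p (s x))"
  using assms(1)
proof (induction rule: real_polynomial_function.induct)
  case (linear f)
  then interpret bounded_linear f .
  have "f (s x) = (\<Sum>b\<in>Basis. f b * (s x \<bullet> b))" for x
    by (subst euclidean_representation[symmetric]) (simp add: sum scaleR mult.commute)
  then show ?case
    by (simp only:) (intro trig_poly_sum trig_poly_mult trig_poly_const assms(2))
qed (auto intro: trig_poly_const trig_poly_add trig_poly_mult)

text \<open>The error outside the ball costs only the uniform bound of \<open>f\<close>: \<open>f\<close> is composed with a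
  triangle wave that is the identity on the ball, the wave being the arcsine of a sine.\<close>

lemma trig_poly_approx:
  fixes f :: "'b::euclidean_space \<Rightarrow> real"
  assumes cont: "continuous_on UNIV f" and B: "\<And>x. \<bar>f x\<bar> \<le> B" and K: "K > 0" and d: "d > 0"
  shows "\<exists>q. trig_poly q \<and> (\<forall>x. \<bar>f x - q x\<bar> \<le> d + 2 * B * indicator {x. K < norm x} x)"
proof -
  \<comment> \<open>The variable \<open>u\<close> stands for the vector of sines. The factor
    \<open>2 * K / pi\<close> rescales \<open>[-pi/2, pi/2]\<close>, the interval on which arcsine
    inverts sine, to \<open>[-K, K]\<close>, which contains every coordinate of a point of the
    ball.\<close>
  define F where "F u = f (\<Sum>b\<in>Basis. (2 * K / pi * arcsin (u \<bullet> b)) *\<^sub>R b)" for u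
  define S where "S = cbox (- One :: 'b) One"
  have S: "compact S" by (simp add: S_def)
  have SD: "u \<in> S \<Longrightarrow> b \<in> Basis \<Longrightarrow> - 1 \<le> u \<bullet> b \<and> u \<bullet> b \<le> 1" for u b
    by (auto simp: S_def mem_box)
  have "continuous_on S F"
    unfolding F_def
    by (intro continuous_on_compose2[OF cont] continuous_intros) (use SD in auto)
  then obtain p where p: "real_polynomial_function p" "\<And>u. u \<in> S \<Longrightarrow> \<bar>F u - p u\<bar> < d"
    using Stone_Weierstrass_real_polynomial_function[OF S _ d] by blast
  define s :: "'b \<Rightarrow> 'b" where "s x = (\<Sum>b\<in>Basis. sin (((pi / (2 * K)) *\<^sub>R b) \<bullet> x) *\<^sub>R b)" for x
  have sb: "s x \<bullet> b = sin (((pi / (2 * K)) *\<^sub>R b) \<bullet> x)" if "b \<in> Basis" for x b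
    using that by (simp add: s_def inner_sum_left inner_Basis if_distrib cong: if_cong)
  have q: "trig_poly (\<lambda>x. p (s x))"
  proof (rule trig_poly_real_polynomial[OF p(1)])
    fix b :: 'b assume "b \<in> Basis"
    then show "trig_poly (\<lambda>x. s x \<bullet> b)"
      using trig_poly_sin[of 1 "(pi / (2 * K)) *\<^sub>R b"] by (simp only: sb mult_1_left)
  qed
  have "s x \<in> S" for x by (auto simp: S_def mem_box sb simp del: inner_scaleR_left)
  then have 1: "\<bar>F (s x) - p (s x)\<bar> \<le> d" for x using p(2) less_imp_le by blast
  have 2: "F (s x) = f x" if "norm x \<le> K" for x
  proof -
    have "2 * K / pi * arcsin (s x \<bullet> b) = x \<bullet> b" if b: "b \<in> Basis" for b
    proof -
      have "\<bar>x \<bullet> b\<bar> \<le> K" using \<open>norm x \<le> K\<close> Basis_le_norm[OF b, of x] by linarith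
      then have "\<bar>pi / (2 * K) * (x \<bullet> b)\<bar> \<le> pi / 2"
        using K by (simp add: abs_mult field_simps)
      then have "arcsin (sin (pi / (2 * K) * (x \<bullet> b))) = pi / (2 * K) * (x \<bullet> b)"
        by (intro arcsin_sin) linarith+
      moreover have "s x \<bullet> b = sin (pi / (2 * K) * (x \<bullet> b))"
        by (subst sb[OF b]) (simp add: inner_commute)
      moreover have "2 * K / pi * (pi / (2 * K) * (x \<bullet> b)) = x \<bullet> b"
        using K by simp
      ultimately show ?thesis by (simp only:)
    qed
    then show ?thesis by (simp add: F_def euclidean_representation cong: sum.cong)
  qed
  have 3: "\<bar>F u\<bar> \<le> B" for u by (simp add: F_def B)
  have "\<bar>f x - p (s x)\<bar> \<le> d + 2 * B * indicator {x. K < norm x} x" for x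
    using 1[of x] 2[of x] 3[of "s x"] B[of x] by (auto simp: indicator_def)
  with q show ?thesis by blast
qed

text \<open>Levy's continuity theorem in finite dimension. A coordinate has the characteristic
  function at frequencies \<open>t *\<^sub>R b\<close>, so the one-dimensional theorem makes it
  tight. Outside a large ball the mass is then small both for \<open>Y i\<close> and for
  \<open>N\<close>, and inside it a trigonometric polynomial replaces \<open>f\<close>.\<close>

lemma conv_in_dist_charI:
  fixes Y :: "nat \<Rightarrow> 'a \<Rightarrow> 'b::euclidean_space" and N :: "'b measure"
  assumes M: "prob_space M" and N: "prob_space N" "sets N = sets borel"
    and Y: "\<And>i. Y i \<in> borel_measurable M"
    and cf: "\<And>t. (\<lambda>i. \<integral>\<omega>. cis (t \<bullet> Y i \<omega>) \<partial>M) \<longlonglongrightarrow> (\<integral>y. cis (t \<bullet> y) \<partial>N)"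
  shows "conv_in_dist M Y sequentially N"
  unfolding conv_in_dist_def
proof (intro conjI allI impI)
  interpret M: prob_space M by fact
  interpret N: prob_space N by fact
  note [measurable] = Y
  have id: "(\<lambda>x. x) \<in> measurable N borel" using N(2) by (simp add: measurable_ident_sets)
  have tight: "\<exists>K>0. \<forall>\<^sub>F i in sequentially. measure M {\<omega> \<in> space M. K < norm (Y i \<omega>)} < e"
    if "e > 0" for e
  proof (rule tight_of_components[OF M Y _ that])
    fix b :: 'b and e :: real assume "b \<in> Basis" and e: "e > 0"
    have m: "(\<lambda>y. y \<bullet> b) \<in> measurable N borel"
      using measurable_compose[OF id borel_measurable_inner[OF measurable_ident borel_measurable_const]]
      by simp
    have "conv_in_dist M (\<lambda>i \<omega>. Y i \<omega> \<bullet> b) sequentially (distr N borel (\<lambda>y. y \<bullet> b))"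
    proof (rule conv_in_dist_1d[OF M N.prob_space_distr[OF m]])
      fix t :: real
      have "(\<lambda>x. cis (t * x)) \<in> borel_measurable borel"
        by (intro borel_measurable_continuous_onI continuous_intros)
      then have "(\<integral>y. cis (t * y) \<partial>distr N borel (\<lambda>y. y \<bullet> b)) = (\<integral>y. cis ((t *\<^sub>R b) \<bullet> y) \<partial>N)"
        by (subst integral_distr[OF m]) (auto simp: inner_commute)
      then show "(\<lambda>i. \<integral>\<omega>. cis (t * (Y i \<omega> \<bullet> b)) \<partial>M) \<longlonglongrightarrow> (\<integral>y. cis (t * y) \<partial>distr N borel (\<lambda>y. y \<bullet> b))"
        using cf[of "t *\<^sub>R b"] by (simp add: inner_commute)
    qed auto
    from conv_in_dist_tight[OF M N.prob_space_distr[OF m] _ this e]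
    show "\<exists>K>0. \<forall>\<^sub>F i in sequentially. measure M {\<omega> \<in> space M. K < \<bar>Y i \<omega> \<bullet> b\<bar>} < e"
      by simp
  qed
  fix f :: "'b \<Rightarrow> real" assume f: "continuous_on UNIV f \<and> bounded (range f)"
  then obtain B where B: "\<And>x. \<bar>f x\<bar> \<le> B" by (auto simp: bounded_iff)
  have "B \<ge> 0" using B[of 0] by linarith
  have fm [measurable]: "f \<in> borel_measurable borel"
    using f by (intro borel_measurable_continuous_onI) auto
  show "(\<lambda>i. \<integral>\<omega>. f (Y i \<omega>) \<partial>M) \<longlonglongrightarrow> (\<integral>y. f y \<partial>N)"
  proof (rule tendstoI)
    fix e :: real assume "e > 0"
    \<comment> \<open>Error budget: replacing \<open>f\<close> by \<open>q\<close> costs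
      \<open>d + 2 * B * d\<close> under \<open>N\<close> and again under \<open>Y i\<close>, and
      the convergence for \<open>q\<close> costs less than \<open>d\<close>; the total is below
      \<open>4 * d + 4 * B * d = e\<close>.\<close>
    define d where "d = e / (4 + 4 * B)"
    have d: "d > 0" "d * (4 + 4 * B) = e"
      using \<open>e > 0\<close> \<open>B \<ge> 0\<close> by (auto simp: d_def)
    have Bd: "B * d \<ge> 0" using d(1) \<open>B \<ge> 0\<close> by simp
    obtain K1 where K1: "K1 > 0" "\<forall>\<^sub>F i in sequentially. measure M {\<omega> \<in> space M. K1 < norm (Y i \<omega>)} < d"
      using tight[OF d(1)] by blast
    obtain K2 where K2: "K2 > 0" "measure N {x. K2 < norm x} < d"
      using prob_norm_tail[OF N d(1)] by blast
    define K where "K = max K1 K2"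
    have K: "K > 0" using K1 by (simp add: K_def)
    obtain q where q: "trig_poly q" "\<And>x. \<bar>f x - q x\<bar> \<le> d + 2 * B * indicator {x. K < norm x} x"
      using trig_poly_approx[of f B K d] f B K d by auto
    note [measurable] = trig_poly_measurable[OF q(1)]
    have qN: "integrable N q"
      using trig_poly_integrable[OF N(1) id q(1)] by simp
    have fN: "integrable N f"
      using measurable_compose[OF id fm] B by (intro N.integrable_const_bound[of _ B]) auto
    have "{x. K < norm x} \<subseteq> {x. K2 < norm x}" by (auto simp: K_def)
    then have "measure N {x. K < norm x} \<le> measure N {x. K2 < norm x}"
      using N(2) by (intro N.finite_measure_mono) auto
    then have NK: "measure N {x. K < norm x} \<le> d" using K2 by simp
    have "\<bar>(\<integral>y. f y \<partial>N) - (\<integral>y. q y \<partial>N)\<bar> \<le> d + 2 * B * measure N {x. K < norm x}"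
      using N(2) q(2) \<open>B \<ge> 0\<close> by (intro N.integral_diff_le_off_event fN qN) auto
    also have "\<dots> \<le> d + 2 * B * d"
      using NK \<open>B \<ge> 0\<close> by (intro add_left_mono mult_left_mono) auto
    finally have c1: "\<bar>(\<integral>y. f y \<partial>N) - (\<integral>y. q y \<partial>N)\<bar> \<le> d + 2 * B * d" .
    have "(\<lambda>i. \<integral>\<omega>. q (Y i \<omega>) \<partial>M) \<longlonglongrightarrow> (\<integral>y. q y \<partial>N)"
      by (rule trig_poly_conv[OF M N Y cf q(1)])
    from tendstoD[OF this d(1)] K1(2)
    show "\<forall>\<^sub>F i in sequentially. dist (\<integral>\<omega>. f (Y i \<omega>) \<partial>M) (\<integral>y. f y \<partial>N) < e"
    proof eventually_elim
      case (elim i)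
      have "measure M {\<omega> \<in> space M. K < norm (Y i \<omega>)} \<le> measure M {\<omega> \<in> space M. K1 < norm (Y i \<omega>)}"
        by (intro M.finite_measure_mono) (auto simp: K_def)
      then have MK: "measure M {\<omega> \<in> space M. K < norm (Y i \<omega>)} \<le> d" using elim by simp
      have "\<bar>(\<integral>\<omega>. f (Y i \<omega>) \<partial>M) - (\<integral>\<omega>. q (Y i \<omega>) \<partial>M)\<bar>
          \<le> d + 2 * B * measure M {\<omega> \<in> space M. K < norm (Y i \<omega>)}"
      proof (rule M.integral_diff_le_off_event)
        show "integrable M (\<lambda>\<omega>. f (Y i \<omega>))"
          using B by (intro M.integrable_const_bound[of _ B]) auto
        show "integrable M (\<lambda>\<omega>. q (Y i \<omega>))" by (rule trig_poly_integrable[OF M Y q(1)])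
        show "\<bar>f (Y i \<omega>) - q (Y i \<omega>)\<bar> \<le> d + 2 * B * indicator {\<omega> \<in> space M. K < norm (Y i \<omega>)} \<omega>"
          if "\<omega> \<in> space M" for \<omega>
          using q(2)[of "Y i \<omega>"] that by (auto simp: indicator_def)
      qed (use \<open>B \<ge> 0\<close> in auto)
      also have "\<dots> \<le> d + 2 * B * d"
        using MK \<open>B \<ge> 0\<close> by (intro add_left_mono mult_left_mono) auto
      finally show ?case
        using c1 elim(1) d Bd by (simp add: dist_real_def algebra_simps)
    qed
  qed
qed (rule Y)

section \<open>Limits in two indices and mapping theorems\<close>

lemma tendsto_prod_sequentiallyI:
  fixes g :: "nat \<times> nat \<Rightarrow> 'c::topological_space"
  assumes "\<And>u v :: nat \<Rightarrow> nat. filterlim u sequentially sequentially \<Longrightarrow>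
    filterlim v sequentially sequentially \<Longrightarrow> (\<lambda>t. g (u t, v t)) \<longlonglongrightarrow> L"
  shows "(g \<longlongrightarrow> L) (sequentially \<times>\<^sub>F sequentially)"
proof (rule topological_tendstoI, rule ccontr)
  fix S assume S: "open S" "L \<in> S" "\<not> (\<forall>\<^sub>F x in sequentially \<times>\<^sub>F sequentially. g x \<in> S)"
  \<comment> \<open>If the limit fails, there are bad pairs with both indices beyond any
    \<open>N\<close>; choosing one for each \<open>N\<close> gives two sequences that tend to
    infinity and contradict the assumption.\<close>
  then have "\<forall>N. \<exists>m n. m \<ge> N \<and> n \<ge> N \<and> g (m, n) \<notin> S"
    unfolding eventually_prod_sequentially by (meson)
  then obtain u v where uv: "\<And>N. u N \<ge> N" "\<And>N. v N \<ge> N" "\<And>N. g (u N, v N) \<notin> S"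
    by metis
  have "filterlim u sequentially sequentially" "filterlim v sequentially sequentially"
    using uv(1,2) by (auto intro: filterlim_at_top_mono[OF filterlim_ident])
  from topological_tendstoD[OF assms[OF this] S(1,2)]
  show False using uv(3) by (auto simp: eventually_sequentially)
qed

text \<open>Transfers the sequential Levy theorem to the limit in both sizes: along any two
  sequences tending to infinity the characteristic functions still converge.\<close>

lemma conv_in_dist_prod_sequentiallyI:
  fixes Y :: "nat \<times> nat \<Rightarrow> 'a \<Rightarrow> 'b::euclidean_space" and N :: "'b measure"
  assumes M: "prob_space M" and N: "prob_space N" "sets N = sets borel"
    and Y: "\<And>i. Y i \<in> borel_measurable M"
    and cf: "\<And>t. ((\<lambda>i. \<integral>\<omega>. cis (t \<bullet> Y i \<omega>) \<partial>M) \<longlongrightarrow> (\<integral>y. cis (t \<bullet> y) \<partial>N)) (sequentially \<times>\<^sub>F sequentially)"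
  shows "conv_in_dist M Y (sequentially \<times>\<^sub>F sequentially) N"
  unfolding conv_in_dist_def
proof (intro conjI allI impI)
  fix f :: "'b \<Rightarrow> real" assume f: "continuous_on UNIV f \<and> bounded (range f)"
  show "((\<lambda>i. \<integral>\<omega>. f (Y i \<omega>) \<partial>M) \<longlongrightarrow> (\<integral>y. f y \<partial>N)) (sequentially \<times>\<^sub>F sequentially)"
  proof (rule tendsto_prod_sequentiallyI)
    fix u v :: "nat \<Rightarrow> nat"
    assume "filterlim u sequentially sequentially" "filterlim v sequentially sequentially"
    then have "filterlim (\<lambda>t. (u t, v t)) (sequentially \<times>\<^sub>F sequentially) sequentially"
      by (rule filterlim_Pair)
    then have "conv_in_dist M (\<lambda>t. Y (u t, v t)) sequentially N"
      by (intro conv_in_dist_charI[OF M N] Y filterlim_compose[OF cf])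
    then show "(\<lambda>t. \<integral>\<omega>. f (Y (u t, v t) \<omega>) \<partial>M) \<longlonglongrightarrow> (\<integral>y. f y \<partial>N)"
      using f by (auto simp: conv_in_dist_def)
  qed
qed (rule Y)

text \<open>A continuous mapping theorem for maps that vary with the index, as in the delta method.
  By tightness \<open>Y i\<close> stays in a ball up to small probability, and there
  \<open>G i\<close> is uniformly close to \<open>g\<close>.\<close>

lemma conv_in_dist_compose_uniform:
  fixes Y :: "'i \<Rightarrow> 'a \<Rightarrow> 'b::euclidean_space" and N :: "'b measure"
    and g :: "'b \<Rightarrow> 'c::euclidean_space"
  assumes M: "prob_space M" and N: "prob_space N" "sets N = sets borel"
    and conv: "conv_in_dist M Y F N"
    and g: "continuous_on UNIV g"
    and unif: "\<And>K. K > 0 \<Longrightarrow> uniform_limit (cball 0 K) G g F"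
    and meas: "\<And>i. (\<lambda>\<omega>. G i (Y i \<omega>)) \<in> borel_measurable M"
  shows "conv_in_dist M (\<lambda>i \<omega>. G i (Y i \<omega>)) F (distr N borel g)"
  unfolding conv_in_dist_def
proof (intro conjI allI impI)
  interpret M: prob_space M by fact
  have Y [measurable]: "Y i \<in> borel_measurable M" for i
    using conv by (rule conv_in_dist_measurable)
  fix f :: "'c \<Rightarrow> real" assume f: "continuous_on UNIV f \<and> bounded (range f)"
  then obtain B where B: "\<And>x. \<bar>f x\<bar> \<le> B" by (auto simp: bounded_iff)
  have "B \<ge> 0" using B[of 0] by linarith
  have fm [measurable]: "f \<in> borel_measurable borel"
    using f by (intro borel_measurable_continuous_onI) auto
  have gm [measurable]: "g \<in> borel_measurable borel"
    using g by (intro borel_measurable_continuous_onI) auto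
  have cfg: "continuous_on UNIV (\<lambda>x. f (g x))"
    using f g continuous_on_compose2[of UNIV f UNIV g] by auto
  have lim: "((\<lambda>i. \<integral>\<omega>. f (g (Y i \<omega>)) \<partial>M) \<longlongrightarrow> (\<integral>y. f (g y) \<partial>N)) F"
    using conv cfg B by (auto simp: conv_in_dist_def bounded_iff)
  have eq: "integral\<^sup>L (distr N borel g) f = (\<integral>y. f (g y) \<partial>N)"
    using gm N(2) by (intro integral_distr) (auto cong: measurable_cong_sets)
  show "((\<lambda>i. \<integral>\<omega>. f (G i (Y i \<omega>)) \<partial>M) \<longlongrightarrow> integral\<^sup>L (distr N borel g) f) F"
    unfolding eq
  proof (rule tendstoI)
    fix e :: real assume "e > 0"
    define d where "d = e / (4 + 4 * B)"
    have d: "d > 0" "d * (4 + 4 * B) = e"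
      using \<open>e > 0\<close> \<open>B \<ge> 0\<close> by (auto simp: d_def)
    have Bd: "B * d \<ge> 0" using d(1) \<open>B \<ge> 0\<close> by simp
    obtain K where K: "K > 0" "\<forall>\<^sub>F i in F. measure M {\<omega> \<in> space M. K < norm (Y i \<omega>)} < d"
      using conv_in_dist_tight[OF M N conv d(1)] by blast
    have "compact (g ` cball 0 K)"
      using g by (intro compact_continuous_image) (auto intro: continuous_on_subset)
    then obtain R where "\<forall>y\<in>g ` cball 0 K. norm y \<le> R"
      using compact_imp_bounded bounded_iff by blast
    then have R: "norm (g x) \<le> R" if "norm x \<le> K" for x using that by auto
    \<comment> \<open>The enlargement by 1 leaves room for \<open>G i x\<close>, which is within
      \<open>min r 1\<close> of \<open>g x\<close>.\<close>
    have "uniformly_continuous_on (cball 0 (R + 1)) f"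
      using f by (intro compact_uniformly_continuous) (auto intro: continuous_on_subset)
    then obtain r where r: "r > 0"
      "\<And>x y. x \<in> cball 0 (R + 1) \<Longrightarrow> y \<in> cball 0 (R + 1) \<Longrightarrow> dist y x < r \<Longrightarrow> dist (f y) (f x) < d"
      using d(1) unfolding uniformly_continuous_on_def by metis
    have "\<forall>\<^sub>F i in F. \<forall>x\<in>cball 0 K. dist (G i x) (g x) < min r 1"
      using uniform_limitD[OF unif[OF K(1)], of "min r 1"] r(1) by simp
    moreover have "\<forall>\<^sub>F i in F. dist (\<integral>\<omega>. f (g (Y i \<omega>)) \<partial>M) (\<integral>y. f (g y) \<partial>N) < d"
      using lim d(1) by (rule tendstoD)
    ultimately show "\<forall>\<^sub>F i in F. dist (\<integral>\<omega>. f (G i (Y i \<omega>)) \<partial>M) (\<integral>y. f (g y) \<partial>N) < e"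
      using K(2)
    proof eventually_elim
      case (elim i)
      have close: "\<bar>f (G i x) - f (g x)\<bar> \<le> d" if "norm x \<le> K" for x
      proof -
        have "dist (G i x) (g x) < min r 1" using elim(1) that by auto
        moreover have "norm (G i x) \<le> norm (g x) + dist (G i x) (g x)"
          by (simp add: dist_norm norm_triangle_sub)
        ultimately have "dist (f (G i x)) (f (g x)) < d"
          using R[OF that] by (intro r(2)) auto
        then show ?thesis by (simp add: dist_real_def)
      qed
      have "\<bar>(\<integral>\<omega>. f (G i (Y i \<omega>)) \<partial>M) - (\<integral>\<omega>. f (g (Y i \<omega>)) \<partial>M)\<bar>
          \<le> d + 2 * B * measure M {\<omega> \<in> space M. K < norm (Y i \<omega>)}"
      proof (rule M.integral_diff_le_off_event)
        show "integrable M (\<lambda>\<omega>. f (G i (Y i \<omega>)))"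
          using measurable_compose[OF meas fm] B by (intro M.integrable_const_bound[of _ B]) auto
        show "integrable M (\<lambda>\<omega>. f (g (Y i \<omega>)))"
          using B by (intro M.integrable_const_bound[of _ B]) auto
        show "\<bar>f (G i (Y i \<omega>)) - f (g (Y i \<omega>))\<bar>
            \<le> d + 2 * B * indicator {\<omega> \<in> space M. K < norm (Y i \<omega>)} \<omega>" if "\<omega> \<in> space M" for \<omega>
          using close[of "Y i \<omega>"] B[of "G i (Y i \<omega>)"] B[of "g (Y i \<omega>)"] d(1) that
          by (auto simp: indicator_def not_less)
      qed (use \<open>B \<ge> 0\<close> in auto)
      also have "\<dots> \<le> d + 2 * B * d"
        using elim(3) \<open>B \<ge> 0\<close> by (intro add_left_mono mult_left_mono) auto
      finally show ?case
        using elim(2) d Bd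
        by (simp add: dist_real_def algebra_simps)
    qed
  qed
qed (rule meas)

lemma conv_in_dist_compose:
  fixes Y :: "'i \<Rightarrow> 'a \<Rightarrow> 'b::topological_space" and g :: "'b \<Rightarrow> 'c::topological_space"
  assumes N: "sets N = sets borel" and conv: "conv_in_dist M Y F N" and g: "continuous_on UNIV g"
  shows "conv_in_dist M (\<lambda>i \<omega>. g (Y i \<omega>)) F (distr N borel g)"
  unfolding conv_in_dist_def
proof (intro conjI allI impI)
  have gm: "g \<in> borel_measurable borel"
    using g by (rule borel_measurable_continuous_onI)
  show "(\<lambda>\<omega>. g (Y i \<omega>)) \<in> borel_measurable M" for i
    using conv_in_dist_measurable[OF conv] gm by (rule measurable_compose)
  fix f :: "'c \<Rightarrow> real" assume f: "continuous_on UNIV f \<and> bounded (range f)"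
  have "integral\<^sup>L (distr N borel g) f = (\<integral>y. f (g y) \<partial>N)"
    using gm N f borel_measurable_continuous_onI[of f]
    by (intro integral_distr) (auto cong: measurable_cong_sets)
  moreover have "continuous_on UNIV (\<lambda>x. f (g x))"
    using f g continuous_on_compose2[of UNIV f UNIV g] by auto
  moreover have "bounded (range (\<lambda>x. f (g x)))"
    using f by (auto intro: bounded_subset)
  ultimately show "((\<lambda>i. \<integral>\<omega>. f (g (Y i \<omega>)) \<partial>M) \<longlongrightarrow> integral\<^sup>L (distr N borel g) f) F"
    using conv by (auto simp: conv_in_dist_def)
qed

section \<open>Exponential families\<close>

text \<open>Everything is dominated by \<open>exp (h * x) + exp (- h * x)\<close>, which exceeds
  \<open>exp (h * \<bar>x\<bar>)\<close>: each power up to a constant, and all partial sums of the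
  series of absolute values of the terms of \<open>exp (s * x)\<close>. Hence sum and integral may
  be exchanged.\<close>

lemma mgf_power_series:
  fixes P :: "real measure"
  assumes P: "sets P = sets borel" and h: "h > 0"
    and int: "integrable P (\<lambda>x. exp (h * x))" "integrable P (\<lambda>x. exp (- h * x))"
  shows "integrable P (\<lambda>x. x ^ n)"
    and "\<bar>s\<bar> \<le> h \<Longrightarrow> (\<lambda>n. (\<integral>x. x ^ n \<partial>P) / fact n * s ^ n) sums (\<integral>x. exp (s * x) \<partial>P)"
proof -
  have [measurable]: "(\<lambda>x. x) \<in> borel_measurable P"
    using P by (simp add: measurable_ident_sets)
  have intE: "integrable P (\<lambda>x. exp (h * x) + exp (- h * x))"
    using int by simp
  have exp_abs: "exp (h * \<bar>x\<bar>) \<le> exp (h * x) + exp (- h * x)" for x :: real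
    by (cases "x \<ge> 0") auto
  have term_le: "y ^ n / fact n \<le> exp y" if "y \<ge> 0" for y :: real and n
  proof -
    have "(\<Sum>k\<in>{n}. y ^ k /\<^sub>R fact k) \<le> (\<Sum>k. y ^ k /\<^sub>R fact k)"
      using that by (intro sum_le_suminf summable_exp_generic) auto
    then show ?thesis by (simp add: exp_def divide_inverse mult.commute)
  qed
  have bound: "\<bar>x\<bar> ^ n \<le> fact n / h ^ n * (exp (h * x) + exp (- h * x))" for x n
  proof -
    have "(h * \<bar>x\<bar>) ^ n / fact n \<le> exp (h * x) + exp (- h * x)"
      using term_le[of "h * \<bar>x\<bar>" n] exp_abs[of x] h by auto
    then show ?thesis using h by (simp add: power_mult_distrib field_simps)
  qed
  show int_pow: "integrable P (\<lambda>x. x ^ n)" for n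
  proof (rule Bochner_Integration.integrable_bound)
    show "integrable P (\<lambda>x. fact n / h ^ n * (exp (h * x) + exp (- h * x)))"
      using intE by (rule integrable_mult_right)
    show "AE x in P. norm (x ^ n) \<le> norm (fact n / h ^ n * (exp (h * x) + exp (- h * x)))"
    proof (rule AE_I2)
      fix x
      show "norm (x ^ n) \<le> norm (fact n / h ^ n * (exp (h * x) + exp (- h * x)))"
        using bound[of x n] unfolding real_norm_def power_abs by linarith
    qed
  qed measurable
  assume s: "\<bar>s\<bar> \<le> h"
  let ?f = "\<lambda>n x. (s * x) ^ n / fact n"
  have sm: "summable (\<lambda>n. norm (?f n x))" for x
    using summable_norm_exp[of "s * x"] by (simp add: divide_inverse mult.commute)
  have fsums: "(\<lambda>n. ?f n x) sums exp (s * x)" for x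
    using exp_converges[of "s * x"] by (simp add: divide_inverse mult.commute)
  have fint: "integrable P (?f n)" for n
    using int_pow[of n] by (simp add: power_mult_distrib)
  have "summable (\<lambda>n. \<integral>x. norm (?f n x) \<partial>P)"
  proof (rule summableI_nonneg_bounded)
    fix n
    have "(\<Sum>i<n. \<integral>x. norm (?f i x) \<partial>P) = (\<integral>x. (\<Sum>i<n. norm (?f i x)) \<partial>P)"
      using fint by (intro Bochner_Integration.integral_sum[symmetric] integrable_norm)
    also have "\<dots> \<le> (\<integral>x. exp (h * x) + exp (- h * x) \<partial>P)"
    proof (rule integral_mono)
      show "integrable P (\<lambda>x. \<Sum>i<n. norm (?f i x))"
        using fint by (intro Bochner_Integration.integrable_sum integrable_norm)
      fix x
      have "(\<Sum>i<n. norm (?f i x)) \<le> (\<Sum>i. norm (?f i x))"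
        by (intro sum_le_suminf sm) auto
      also have "\<dots> = exp \<bar>s * x\<bar>"
        using exp_converges[of "\<bar>s * x\<bar>"]
        by (simp add: sums_iff divide_inverse mult.commute abs_mult power_abs)
      also have "\<dots> \<le> exp (h * \<bar>x\<bar>)"
        using s by (simp add: abs_mult mult_right_mono)
      finally show "(\<Sum>i<n. norm (?f i x)) \<le> exp (h * x) + exp (- h * x)"
        using exp_abs[of x] by linarith
    qed (rule intE)
    finally show "(\<Sum>i<n. \<integral>x. norm (?f i x) \<partial>P) \<le> (\<integral>x. exp (h * x) + exp (- h * x) \<partial>P)" .
  qed auto
  then have "(\<lambda>n. \<integral>x. ?f n x \<partial>P) sums (\<integral>x. (\<Sum>n. ?f n x) \<partial>P)"
    using fint sm by (intro sums_integral) auto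
  moreover have "(\<Sum>n. ?f n x) = exp (s * x)" for x
    using fsums[of x] by (simp add: sums_iff)
  moreover have "(\<integral>x. ?f n x \<partial>P) = (\<integral>x. x ^ n \<partial>P) / fact n * s ^ n" for n
    by (simp add: power_mult_distrib)
  ultimately show "(\<lambda>n. (\<integral>x. x ^ n \<partial>P) / fact n * s ^ n) sums (\<integral>x. exp (s * x) \<partial>P)"
    by simp
qed

text \<open>The witness is the termwise derivative of the moment series. It has to be the derivative
  on a whole neighbourhood of 0, because its own derivative at 0 yields the second moment.\<close>

lemma mgf_derivatives:
  fixes P :: "real measure"
  assumes P: "sets P = sets borel" and h: "h > 0"
    and int: "integrable P (\<lambda>x. exp (h * x))" "integrable P (\<lambda>x. exp (- h * x))"
  shows "\<exists>m'. (\<forall>s. \<bar>s\<bar> < h \<longrightarrow> ((\<lambda>s. \<integral>x. exp (s * x) \<partial>P) has_real_derivative m' s) (at s)) \<and>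
    m' 0 = (\<integral>x. x \<partial>P) \<and> (m' has_real_derivative (\<integral>x. x\<^sup>2 \<partial>P)) (at 0)"
proof -
  define c where "c n = (\<integral>x. x ^ n \<partial>P) / fact n" for n
  define m' where "m' s = (\<Sum>n. diffs c n * s ^ n)" for s
  have sums: "(\<lambda>n. c n * s ^ n) sums (\<integral>x. exp (s * x) \<partial>P)" if "\<bar>s\<bar> \<le> h" for s
    unfolding c_def by (rule mgf_power_series(2)[OF P h int that])
  have smb: "summable (\<lambda>n. c n * s ^ n)" if "norm s < h" for s
    using sums[of s] that by (auto simp: sums_iff)
  have "((\<lambda>s. \<integral>x. exp (s * x) \<partial>P) has_real_derivative m' s) (at s)" if s: "\<bar>s\<bar> < h" for s
  proof -
    have "((\<lambda>s. \<Sum>n. c n * s ^ n) has_real_derivative m' s) (at s)"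
      unfolding m'_def by (rule termdiffs_strong'[of h]) (use smb s in auto)
    then show ?thesis
    proof (rule has_field_derivative_transform_within_open[of _ _ _ "ball 0 h"])
      show "(\<Sum>n. c n * t ^ n) = (\<integral>x. exp (t * x) \<partial>P)" if "t \<in> ball 0 h" for t
        using sums[of t] that by (auto simp: sums_iff)
    qed (use s in auto)
  qed
  moreover have "m' 0 = diffs c 0" unfolding m'_def by (rule powser_zero)
  then have "m' 0 = (\<integral>x. x \<partial>P)" by (simp add: diffs_def c_def)
  moreover have "(m' has_real_derivative (\<integral>x. x\<^sup>2 \<partial>P)) (at 0)"
  proof -
    have "summable (\<lambda>n. diffs c n * s ^ n)" if "norm s < h" for s
      using that by (rule termdiff_converges) (rule smb)
    then have "(m' has_real_derivative (\<Sum>n. diffs (diffs c) n * 0 ^ n)) (at 0)"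
      unfolding m'_def by (intro termdiffs_strong'[of h]) (use h in auto)
    then have "(m' has_real_derivative diffs (diffs c) 0) (at 0)"
      by (simp only: powser_zero)
    then show ?thesis by (simp add: diffs_def c_def numeral_2_eq_2)
  qed
  ultimately show ?thesis by blast
qed

section \<open>Mean, variance and inverse mean map of an exponential family\<close>

locale ef =
  fixes \<mu> :: "real measure" and b \<psi> :: "real \<Rightarrow> real" and A :: "real set"
  assumes family: "exponential_family \<mu> b \<psi> A"
    and inj_law: "inj_on (ef_law \<mu> b \<psi>) A"
begin

abbreviation law :: "real \<Rightarrow> real measure" where "law \<equiv> ef_law \<mu> b \<psi>"

abbreviation mean :: "real \<Rightarrow> real" where "mean \<alpha> \<equiv> \<integral>x. x \<partial>law \<alpha>"

lemma sets_law [simp]: "sets (law \<alpha>) = sets borel"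
  using family by (simp add: exponential_family_def ef_law_def)

lemma space_law [simp]: "space (law \<alpha>) = UNIV"
  using sets_eq_imp_space_eq[OF sets_law] by simp

lemma measurable_law [simp]: "measurable (law \<alpha>) N = measurable borel N"
  by (rule measurable_cong_sets) auto

lemma prob_space_law: "\<alpha> \<in> A \<Longrightarrow> prob_space (law \<alpha>)"
  using family by (simp add: exponential_family_def)

text \<open>Exponential tilting. It expresses one member of the family through another, so that the
  later arguments no longer refer to \<open>b\<close> and \<open>\<mu>\<close>.\<close>

lemma law_change:
  "law \<beta> = density (law \<alpha>) (\<lambda>x. ennreal (exp ((\<beta> - \<alpha>) * x - (\<psi> \<beta> - \<psi> \<alpha>))))"
proof -
  have [measurable]: "b \<in> borel_measurable \<mu>" "(\<lambda>x. x) \<in> borel_measurable \<mu>"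
    using family by (auto simp: exponential_family_def measurable_ident_sets cong: measurable_cong_sets)
  have b: "b x \<ge> 0" for x using family by (simp add: exponential_family_def)
  have "ef_density b \<psi> x \<beta> = ef_density b \<psi> x \<alpha> * exp ((\<beta> - \<alpha>) * x - (\<psi> \<beta> - \<psi> \<alpha>))" for x
    by (simp add: ef_density_def algebra_simps flip: exp_add)
  then have "(\<lambda>x. ennreal (ef_density b \<psi> x \<beta>)) = (\<lambda>x. ennreal (ef_density b \<psi> x \<alpha>) *
      ennreal (exp ((\<beta> - \<alpha>) * x - (\<psi> \<beta> - \<psi> \<alpha>))))"
    using b by (auto simp: ef_density_def simp flip: ennreal_mult)
  moreover have "(\<lambda>x. ennreal (ef_density b \<psi> x \<alpha>)) \<in> borel_measurable \<mu>"
    unfolding ef_density_def by measurable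
  ultimately show ?thesis
    unfolding ef_law_def by (subst density_density_eq) auto
qed

lemma integrable_law_change:
  "f \<in> borel_measurable borel \<Longrightarrow> integrable (law \<beta>) (f :: real \<Rightarrow> real) \<longleftrightarrow>
    integrable (law \<alpha>) (\<lambda>x. exp ((\<beta> - \<alpha>) * x - (\<psi> \<beta> - \<psi> \<alpha>)) * f x)"
  by (subst law_change[of \<beta> \<alpha>], subst integrable_density) auto

lemma integral_law_change:
  "f \<in> borel_measurable borel \<Longrightarrow> integral\<^sup>L (law \<beta>) (f :: real \<Rightarrow> real) =
    (\<integral>x. exp ((\<beta> - \<alpha>) * x - (\<psi> \<beta> - \<psi> \<alpha>)) * f x \<partial>law \<alpha>)"
  by (subst law_change[of \<beta> \<alpha>], subst integral_density) auto

text \<open>After tilting, the normalisation at \<open>\<beta>\<close> is the value at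
  \<open>\<beta> - \<alpha>\<close> of the moment generating function of
  \<open>law \<alpha>\<close>.\<close>

lemma mgf_law:
  assumes "\<beta> \<in> A"
  shows "integrable (law \<alpha>) (\<lambda>x. exp ((\<beta> - \<alpha>) * x))"
    and "(\<integral>x. exp ((\<beta> - \<alpha>) * x) \<partial>law \<alpha>) = exp (\<psi> \<beta> - \<psi> \<alpha>)"
proof -
  interpret prob_space "law \<beta>" using assms by (rule prob_space_law)
  have e: "exp ((\<beta> - \<alpha>) * x) = exp (\<psi> \<beta> - \<psi> \<alpha>) * (exp ((\<beta> - \<alpha>) * x - (\<psi> \<beta> - \<psi> \<alpha>)) * 1)" for x
    by (simp flip: exp_add)
  have "integrable (law \<beta>) (\<lambda>x. 1 :: real)" by simp
  then have "integrable (law \<alpha>) (\<lambda>x. exp ((\<beta> - \<alpha>) * x - (\<psi> \<beta> - \<psi> \<alpha>)) * 1)"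
    by (subst (asm) integrable_law_change[of _ _ \<alpha>]) auto
  then show "integrable (law \<alpha>) (\<lambda>x. exp ((\<beta> - \<alpha>) * x))"
    unfolding e by (rule integrable_mult_right)
  have "(\<integral>x. exp ((\<beta> - \<alpha>) * x - (\<psi> \<beta> - \<psi> \<alpha>)) * 1 \<partial>law \<alpha>) = integral\<^sup>L (law \<beta>) (\<lambda>x. 1 :: real)"
    by (rule integral_law_change[symmetric]) auto
  then show "(\<integral>x. exp ((\<beta> - \<alpha>) * x) \<partial>law \<alpha>) = exp (\<psi> \<beta> - \<psi> \<alpha>)"
    unfolding e using prob_space by simp
qed

text \<open>Near an interior point, the increment of \<open>\<psi>\<close> is the logarithm of the
  moment generating function \<open>m\<close>, that is, the cumulant generating function. Its first
  two derivatives at 0 are the mean and the variance; smoothness of \<open>\<psi>\<close> is thus a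
  conclusion.\<close>

lemma moments:
  assumes "\<alpha> \<in> interior A"
  shows "integrable (law \<alpha>) (\<lambda>x. x ^ n)"
    and "(\<psi> has_real_derivative mean \<alpha>) (at \<alpha>)"
    and "(deriv \<psi> has_real_derivative (\<integral>x. x\<^sup>2 \<partial>law \<alpha>) - (mean \<alpha>)\<^sup>2) (at \<alpha>)"
proof -
  obtain r where r: "r > 0" "cball \<alpha> r \<subseteq> A"
    using assms by (meson mem_interior_cball)
  have inA: "\<alpha> + s \<in> A" if "\<bar>s\<bar> \<le> r" for s
    using that r(2) by (intro subsetD[OF r(2)]) (auto simp: dist_real_def)
  have int: "integrable (law \<alpha>) (\<lambda>x. exp (r * x))" "integrable (law \<alpha>) (\<lambda>x. exp (- r * x))"
    using mgf_law(1)[OF inA[of r], of \<alpha>] mgf_law(1)[OF inA[of "- r"], of \<alpha>] r(1) by auto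
  show "integrable (law \<alpha>) (\<lambda>x. x ^ n)"
    by (rule mgf_power_series(1)[OF _ r(1) int]) simp
  define m where "m s = (\<integral>x. exp (s * x) \<partial>law \<alpha>)" for s
  obtain m' where m': "\<And>s. \<bar>s\<bar> < r \<Longrightarrow> (m has_real_derivative m' s) (at s)"
    "m' 0 = mean \<alpha>" "(m' has_real_derivative (\<integral>x. x\<^sup>2 \<partial>law \<alpha>)) (at 0)"
    using mgf_derivatives[OF sets_law r(1) int] unfolding m_def by blast
  have m: "m s = exp (\<psi> (\<alpha> + s) - \<psi> \<alpha>)" if "\<bar>s\<bar> \<le> r" for s
    using mgf_law(2)[OF inA[OF that], of \<alpha>] by (simp add: m_def)
  \<comment> \<open>Needed at every nearby point and not just at \<open>\<alpha>\<close>, since the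
    resulting formula for \<open>deriv \<psi>\<close> is differentiated once more.\<close>
  have psi: "(\<psi> has_real_derivative m' s / m s) (at (\<alpha> + s))" if "\<bar>s\<bar> < r" for s
  proof -
    have "m s > 0" using m[of s] that by simp
    have sh: "((\<lambda>t. m (t - \<alpha>)) has_real_derivative m' s) (at (\<alpha> + s))"
      using m'(1)[OF that] DERIV_shift[of "\<lambda>t. m (t - \<alpha>)" "m' s" s \<alpha>] by (simp add: add.commute)
    have "((\<lambda>t. ln (m (t - \<alpha>)) + \<psi> \<alpha>) has_real_derivative m' s / m s) (at (\<alpha> + s))"
      using \<open>m s > 0\<close> by (auto intro!: derivative_eq_intros sh simp: divide_inverse)
    then show ?thesis
    proof (rule has_field_derivative_transform_within_open[of _ _ _ "ball \<alpha> r"])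
      show "ln (m (t - \<alpha>)) + \<psi> \<alpha> = \<psi> t" if "t \<in> ball \<alpha> r" for t
        using m[of "t - \<alpha>"] that by (auto simp: dist_real_def)
    qed (use that in \<open>auto simp: dist_real_def\<close>)
  qed
  have m0: "m 0 = 1" using m[of 0] r(1) by simp
  show "(\<psi> has_real_derivative mean \<alpha>) (at \<alpha>)"
    using psi[of 0] r(1) m0 m'(2) by simp
  have "((\<lambda>s. m' s / m s) has_real_derivative (\<integral>x. x\<^sup>2 \<partial>law \<alpha>) - (mean \<alpha>)\<^sup>2) (at 0)"
    using m'(1)[of 0] m'(2,3) r(1) m0
    by (auto intro!: derivative_eq_intros simp: power2_eq_square)
  then have "((\<lambda>t. m' (t - \<alpha>) / m (t - \<alpha>)) has_real_derivative (\<integral>x. x\<^sup>2 \<partial>law \<alpha>) - (mean \<alpha>)\<^sup>2) (at \<alpha>)"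
    using DERIV_shift[of "\<lambda>t. m' (t - \<alpha>) / m (t - \<alpha>)" _ 0 \<alpha>] by simp
  then show "(deriv \<psi> has_real_derivative (\<integral>x. x\<^sup>2 \<partial>law \<alpha>) - (mean \<alpha>)\<^sup>2) (at \<alpha>)"
  proof (rule has_field_derivative_transform_within_open[of _ _ _ "ball \<alpha> r"])
    show "m' (t - \<alpha>) / m (t - \<alpha>) = deriv \<psi> t" if "t \<in> ball \<alpha> r" for t
      using psi[of "t - \<alpha>"] that by (auto simp: dist_real_def intro!: DERIV_imp_deriv[symmetric])
  qed (use r(1) in auto)
qed

lemma deriv_psi: "\<alpha> \<in> interior A \<Longrightarrow> deriv \<psi> \<alpha> = mean \<alpha>"
  by (intro DERIV_imp_deriv moments)

lemma integrable_id: "\<alpha> \<in> interior A \<Longrightarrow> integrable (law \<alpha>) (\<lambda>x. x)"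
  using moments(1)[of \<alpha> 1] by simp

text \<open>The product \<open>(\<beta> - \<alpha>) (mean \<beta> - mean \<alpha>)\<close> is the symmetrised relative entropy of the two laws.
  No path from \<open>\<alpha>\<close> to \<open>\<beta>\<close> inside \<open>A\<close> is needed, so \<open>A\<close> may be disconnected.\<close>

lemma mean_strict_mono:
  assumes \<alpha>: "\<alpha> \<in> interior A" and \<beta>: "\<beta> \<in> interior A" and ne: "\<alpha> \<noteq> \<beta>"
  shows "(\<beta> - \<alpha>) * (mean \<beta> - mean \<alpha>) > 0"
proof -
  have A: "\<alpha> \<in> A" "\<beta> \<in> A" using \<alpha> \<beta> interior_subset by auto
  interpret a: prob_space "law \<alpha>" by (rule prob_space_law) fact
  interpret b: prob_space "law \<beta>" by (rule prob_space_law) fact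
  \<comment> \<open>The log-likelihood ratio of \<open>law \<beta>\<close> to
    \<open>law \<alpha>\<close>. The integrand \<open>u x * (exp (u x) - 1)\<close> is nonnegative
    and vanishes only where \<open>u x = 0\<close>; a zero integral would make the two laws equal,
    against the injectivity of the parametrisation.\<close>
  define u where "u x = (\<beta> - \<alpha>) * x - (\<psi> \<beta> - \<psi> \<alpha>)" for x
  have um [measurable]: "u \<in> borel_measurable borel"
    unfolding u_def by measurable
  have ia: "integrable (law \<alpha>) u" and ib: "integrable (law \<beta>) u"
    unfolding u_def using integrable_id[OF \<alpha>] integrable_id[OF \<beta>] by auto
  have ic: "integrable (law \<alpha>) (\<lambda>x. exp (u x) * u x)"
    using ib by (subst (asm) integrable_law_change[of _ _ \<alpha>]) (auto simp: u_def)
  have eq: "(\<integral>x. u x * (exp (u x) - 1) \<partial>law \<alpha>) = (\<beta> - \<alpha>) * (mean \<beta> - mean \<alpha>)"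
  proof -
    have "(\<integral>x. u x * (exp (u x) - 1) \<partial>law \<alpha>) = (\<integral>x. exp (u x) * u x - u x \<partial>law \<alpha>)"
      by (simp add: algebra_simps)
    also have "\<dots> = (\<integral>x. exp (u x) * u x \<partial>law \<alpha>) - (\<integral>x. u x \<partial>law \<alpha>)"
      using ia ic by simp
    also have "(\<integral>x. exp (u x) * u x \<partial>law \<alpha>) = (\<integral>x. u x \<partial>law \<beta>)"
      using integral_law_change[OF um, of \<beta> \<alpha>] by (simp add: u_def[symmetric])
    also have "(\<integral>x. u x \<partial>law \<beta>) - (\<integral>x. u x \<partial>law \<alpha>) = (\<beta> - \<alpha>) * (mean \<beta> - mean \<alpha>)"
      unfolding u_def using integrable_id[OF \<alpha>] integrable_id[OF \<beta>]
      using a.prob_space b.prob_space by (simp add: algebra_simps)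
    finally show ?thesis .
  qed
  have int: "integrable (law \<alpha>) (\<lambda>x. u x * (exp (u x) - 1))"
    using Bochner_Integration.integrable_diff[OF ic ia] by (simp add: algebra_simps)
  have nn: "v * (exp v - 1) \<ge> 0" for v :: real
    by (cases "v \<ge> 0") (auto intro!: mult_nonneg_nonneg mult_nonpos_nonpos)
  have "(\<integral>x. u x * (exp (u x) - 1) \<partial>law \<alpha>) \<noteq> 0"
  proof
    assume "(\<integral>x. u x * (exp (u x) - 1) \<partial>law \<alpha>) = 0"
    then have "AE x in law \<alpha>. u x * (exp (u x) - 1) = 0"
      using integral_nonneg_eq_0_iff_AE[OF int] nn by auto
    then have "AE x in law \<alpha>. ennreal (exp (u x)) = 1" by eventually_elim auto
    then have "density (law \<alpha>) (\<lambda>x. ennreal (exp (u x))) = density (law \<alpha>) (\<lambda>x. 1)"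
      by (intro density_cong) auto
    then have "law \<beta> = law \<alpha>"
      by (simp add: law_change[of \<beta> \<alpha>] u_def density_1)
    then show False using inj_law A ne by (auto dest: inj_onD)
  qed
  moreover have "(\<integral>x. u x * (exp (u x) - 1) \<partial>law \<alpha>) \<ge> 0"
    using nn by (intro integral_nonneg_AE) auto
  ultimately show ?thesis using eq by linarith
qed

lemma law_variance:
  assumes "\<alpha> \<in> interior A"
  shows "(\<integral>x. (x - mean \<alpha>)\<^sup>2 \<partial>law \<alpha>) = deriv (deriv \<psi>) \<alpha>"
proof -
  interpret prob_space "law \<alpha>"
    using assms interior_subset by (intro prob_space_law) auto
  have "variance (\<lambda>x. x) = (\<integral>x. x\<^sup>2 \<partial>law \<alpha>) - (mean \<alpha>)\<^sup>2"
    by (rule variance_eq) (use integrable_id[OF assms] moments(1)[OF assms, of 2] in auto)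
  then show ?thesis using DERIV_imp_deriv[OF moments(3)[OF assms]] by simp
qed

text \<open>A law with variance 0 is a point mass at its mean. By tilting, a neighbouring member of
  the family is concentrated at the same point and has the same mean, which contradicts
  \<open>mean_strict_mono\<close>.\<close>

lemma variance_pos:
  assumes \<alpha>: "\<alpha> \<in> interior A"
  shows "deriv (deriv \<psi>) \<alpha> > 0"
proof -
  interpret prob_space "law \<alpha>"
    using \<alpha> interior_subset by (intro prob_space_law) auto
  have int: "integrable (law \<alpha>) (\<lambda>x. (x - mean \<alpha>)\<^sup>2)"
    unfolding power2_diff using moments(1)[OF \<alpha>, of 2] integrable_id[OF \<alpha>] by auto
  have "(\<integral>x. (x - mean \<alpha>)\<^sup>2 \<partial>law \<alpha>) \<noteq> 0"
  proof
    assume "(\<integral>x. (x - mean \<alpha>)\<^sup>2 \<partial>law \<alpha>) = 0"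
    then have ae: "AE x in law \<alpha>. x = mean \<alpha>"
      using integral_nonneg_eq_0_iff_AE[OF int] by auto
    obtain r where r: "r > 0" "ball \<alpha> r \<subseteq> interior A"
      using \<alpha> open_interior[of A] by (auto simp: open_contains_ball)
    define \<beta> where "\<beta> = \<alpha> + r / 2"
    have "\<beta> \<in> ball \<alpha> r" using r(1) by (simp add: \<beta>_def dist_real_def)
    with r have \<beta>: "\<beta> \<in> interior A" "\<beta> \<noteq> \<alpha>" by (auto simp: \<beta>_def)
    interpret b: prob_space "law \<beta>"
      using \<beta>(1) interior_subset by (intro prob_space_law) auto
    have "AE x in law \<beta>. x = mean \<alpha>"
      unfolding law_change[of \<beta> \<alpha>] using ae by (subst AE_density) auto
    then have "mean \<beta> = (\<integral>x. mean \<alpha> \<partial>law \<beta>)"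
      by (intro integral_cong_AE) auto
    then have "mean \<beta> = mean \<alpha>" using b.prob_space by simp
    then show False using mean_strict_mono[OF \<alpha> \<beta>(1)] \<beta>(2) by simp
  qed
  moreover have "(\<integral>x. (x - mean \<alpha>)\<^sup>2 \<partial>law \<alpha>) \<ge> 0" by simp
  ultimately show ?thesis using law_variance[OF \<alpha>] by linarith
qed

lemma inj_deriv_psi: "inj_on (deriv \<psi>) (interior A)"
proof (rule inj_onI, rule ccontr)
  fix \<alpha> \<beta> assume "\<alpha> \<in> interior A" "\<beta> \<in> interior A" "deriv \<psi> \<alpha> = deriv \<psi> \<beta>" "\<alpha> \<noteq> \<beta>"
  then show False using mean_strict_mono[of \<alpha> \<beta>] by (simp add: deriv_psi)
qed

lemma continuous_on_deriv_psi: "continuous_on (interior A) (deriv \<psi>)"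
  by (intro continuous_at_imp_continuous_on ballI DERIV_isCont[OF moments(3)])

lemma deriv_inverse:
  assumes "\<alpha> \<in> interior A"
  shows "(inv_into (interior A) (deriv \<psi>) has_real_derivative inverse (deriv (deriv \<psi>) \<alpha>))
    (at (mean \<alpha>))"
proof -
  have "deriv (deriv \<psi>) \<alpha> = (\<integral>x. x\<^sup>2 \<partial>law \<alpha>) - (mean \<alpha>)\<^sup>2"
    by (rule DERIV_imp_deriv[OF moments(3)[OF assms]])
  then have "(deriv \<psi> has_derivative (*) (deriv (deriv \<psi>) \<alpha>)) (at \<alpha>)"
    using moments(3)[OF assms] by (simp add: has_field_derivative_def)
  then have "(inv_into (interior A) (deriv \<psi>) has_derivative (*) (inverse (deriv (deriv \<psi>) \<alpha>)))
      (at (deriv \<psi> \<alpha>))"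
    by (rule has_derivative_inverse_strong[OF open_interior assms continuous_on_deriv_psi, rotated])
       (use variance_pos[OF assms] inj_deriv_psi in \<open>auto simp: fun_eq_iff\<close>)
  then have "(inv_into (interior A) (deriv \<psi>) has_real_derivative inverse (deriv (deriv \<psi>) \<alpha>))
      (at (deriv \<psi> \<alpha>))"
    by (simp add: has_field_derivative_def)
  then show ?thesis by (simp add: deriv_psi[OF assms])
qed

text \<open>The estimator applies the inverse also outside the range of \<open>deriv \<psi>\<close>.
  That range is open by invariance of domain, the inverse is continuous on it, and it is constant
  elsewhere.\<close>

lemma measurable_inverse: "inv_into (interior A) (deriv \<psi>) \<in> borel_measurable borel"
proof -
  let ?U = "deriv \<psi> ` interior A" and ?h = "inv_into (interior A) (deriv \<psi>)"
  have U: "open ?U"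
    by (rule invariance_of_domain[OF continuous_on_deriv_psi open_interior inj_deriv_psi])
  have "continuous_on ?U ?h"
    by (rule continuous_on_inverse_open[OF open_interior continuous_on_deriv_psi])
       (use inj_deriv_psi in auto)
  then have "(\<lambda>x. if x \<in> ?U then ?h x else (SOME y. False)) \<in> borel_measurable borel"
    using U by (intro borel_measurable_continuous_on_if) auto
  \<comment> \<open>Outside the image the predicate inside \<open>inv_into\<close> is identically
    false, hence the chosen value is the same at all such points.\<close>
  moreover have "?h x = (SOME y. False)" if "x \<notin> ?U" for x
  proof -
    have "(\<lambda>y. y \<in> interior A \<and> deriv \<psi> y = x) = (\<lambda>y. False)" using that by auto
    then show ?thesis by (simp add: inv_into_def)
  qed
  then have "(\<lambda>x. if x \<in> ?U then ?h x else (SOME y. False)) = ?h" by auto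
  ultimately show ?thesis by simp
qed

end

section \<open>Normal laws\<close>

lemma sets_normal_law [simp, measurable_cong]: "sets (normal_law s) = sets borel"
  by (simp add: normal_law_def)

lemma space_normal_law [simp]: "space (normal_law s) = UNIV"
  by (simp add: normal_law_def)

lemma prob_space_normal_law: "s > 0 \<Longrightarrow> prob_space (normal_law s)"
  unfolding normal_law_def by (intro prob_space_normal_density) simp

lemma cis_measurable [measurable]: "cis \<in> borel_measurable borel"
  by (intro borel_measurable_continuous_onI continuous_intros)

lemma (in prob_space) integrable_cis:
  "X \<in> borel_measurable M \<Longrightarrow> integrable M (\<lambda>\<omega>. cis (X \<omega>))"
  by (intro integrable_const_bound[of _ 1]) auto

lemma char_normal_law:
  assumes "s > 0"
  shows "(\<integral>y. cis (t * y) \<partial>normal_law s) = of_real (exp (- s * t\<^sup>2 / 2))"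
proof -
  interpret prob_space "normal_law s" using assms by (rule prob_space_normal_law)
  have m: "(\<lambda>x. x) \<in> measurable (normal_law s) lborel"
    by (simp add: measurable_ident_sets)
  have "distr (normal_law s) lborel (\<lambda>x. x) = normal_law s"
    by (rule distr_id2) simp
  then have "distributed (normal_law s) lborel (\<lambda>x. x) (normal_density 0 (sqrt s))"
    using m by (simp add: distributed_def normal_law_def[symmetric])
  then have "distributed (normal_law s) lborel (\<lambda>x. (x - 0) / sqrt s) std_normal_density"
    using assms by (subst normal_standard_normal_convert[symmetric]) auto
  then have d: "distr (normal_law s) lborel (\<lambda>x. x / sqrt s) = std_normal_distribution"
    by (simp add: distributed_def)
  have "(\<integral>y. cis (t * y) \<partial>normal_law s) = (\<integral>y. cis ((t * sqrt s) * (y / sqrt s)) \<partial>normal_law s)"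
    using assms by simp
  also have "\<dots> = (\<integral>y. cis ((t * sqrt s) * y) \<partial>distr (normal_law s) lborel (\<lambda>x. x / sqrt s))"
    by (subst integral_distr) auto
  also have "\<dots> = char std_normal_distribution (t * sqrt s)"
    by (simp add: d char_def cis_conv_exp)
  also have "\<dots> = of_real (exp (- s * t\<^sup>2 / 2))"
    using assms by (simp add: char_std_normal_distribution power_mult_distrib mult.commute)
  finally show ?thesis .
qed

lemma cis_sum: "cis (\<Sum>i\<in>I. f i) = (\<Prod>i\<in>I. cis (f i))"
  by (induction I rule: infinite_finite_induct) (auto simp: cis_mult[symmetric])

lemma char_PiM_normal_law:
  fixes v :: "'i::finite \<Rightarrow> real"
  assumes "\<And>i. v i > 0"
  shows "(\<integral>y. cis (\<Sum>i\<in>UNIV. t i * y i) \<partial>(\<Pi>\<^sub>M i\<in>UNIV. normal_law (v i)))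
    = of_real (exp (- (\<Sum>i\<in>UNIV. v i * (t i)\<^sup>2) / 2))"
proof -
  interpret N: prob_space "normal_law (v i)" for i using assms by (rule prob_space_normal_law)
  interpret product_prob_space "\<lambda>i. normal_law (v i)" UNIV ..
  have "(\<integral>y. cis (\<Sum>i\<in>UNIV. t i * y i) \<partial>(\<Pi>\<^sub>M i\<in>UNIV. normal_law (v i)))
      = (\<integral>y. (\<Prod>i\<in>UNIV. cis (t i * y i)) \<partial>(\<Pi>\<^sub>M i\<in>UNIV. normal_law (v i)))"
    by (simp add: cis_sum)
  also have "\<dots> = (\<Prod>i\<in>UNIV. \<integral>y. cis (t i * y) \<partial>normal_law (v i))"
    by (intro product_integral_prod N.integrable_cis) auto
  also have "\<dots> = (\<Prod>i\<in>UNIV. of_real (exp (- v i * (t i)\<^sup>2 / 2)))"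
    using assms by (simp add: char_normal_law)
  also have "\<dots> = of_real (exp (- (\<Sum>i\<in>UNIV. v i * (t i)\<^sup>2) / 2))"
    by (simp add: exp_sum[symmetric] sum_negf sum_divide_distrib flip: of_real_prod)
  finally show ?thesis .
qed

text \<open>The entries lie in a Euclidean space, so that two applications handle matrices, which
  are vectors of rows.\<close>

lemma measurable_vecI:
  fixes f :: "'a \<Rightarrow> 'b::euclidean_space^'n"
  assumes "\<And>i. (\<lambda>x. f x $ i) \<in> borel_measurable M"
  shows "f \<in> borel_measurable M"
proof (subst borel_measurable_euclidean_space, rule ballI)
  fix u :: "'b^'n" assume "u \<in> Basis"
  then obtain i w where "u = axis i w" by (auto simp: Basis_vec_def)
  then show "(\<lambda>x. f x \<bullet> u) \<in> borel_measurable M"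
    using borel_measurable_inner[OF assms[of i] borel_measurable_const[of w]]
    by (simp add: inner_axis)
qed

lemma measurable_vec_nth [measurable (raw)]:
  fixes f :: "'a \<Rightarrow> 'b::euclidean_space^'n"
  assumes "f \<in> borel_measurable M"
  shows "(\<lambda>x. f x $ i) \<in> borel_measurable M"
proof (rule measurable_compose[OF assms])
  show "(\<lambda>x::'b^'n. x $ i) \<in> borel_measurable borel"
    by (intro borel_measurable_continuous_onI continuous_intros)
qed

text \<open>A factor \<open>L\<close> must exist for the choice in \<open>mvn_law\<close> to be
  meaningful. The chosen \<open>L'\<close> enters the characteristic function only through the
  squared norm of \<open>transpose L' *v t\<close>, which is
  \<open>t \<bullet> (S *v t)\<close>.\<close>

lemma mvn_law_factor:
  fixes L :: "real^'k^'k"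
  assumes "L ** transpose L = S"
  shows "sets (mvn_law S) = sets borel" "prob_space (mvn_law S)"
    "(\<integral>y. cis (t \<bullet> y) \<partial>mvn_law S) = of_real (exp (- (t \<bullet> (S *v t)) / 2))"
proof -
  define L' :: "real^'k^'k" where "L' = (SOME L. L ** transpose L = S)"
  have L': "L' ** transpose L' = S" unfolding L'_def using assms by (rule someI)
  interpret N: prob_space "normal_law 1" by (rule prob_space_normal_law) simp
  interpret product_prob_space "\<lambda>i::'k. normal_law 1" UNIV ..
  have [measurable]: "(\<lambda>y. L' *v (\<chi> i. y i)) \<in> borel_measurable (\<Pi>\<^sub>M i\<in>(UNIV :: 'k set). normal_law 1)"
    by (rule measurable_vecI) (simp add: matrix_vector_mult_def)
  have mvn: "mvn_law S = distr (\<Pi>\<^sub>M i\<in>(UNIV :: 'k set). normal_law 1) borel (\<lambda>y. L' *v (\<chi> i. y i))"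
    by (simp add: mvn_law_def L'_def)
  show "sets (mvn_law S) = sets borel" by (simp add: mvn)
  show "prob_space (mvn_law S)" unfolding mvn by (rule P.prob_space_distr) measurable
  have "(\<lambda>y. cis (t \<bullet> y)) \<in> borel_measurable borel" by measurable
  then have "(\<integral>y. cis (t \<bullet> y) \<partial>mvn_law S)
      = (\<integral>y. cis (t \<bullet> (L' *v (\<chi> i. y i))) \<partial>(\<Pi>\<^sub>M i\<in>(UNIV :: 'k set). normal_law 1))"
    unfolding mvn by (subst integral_distr) auto
  also have "\<dots> = (\<integral>y. cis (\<Sum>i\<in>UNIV. (transpose L' *v t) $ i * y i) \<partial>(\<Pi>\<^sub>M i\<in>(UNIV :: 'k set). normal_law 1))"
    by (subst dot_lmul_matrix[symmetric]) (simp add: inner_vec_def)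
  also have "\<dots> = of_real (exp (- (\<Sum>i\<in>UNIV. 1 * ((transpose L' *v t) $ i)\<^sup>2) / 2))"
    by (rule char_PiM_normal_law) simp
  also have "(\<Sum>i\<in>UNIV. 1 * ((transpose L' *v t) $ i)\<^sup>2) = (transpose L' *v t) \<bullet> (transpose L' *v t)"
    by (simp add: inner_vec_def power2_eq_square)
  also have "\<dots> = t \<bullet> (S *v t)"
    by (simp add: L'[symmetric] matrix_vector_mul_assoc[symmetric] dot_lmul_matrix[symmetric])
  finally show "(\<integral>y. cis (t \<bullet> y) \<partial>mvn_law S) = of_real (exp (- (t \<bullet> (S *v t)) / 2))" .
qed

section \<open>The multinomial covariance matrix\<close>

lemma Sigma_prop_mult: "(Sigma_prop p *v t) $ i = p $ i * (t $ i - p \<bullet> t)"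
proof -
  have "(Sigma_prop p *v t) $ i = (\<Sum>j\<in>UNIV. (if i = j then p $ i * t $ j else 0) - p $ i * (p $ j * t $ j))"
    unfolding Sigma_prop_def diag_mat_def outer_def matrix_vector_mult_def
    by (auto simp: algebra_simps intro!: sum.cong)
  also have "\<dots> = p $ i * (t $ i - p \<bullet> t)"
    by (simp add: sum_subtractf inner_vec_def sum_distrib_left right_diff_distrib)
  finally show ?thesis .
qed

lemma Sigma_prop_factor:
  fixes p :: "real^'k"
  assumes "prob_vector p"
  shows "\<exists>L :: real^'k^'k. L ** transpose L = Sigma_prop p"
proof -
  \<comment> \<open>This is Diag(sqrt p) times the orthogonal projection along sqrt p, a unit vector
    because the entries of \<open>p\<close> sum to 1. A projection times its transpose is itself, so
    the product collapses to Diag(p) minus the outer product of \<open>p\<close>.\<close>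
  let ?L = "(\<chi> i j. (if i = j then sqrt (p $ i) else 0) - p $ i * sqrt (p $ j)) :: real^'k^'k"
  have p: "p $ k \<ge> 0" "(\<Sum>k\<in>UNIV. p $ k) = 1" for k
    using assms by (auto simp: prob_vector_def)
  have "(?L ** transpose ?L) $ i $ j = Sigma_prop p $ i $ j" for i j
  proof -
    have "(?L ** transpose ?L) $ i $ j = (\<Sum>k\<in>UNIV. (if i = k then (if j = k then p $ i else 0) - p $ i * p $ j else 0)
        - (if j = k then p $ i * p $ j else 0) + p $ i * p $ j * p $ k)"
      unfolding matrix_matrix_mult_def transpose_def
      using p by (auto simp: algebra_simps intro!: sum.cong)
    also have "\<dots> = (if j = i then p $ i else 0) - p $ i * p $ j"
      using p by (simp add: sum.distrib sum_subtractf flip: sum_distrib_left)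
    finally show ?thesis
      by (auto simp: Sigma_prop_def diag_mat_def outer_def)
  qed
  then have "?L ** transpose ?L = Sigma_prop p" by (simp add: vec_eq_iff)
  then show ?thesis by (rule exI)
qed

lemma pos_semidef_factor:
  fixes L :: "real^'k^'k"
  shows "pos_semidef (L ** transpose L)"
  by (simp add: pos_semidef_def matrix_transpose_mul matrix_vector_mul_assoc[symmetric]
      dot_lmul_matrix[symmetric] inner_ge_zero)

lemma pos_semidef_Sigma_prop: "prob_vector p \<Longrightarrow> pos_semidef (Sigma_prop p)"
  using Sigma_prop_factor pos_semidef_factor by metis

text \<open>The range is exactly the hyperplane orthogonal to the all-ones vector.\<close>

lemma rank_Sigma_prop:
  fixes p :: "real^'k"
  assumes p: "prob_vector p" "\<And>k. p $ k > 0"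
  shows "rank (Sigma_prop p) = CARD('k) - 1"
proof -
  let ?one = "(\<chi> i. 1) :: real^'k"
  have s: "(\<Sum>k\<in>UNIV. p $ k) = 1" using p by (simp add: prob_vector_def)
  have "range (\<lambda>x. Sigma_prop p *v x) = {y. ?one \<bullet> y = 0}"
  proof safe
    fix x
    have "(\<Sum>i\<in>UNIV. p $ i * (x $ i - p \<bullet> x)) = p \<bullet> x - (\<Sum>i\<in>UNIV. p $ i) * (p \<bullet> x)"
      by (simp add: right_diff_distrib sum_subtractf inner_vec_def sum_distrib_right)
    then show "?one \<bullet> (Sigma_prop p *v x) = 0"
      by (simp add: inner_vec_def[of ?one] Sigma_prop_mult s)
  next
    fix y assume y: "?one \<bullet> y = 0"
    \<comment> \<open>A preimage of \<open>y\<close>: here \<open>p \<bullet> ?x\<close> is the sum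
      of the entries of \<open>y\<close>, hence 0, and only the multiplication by \<open>p\<close>
      remains.\<close>
    let ?x = "\<chi> i. y $ i / p $ i"
    have nz: "p $ i \<noteq> 0" for i using p(2)[of i] by simp
    have "p \<bullet> ?x = ?one \<bullet> y" by (simp add: inner_vec_def nz)
    then have "Sigma_prop p *v ?x = y"
      using y nz by (simp add: vec_eq_iff Sigma_prop_mult)
    then show "y \<in> range (\<lambda>x. Sigma_prop p *v x)" by (metis rangeI)
  qed
  then have "rank (Sigma_prop p) = dim {y. ?one \<bullet> y = 0}"
    by (simp add: rank_dim_range)
  also have "\<dots> = DIM(real^'k) - 1"
    by (rule dim_hyperplane) (simp add: vec_eq_iff)
  finally show ?thesis by simp
qed

section \<open>Powers of characteristic functions\<close>

lemma exp_minus_second_order: "0 \<le> a \<Longrightarrow> \<bar>exp (- a) - (1 - a)\<bar> \<le> a\<^sup>2" for a :: real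
proof -
  assume a: "0 \<le> a"
  have "exp (- a) \<le> 1 / (1 + a)"
    using exp_ge_add_one_self[of a] a by (simp add: exp_minus field_simps)
  also have "1 / (1 + a) \<le> 1 - a + a\<^sup>2"
    using a by (simp add: field_simps power2_eq_square power3_eq_cube)
  finally show ?thesis
    using exp_ge_add_one_self[of "- a"] by linarith
qed

text \<open>A central limit theorem for \<open>k i\<close> summands at frequency \<open>s i\<close>;
  only the limit of \<open>k i * (s i)\<^sup>2\<close> matters, and the filter is arbitrary, so it
  serves both the proportions and the blocks, whose sizes depend on the labels. Powers of two
  numbers of modulus at most 1 differ by at most \<open>k i\<close> times the difference of the
  numbers, and the characteristic function differs from the Gaussian factor by
  o(\<open>(s i)\<^sup>2\<close>).\<close>

lemma (in real_distribution) char_power_tendsto: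
  fixes s :: "'i \<Rightarrow> real" and k :: "'i \<Rightarrow> nat"
  assumes i1: "integrable M (\<lambda>x. x)" and m: "expectation (\<lambda>x. x) = 0"
    and i2: "integrable M (\<lambda>x. x\<^sup>2)" and v: "expectation (\<lambda>x. x\<^sup>2) = \<sigma>2"
    and s: "(s \<longlongrightarrow> 0) F" and ks: "((\<lambda>i. k i * (s i)\<^sup>2) \<longlongrightarrow> w) F"
  shows "((\<lambda>i. char M (s i) ^ k i) \<longlongrightarrow> of_real (exp (- w * \<sigma>2 / 2))) F"
proof -
  \<comment> \<open>The remainder in the second-order expansion of the characteristic function. The
    cubic term is cut off by \<open>6 * x\<^sup>2\<close> since only a second moment is assumed;
    this also dominates, so \<open>R\<close> is continuous at 0.\<close>
  define R where "R t = expectation (\<lambda>x. min (6 * x\<^sup>2) (\<bar>t\<bar> * \<bar>x\<bar> ^ 3))" for t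
  have "\<sigma>2 \<ge> 0" unfolding v[symmetric] by simp
  have R0: "R 0 = 0" by (simp add: R_def min_absorb2)
  have "isCont R 0"
  proof (rule continuous_at_sequentiallyI)
    fix u :: "nat \<Rightarrow> real" assume u: "u \<longlonglongrightarrow> 0"
    show "(\<lambda>n. R (u n)) \<longlonglongrightarrow> R 0"
      unfolding R_def
    proof (rule integral_dominated_convergence[where w = "\<lambda>x. 6 * x\<^sup>2"])
      show "integrable M (\<lambda>x. 6 * x\<^sup>2)" using i2 by simp
      show "AE x in M. (\<lambda>n. min (6 * x\<^sup>2) (\<bar>u n\<bar> * \<bar>x\<bar> ^ 3)) \<longlonglongrightarrow> min (6 * x\<^sup>2) (\<bar>0\<bar> * \<bar>x\<bar> ^ 3)"
        using u by (intro AE_I2 tendsto_intros)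
    qed auto
  qed
  then have Rs: "((\<lambda>i. R (s i)) \<longlongrightarrow> 0) F"
    using isCont_tendsto_compose[OF _ s] R0 by metis
  let ?e = "\<lambda>i. complex_of_real (exp (- ((s i)\<^sup>2 * \<sigma>2 / 2)))"
  \<comment> \<open>The two errors divided by \<open>(s i)\<^sup>2\<close>: the expansion of the
    characteristic function, then the replacement of \<open>1 - a\<close> by
    \<open>exp (- a)\<close>.\<close>
  let ?\<eta> = "\<lambda>i. R (s i) / 6 + (s i)\<^sup>2 * (\<sigma>2 / 2)\<^sup>2"
  have variance: "variance (\<lambda>x. x) = \<sigma>2" by (simp add: m v)
  have bound: "norm (char M (s i) ^ k i - ?e i ^ k i) \<le> (k i * (s i)\<^sup>2) * ?\<eta> i" for i
  proof -
    have "norm (char M (s i) - ?e i) \<le> norm (char M (s i) - (1 - (s i)\<^sup>2 * \<sigma>2 / 2))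
        + norm ((1 - (s i)\<^sup>2 * \<sigma>2 / 2) - ?e i)"
      using norm_triangle_ineq[of "char M (s i) - (1 - (s i)\<^sup>2 * \<sigma>2 / 2)" "(1 - (s i)\<^sup>2 * \<sigma>2 / 2) - ?e i"] by simp
    also have "norm (char M (s i) - (1 - (s i)\<^sup>2 * \<sigma>2 / 2)) \<le> (s i)\<^sup>2 / 6 * R (s i)"
      unfolding R_def using char_approx3[OF i1 m i2 variance, of "s i"] by simp
    also have "norm ((1 - (s i)\<^sup>2 * \<sigma>2 / 2) - ?e i)
        = \<bar>exp (- ((s i)\<^sup>2 * \<sigma>2 / 2)) - (1 - (s i)\<^sup>2 * \<sigma>2 / 2)\<bar>"
      by (subst abs_minus_commute, subst norm_of_real[symmetric, where 'a = complex]) simp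
    also have "\<dots> \<le> ((s i)\<^sup>2 * \<sigma>2 / 2)\<^sup>2"
      using \<open>\<sigma>2 \<ge> 0\<close> by (intro exp_minus_second_order) auto
    finally have *: "norm (char M (s i) - ?e i) \<le> (s i)\<^sup>2 * ?\<eta> i"
      by (simp add: algebra_simps power2_eq_square)
    have "norm (char M (s i) ^ k i - ?e i ^ k i) \<le> k i * norm (char M (s i) - ?e i)"
      using \<open>\<sigma>2 \<ge> 0\<close> by (intro norm_power_diff cmod_char_le_1) (auto simp: norm_of_real simp del: of_real_exp)
    also have "\<dots> \<le> k i * ((s i)\<^sup>2 * ?\<eta> i)"
      using * by (intro mult_left_mono) auto
    finally show ?thesis by (simp add: mult.assoc)
  qed
  have "((\<lambda>i. (k i * (s i)\<^sup>2) * ?\<eta> i) \<longlongrightarrow> w * (0 / 6 + 0\<^sup>2 * (\<sigma>2 / 2)\<^sup>2)) F"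
    by (intro tendsto_intros ks Rs s) simp_all
  then have lim: "((\<lambda>i. (k i * (s i)\<^sup>2) * ?\<eta> i) \<longlongrightarrow> 0) F" by simp
  have "((\<lambda>i. char M (s i) ^ k i - ?e i ^ k i) \<longlongrightarrow> 0) F"
    by (rule Lim_null_comparison[OF always_eventually[OF allI[OF bound]] lim])
  moreover have "((\<lambda>i. ?e i ^ k i) \<longlongrightarrow> of_real (exp (- w * \<sigma>2 / 2))) F"
  proof -
    have "exp (- ((s i)\<^sup>2 * \<sigma>2 / 2)) ^ k i = exp (- (k i * (s i)\<^sup>2) * \<sigma>2 / 2)" for i
      by (subst exp_of_nat_mult[symmetric]) simp
    then have "?e i ^ k i = of_real (exp (- (k i * (s i)\<^sup>2) * \<sigma>2 / 2))" for i
      by (metis of_real_power)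
    moreover have "((\<lambda>i. complex_of_real (exp (- (k i * (s i)\<^sup>2) * \<sigma>2 / 2)))
        \<longlongrightarrow> of_real (exp (- w * \<sigma>2 / 2))) F"
      by (intro tendsto_of_real tendsto_exp tendsto_divide tendsto_mult tendsto_minus ks tendsto_const) simp
    ultimately show ?thesis by (simp only:)
  qed
  ultimately show ?thesis
    by (rule Lim_transform[rotated])
qed

section \<open>Labels\<close>

text \<open>Bounded convergence in probability to a constant. \<open>H\<close> converges
  deterministically along \<open>\<Phi>\<close>, and the assumption on \<open>J\<close> says that
  the random argument lies in each set of \<open>\<Phi>\<close> up to small probability; the
  covering event \<open>B\<close> avoids asking whether that set is measurable.\<close>

lemma (in prob_space) expectation_tendsto_in_prob:
  fixes H :: "'j \<Rightarrow> complex"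
  assumes H: "(H \<longlongrightarrow> L) \<Phi>" and le1: "\<And>x. norm (H x) \<le> 1"
    and meas: "\<And>i. (\<lambda>\<omega>. H (J i \<omega>)) \<in> borel_measurable M"
    and J: "\<And>P e. eventually P \<Phi> \<Longrightarrow> e > 0 \<Longrightarrow>
      \<forall>\<^sub>F i in F. \<exists>B\<in>events. prob B < e \<and> (\<forall>\<omega>\<in>space M - B. P (J i \<omega>))"
  shows "((\<lambda>i. \<integral>\<omega>. H (J i \<omega>) \<partial>M) \<longlongrightarrow> L) F"
proof (rule tendstoI)
  fix e :: real assume e: "e > 0"
  \<comment> \<open>A bound for the distance from \<open>H\<close> to \<open>L\<close> everywhere,
    used on the exceptional event, which then contributes less than \<open>e / 2\<close>.\<close>
  define C where "C = 1 + norm L"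
  have C: "C > 0" by (simp add: C_def add_pos_nonneg)
  have "\<forall>\<^sub>F x in \<Phi>. dist (H x) L < e / 2" using e by (intro tendstoD[OF H]) simp
  from J[OF this, of "e / (2 * C)"] e C
  have "\<forall>\<^sub>F i in F. \<exists>B\<in>events. prob B < e / (2 * C) \<and> (\<forall>\<omega>\<in>space M - B. dist (H (J i \<omega>)) L < e / 2)"
    by simp
  then show "\<forall>\<^sub>F i in F. dist (\<integral>\<omega>. H (J i \<omega>) \<partial>M) L < e"
  proof eventually_elim
    case (elim i)
    then obtain B where B: "B \<in> events" "prob B < e / (2 * C)"
      "\<And>\<omega>. \<omega> \<in> space M \<Longrightarrow> \<omega> \<notin> B \<Longrightarrow> dist (H (J i \<omega>)) L < e / 2" by auto
    have int: "integrable M (\<lambda>\<omega>. H (J i \<omega>))"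
      using le1 meas by (intro integrable_const_bound[of _ 1]) auto
    have intB: "integrable M (\<lambda>\<omega>. C * indicator B \<omega>)"
      using B(1) by (intro integrable_mult_right integrable_real_indicator) (auto simp: less_top[symmetric])
    have "(\<integral>\<omega>. H (J i \<omega>) \<partial>M) - L = (\<integral>\<omega>. H (J i \<omega>) - L \<partial>M)"
      using int prob_space by simp
    also have "norm \<dots> \<le> (\<integral>\<omega>. norm (H (J i \<omega>) - L) \<partial>M)"
      by (rule integral_norm_bound)
    also have "\<dots> \<le> (\<integral>\<omega>. e / 2 + C * indicator B \<omega> \<partial>M)"
    proof (rule integral_mono)
      show "norm (H (J i \<omega>) - L) \<le> e / 2 + C * indicator B \<omega>" if "\<omega> \<in> space M" for \<omega>
      proof (cases "\<omega> \<in> B")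
        case True
        have "norm (H (J i \<omega>) - L) \<le> norm (H (J i \<omega>)) + norm L" by (rule norm_triangle_ineq4)
        then show ?thesis using True le1[of "J i \<omega>"] e by (simp add: C_def)
      next
        case False
        then show ?thesis using B(3)[OF that] by (simp add: dist_norm)
      qed
    qed (use int intB in auto)
    also have "\<dots> = e / 2 + C * prob B"
      using intB B(1) prob_space by (subst Bochner_Integration.integral_add) auto
    also have "C * prob B < e / 2"
      using B(2) C by (simp add: field_simps)
    finally show ?case by (simp add: dist_norm)
  qed
qed

definition label_count :: "nat \<Rightarrow> (nat \<Rightarrow> 'k) \<Rightarrow> 'k \<Rightarrow> nat" where
  "label_count n r k = card {i. i < n \<and> r i = k}"

lemma sum_label_count: "(\<Sum>i<n. if r i = k then 1 else 0) = real (label_count n r k)"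
proof -
  have "{i. i < n \<and> r i = k} = {..<n} \<inter> {i. r i = k}" by auto
  then show ?thesis by (simp add: label_count_def sum.If_cases)
qed

section \<open>Random labels and class proportions\<close>

locale labels = prob_space M for M :: "'a measure" +
  fixes p :: "real^'k" and Z :: "nat \<Rightarrow> 'a \<Rightarrow> real^'k"
  assumes iid: "\<And>n. iid_assignment M n p Z" and p: "prob_vector p"
begin

lemma Z_meas [measurable]: "Z i \<in> borel_measurable M"
  using iid[of "Suc i"] unfolding iid_assignment_def by blast

lemma Z_prob: "prob {\<omega> \<in> space M. Z i \<omega> = onehot k} = p $ k"
  using iid[of "Suc i"] unfolding iid_assignment_def by blast

lemma Z_indep: "indep_vars (\<lambda>_. borel) Z {..<n}"
  using iid[of n] unfolding iid_assignment_def by blast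

definition lab :: "nat \<Rightarrow> 'a \<Rightarrow> 'k" where "lab i \<omega> = (THE k. Z i \<omega> = onehot k)"

lemma Z_lab: "\<omega> \<in> space M \<Longrightarrow> Z i \<omega> = onehot (lab i \<omega>)"
proof -
  assume "\<omega> \<in> space M"
  then obtain k where "Z i \<omega> = onehot k"
    using iid[of "Suc i"] by (fastforce simp: iid_assignment_def)
  then show ?thesis unfolding lab_def by (rule theI2) (simp_all add: \<open>Z i \<omega> = onehot k\<close> axis_eq_axis)
qed

lemma Z_eq_iff: "\<omega> \<in> space M \<Longrightarrow> Z i \<omega> = onehot k \<longleftrightarrow> lab i \<omega> = k"
  by (simp add: Z_lab axis_eq_axis)

lemma Z_nth: "\<omega> \<in> space M \<Longrightarrow> Z i \<omega> $ k = (if lab i \<omega> = k then 1 else 0)"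
  by (simp add: Z_lab axis_def)

lemma sum_Z: "\<omega> \<in> space M \<Longrightarrow> (\<Sum>i<n. Z i \<omega> $ k) = label_count n (\<lambda>i. lab i \<omega>) k"
  by (simp add: Z_nth sum_label_count)

text \<open>Restricting to the first \<open>n\<close> indices leaves finitely many possible values,
  so conditioning on labels becomes a finite sum.\<close>

definition labs :: "nat \<Rightarrow> 'a \<Rightarrow> nat \<Rightarrow> 'k" where "labs n \<omega> = (\<lambda>i\<in>{..<n}. lab i \<omega>)"

lemma labs_in: "labs n \<omega> \<in> {..<n} \<rightarrow>\<^sub>E UNIV"
  by (simp add: labs_def)

lemma label_count_labs: "label_count n (labs n \<omega>) k = label_count n (\<lambda>i. lab i \<omega>) k"
  unfolding label_count_def by (rule arg_cong[where f = card]) (auto simp: labs_def)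

lemma labs_eq_iff:
  assumes "\<omega> \<in> space M" "r \<in> {..<n} \<rightarrow>\<^sub>E UNIV"
  shows "labs n \<omega> = r \<longleftrightarrow> (\<forall>i<n. Z i \<omega> = onehot (r i))"
proof
  assume "\<forall>i<n. Z i \<omega> = onehot (r i)"
  then show "labs n \<omega> = r"
    using assms by (intro PiE_ext[OF labs_in assms(2)]) (auto simp: labs_def Z_eq_iff)
next
  assume "labs n \<omega> = r"
  then show "\<forall>i<n. Z i \<omega> = onehot (r i)"
    using assms(1) by (auto simp: labs_def Z_lab)
qed

lemma prop_hat_labs:
  "\<omega> \<in> space M \<Longrightarrow> prop_hat n (\<lambda>i. Z i \<omega>) = (\<chi> k. label_count n (labs n \<omega>) k / n)"
  by (simp add: prop_hat_def sum_Z label_count_labs)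

lemma prop_hat_meas [measurable]: "(\<lambda>\<omega>. prop_hat n (\<lambda>i. Z i \<omega>)) \<in> borel_measurable M"
  unfolding prop_hat_def by (rule measurable_vecI) (unfold vec_lambda_beta, measurable)

lemma label_event: "{\<omega> \<in> space M. \<forall>i<n. Z i \<omega> = onehot (r i)} \<in> assignment_events M n Z"
proof -
  let ?f = "\<lambda>\<omega>. \<lambda>i\<in>{..<n}. Z i \<omega>"
  have "{\<omega> \<in> space M. \<forall>i<n. Z i \<omega> = onehot (r i)} = ?f -` (\<Pi>\<^sub>E i\<in>{..<n}. {onehot (r i)}) \<inter> space M"
  proof (rule set_eqI)
    show "\<omega> \<in> {\<omega> \<in> space M. \<forall>i<n. Z i \<omega> = onehot (r i)} \<longleftrightarrow>
        \<omega> \<in> ?f -` (\<Pi>\<^sub>E i\<in>{..<n}. {onehot (r i)}) \<inter> space M" for \<omega>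
      by (simp add: PiE_iff Ball_def) blast
  qed
  moreover have "(\<Pi>\<^sub>E i\<in>{..<n}. {onehot (r i)}) \<in> sets (\<Pi>\<^sub>M i\<in>{..<n}. borel)"
    by (intro sets_PiM_I_finite) auto
  ultimately show ?thesis
    unfolding assignment_events_def by (simp only:) (rule in_vimage_algebra)
qed

lemma prob_label_event:
  "prob {\<omega> \<in> space M. \<forall>i<n. Z i \<omega> = onehot (r i)} = (\<Prod>i<n. p $ r i)"
proof (cases "n = 0")
  case True
  then show ?thesis using prob_space by simp
next
  case False
  have "{\<omega> \<in> space M. \<forall>i<n. Z i \<omega> = onehot (r i)} = (\<Inter>i\<in>{..<n}. Z i -` {onehot (r i)} \<inter> space M)"
    using False by auto
  also have "prob \<dots> = (\<Prod>i\<in>{..<n}. prob (Z i -` {onehot (r i)} \<inter> space M))"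
    using False by (intro indep_varsD_finite[OF Z_indep]) auto
  also have "\<dots> = (\<Prod>i<n. p $ r i)"
  proof (intro prod.cong refl)
    fix i
    have "Z i -` {onehot (r i)} \<inter> space M = {\<omega> \<in> space M. Z i \<omega> = onehot (r i)}" by auto
    then show "prob (Z i -` {onehot (r i)} \<inter> space M) = p $ r i" using Z_prob by simp
  qed
  finally show ?thesis .
qed

lemma integral_Z:
  fixes g :: "real^'k \<Rightarrow> 'b::{banach, second_countable_topology}"
  shows "integrable M (\<lambda>\<omega>. g (Z i \<omega>))"
    and "(\<integral>\<omega>. g (Z i \<omega>) \<partial>M) = (\<Sum>k\<in>UNIV. p $ k *\<^sub>R g (onehot k))"
proof -
  let ?E = "\<lambda>k. {\<omega> \<in> space M. Z i \<omega> = onehot k}"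
  have eq: "g (Z i \<omega>) = (\<Sum>k\<in>UNIV. indicator (?E k) \<omega> *\<^sub>R g (onehot k))" if "\<omega> \<in> space M" for \<omega>
    using that by (simp add: Z_lab axis_eq_axis indicator_def of_bool_def if_distrib[of "\<lambda>c. c *\<^sub>R _"] cong: if_cong)
  have int: "integrable M (\<lambda>\<omega>. indicator (?E k) \<omega> *\<^sub>R g (onehot k))" for k
    by (intro integrable_scaleR_left integrable_real_indicator) (auto simp: less_top[symmetric])
  then show "integrable M (\<lambda>\<omega>. g (Z i \<omega>))"
    by (subst Bochner_Integration.integrable_cong[OF refl eq]) (assumption, intro Bochner_Integration.integrable_sum)
  have "(\<integral>\<omega>. g (Z i \<omega>) \<partial>M) = (\<integral>\<omega>. (\<Sum>k\<in>UNIV. indicator (?E k) \<omega> *\<^sub>R g (onehot k)) \<partial>M)"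
    by (rule Bochner_Integration.integral_cong[OF refl eq])
  also have "\<dots> = (\<Sum>k\<in>UNIV. \<integral>\<omega>. indicator (?E k) \<omega> *\<^sub>R g (onehot k) \<partial>M)"
    by (rule Bochner_Integration.integral_sum) (rule int)
  also have "\<dots> = (\<Sum>k\<in>UNIV. p $ k *\<^sub>R g (onehot k))"
  proof (intro sum.cong refl)
    fix k
    have "?E k \<inter> space M = ?E k" by auto
    then have "integral\<^sup>L M (indicator (?E k)) = p $ k"
      using Z_prob[of i k] by (simp only: Bochner_Integration.integral_indicator)
    moreover have "integrable M (indicator (?E k) :: 'a \<Rightarrow> real)"
      by (intro integrable_real_indicator) (auto simp: less_top[symmetric])
    ultimately show "(\<integral>\<omega>. indicator (?E k) \<omega> *\<^sub>R g (onehot k) \<partial>M) = p $ k *\<^sub>R g (onehot k)"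
      by (subst integral_scaleR_left) auto
  qed
  finally show "(\<integral>\<omega>. g (Z i \<omega>) \<partial>M) = (\<Sum>k\<in>UNIV. p $ k *\<^sub>R g (onehot k))" .
qed

lemma char_prop_hat:
  "(\<lambda>n. \<integral>\<omega>. cis (t \<bullet> (sqrt (real n) *\<^sub>R (prop_hat n (\<lambda>i. Z i \<omega>) - p))) \<partial>M)
     \<longlonglongrightarrow> of_real (exp (- (t \<bullet> (Sigma_prop p *v t)) / 2))"
proof -
  \<comment> \<open>Projecting on \<open>t\<close> leaves real i.i.d. centred summands with variance
    \<open>t \<bullet> (Sigma_prop p *v t)\<close>. The direction is absorbed in their law
    \<open>P\<close>, and the frequency is \<open>1 / sqrt n\<close>.\<close>
  define X where "X i \<omega> = t \<bullet> Z i \<omega> - t \<bullet> p" for i \<omega>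
  have Xm [measurable]: "X i \<in> borel_measurable M" for i unfolding X_def by measurable
  define P where "P = distr M borel (X 0)"
  interpret P: real_distribution P
    unfolding P_def by (rule real_distribution_distr) (rule Xm)
  have EP: "integral\<^sup>L P g = (\<Sum>k\<in>UNIV. p $ k * g (t $ k - t \<bullet> p))" and IP: "integrable P g"
    if [measurable]: "g \<in> borel_measurable borel" for g :: "real \<Rightarrow> real"
    using integral_Z[of "\<lambda>z. g (t \<bullet> z - t \<bullet> p)" 0]
    by (simp_all add: P_def integral_distr integrable_distr_eq X_def inner_axis)
  have IP1: "integrable P (\<lambda>x. x)" and IP2: "integrable P (\<lambda>x. x\<^sup>2)"
    by (rule IP, measurable)+
  have char: "char (distr M borel (X i)) s = char P s" for i s
    using integral_Z(2)[of "\<lambda>z. cis (s * (t \<bullet> z - t \<bullet> p))"]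
    by (simp add: P_def char_def integral_distr X_def cis_conv_exp)
  have s1: "(\<Sum>k\<in>UNIV. p $ k) = 1" using p by (simp add: prob_vector_def)
  have mean: "integral\<^sup>L P (\<lambda>x. x) = 0"
    using s1 by (simp add: EP right_diff_distrib sum_subtractf inner_vec_def mult.commute flip: sum_distrib_right)
  have var: "integral\<^sup>L P (\<lambda>x. x\<^sup>2) = t \<bullet> (Sigma_prop p *v t)"
  proof -
    have "integral\<^sup>L P (\<lambda>x. x\<^sup>2) = (\<Sum>k\<in>UNIV. p $ k * (t $ k - t \<bullet> p)\<^sup>2)"
      by (simp add: EP)
    also have "\<dots> = (\<Sum>k\<in>UNIV. t $ k * (p $ k * (t $ k - t \<bullet> p))) - (t \<bullet> p) * (\<Sum>k\<in>UNIV. p $ k * (t $ k - t \<bullet> p))"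
      by (simp add: sum_distrib_left power2_eq_square algebra_simps flip: sum_subtractf)
    also have "(\<Sum>k\<in>UNIV. p $ k * (t $ k - t \<bullet> p)) = 0"
      using mean by (simp add: EP)
    finally show ?thesis by (simp add: inner_vec_def[of t "Sigma_prop p *v t"] Sigma_prop_mult inner_commute)
  qed
  have eq: "(\<integral>\<omega>. cis (t \<bullet> (sqrt (real n) *\<^sub>R (prop_hat n (\<lambda>i. Z i \<omega>) - p))) \<partial>M) = char P (1 / sqrt n) ^ n"
    if "n > 0" for n
  proof -
    have "t \<bullet> (sqrt (real n) *\<^sub>R (prop_hat n (\<lambda>i. Z i \<omega>) - p)) = 1 / sqrt n * (\<Sum>i<n. X i \<omega>)" for \<omega>
    proof -
      have "prop_hat n (\<lambda>i. Z i \<omega>) = (1 / n) *\<^sub>R (\<Sum>i<n. Z i \<omega>)"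
        by (simp add: prop_hat_def vec_eq_iff)
      moreover have "(\<Sum>i<n. X i \<omega>) = t \<bullet> (\<Sum>i<n. Z i \<omega>) - n * (t \<bullet> p)"
        by (simp add: X_def sum_subtractf inner_sum_right)
      moreover have "1 / sqrt n = sqrt n / n"
        using that by (simp add: field_simps)
      ultimately show ?thesis using that by (simp add: inner_diff_right right_diff_distrib diff_divide_distrib)
    qed
    then have "(\<integral>\<omega>. cis (t \<bullet> (sqrt (real n) *\<^sub>R (prop_hat n (\<lambda>i. Z i \<omega>) - p))) \<partial>M)
        = char (distr M borel (\<lambda>\<omega>. \<Sum>i<n. X i \<omega>)) (1 / sqrt n)"
      by (simp add: char_def integral_distr cis_conv_exp)
    also have "\<dots> = (\<Prod>i<n. char (distr M borel (X i)) (1 / sqrt n))"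
    proof (rule char_distr_sum)
      show "indep_vars (\<lambda>i. borel) X {..<n}"
        unfolding X_def by (rule indep_vars_compose2[OF Z_indep, where Y = "\<lambda>i z. t \<bullet> z - t \<bullet> p"]) measurable
    qed
    finally show ?thesis by (simp add: char)
  qed
  have "(\<lambda>n. char P (1 / sqrt (real n)) ^ n) \<longlonglongrightarrow> of_real (exp (- 1 * (t \<bullet> (Sigma_prop p *v t)) / 2))"
  proof (rule P.char_power_tendsto[OF IP1 mean IP2 var])
    have "(\<lambda>n. sqrt (1 / real n)) \<longlonglongrightarrow> sqrt 0"
      by (intro tendsto_real_sqrt lim_1_over_n)
    then show "(\<lambda>n. 1 / sqrt (real n)) \<longlonglongrightarrow> 0" by (simp add: real_sqrt_divide)
    show "(\<lambda>n. real n * (1 / sqrt (real n))\<^sup>2) \<longlonglongrightarrow> 1"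
      by (rule tendsto_eventually) (auto simp: power_divide eventually_sequentially intro!: exI[of _ 1])
  qed
  then have "(\<lambda>n. char P (1 / sqrt (real n)) ^ n) \<longlonglongrightarrow> of_real (exp (- (t \<bullet> (Sigma_prop p *v t)) / 2))"
    by simp
  then show ?thesis
  proof (rule Lim_transform_eventually)
    show "\<forall>\<^sub>F n in sequentially. char P (1 / sqrt (real n)) ^ n
        = (\<integral>\<omega>. cis (t \<bullet> (sqrt (real n) *\<^sub>R (prop_hat n (\<lambda>i. Z i \<omega>) - p))) \<partial>M)"
      using eventually_gt_at_top[of 0] by eventually_elim (simp only: eq)
  qed
qed

lemma conv_prop_hat:
  "conv_in_dist M (\<lambda>n \<omega>. sqrt (real n) *\<^sub>R (prop_hat n (\<lambda>i. Z i \<omega>) - p)) sequentially (mvn_law (Sigma_prop p))"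
proof -
  obtain L :: "real^'k^'k" where L: "L ** transpose L = Sigma_prop p"
    using Sigma_prop_factor[OF p] by blast
  show ?thesis
    by (rule conv_in_dist_charI[OF prob_space_axioms mvn_law_factor(2,1)[OF L]])
       (use char_prop_hat in \<open>auto simp: mvn_law_factor(3)[OF L]\<close>)
qed

text \<open>The weak law of large numbers, read off from the central limit theorem: the rescaled
  error is tight, whereas an error of size \<open>\<delta>\<close> is eventually rescaled beyond any
  fixed bound.\<close>

lemma prop_hat_in_prob:
  assumes e: "e > 0" and \<delta>: "\<delta> > 0"
  shows "\<forall>\<^sub>F n in sequentially. prob {\<omega> \<in> space M. \<delta> \<le> dist (prop_hat n (\<lambda>i. Z i \<omega>)) p} < e"
proof -
  obtain L :: "real^'k^'k" where L: "L ** transpose L = Sigma_prop p"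
    using Sigma_prop_factor[OF p] by blast
  obtain K where K: "K > 0"
    "\<forall>\<^sub>F n in sequentially. prob {\<omega> \<in> space M. K < norm (sqrt (real n) *\<^sub>R (prop_hat n (\<lambda>i. Z i \<omega>) - p))} < e"
    using conv_in_dist_tight[OF prob_space_axioms mvn_law_factor(2,1)[OF L] conv_prop_hat e] by blast
  have "\<forall>\<^sub>F n in sequentially. K / \<delta> < sqrt (real n)"
    using filterlim_compose[OF sqrt_at_top filterlim_real_sequentially] by (simp add: filterlim_at_top_dense)
  with K(2) show ?thesis
  proof eventually_elim
    case (elim n)
    have "prob {\<omega> \<in> space M. \<delta> \<le> dist (prop_hat n (\<lambda>i. Z i \<omega>)) p}
        \<le> prob {\<omega> \<in> space M. K < norm (sqrt (real n) *\<^sub>R (prop_hat n (\<lambda>i. Z i \<omega>) - p))}"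
    proof (rule finite_measure_mono, safe)
      fix \<omega> assume "\<delta> \<le> dist (prop_hat n (\<lambda>i. Z i \<omega>)) p"
      then have "sqrt n * \<delta> \<le> sqrt n * norm (prop_hat n (\<lambda>i. Z i \<omega>) - p)"
        by (intro mult_left_mono) (auto simp: dist_norm)
      moreover have "K < sqrt n * \<delta>" using elim(2) \<delta> by (simp add: field_simps)
      ultimately show "K < norm (sqrt (real n) *\<^sub>R (prop_hat n (\<lambda>i. Z i \<omega>) - p))" by simp
    qed measurable
    then show ?case using elim(1) by linarith
  qed
qed

end

section \<open>The model conditioned on the labels\<close>

lemma (in prob_space) integral_uniform_measure:
  fixes f :: "'a \<Rightarrow> 'b::{banach, second_countable_topology}"
  assumes A [measurable]: "A \<in> events" and pos: "prob A > 0" and f [measurable]: "f \<in> borel_measurable M"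
  shows "(\<integral>\<omega>. f \<omega> \<partial>uniform_measure M A) = (1 / prob A) *\<^sub>R (\<integral>\<omega>. indicator A \<omega> *\<^sub>R f \<omega> \<partial>M)"
proof -
  have "uniform_measure M A = density M (\<lambda>\<omega>. ennreal (indicator A \<omega> / prob A))"
    unfolding uniform_measure_def
    using pos by (intro density_cong) (auto simp: emeasure_eq_measure divide_ennreal indicator_def
        simp flip: ennreal_1)
  then have "(\<integral>\<omega>. f \<omega> \<partial>uniform_measure M A) = (\<integral>\<omega>. (indicator A \<omega> / prob A) *\<^sub>R f \<omega> \<partial>M)"
    by (simp add: integral_density)
  also have "\<dots> = (\<integral>\<omega>. (1 / prob A) *\<^sub>R (indicator A \<omega> *\<^sub>R f \<omega>) \<partial>M)"
    by simp
  also have "\<dots> = (1 / prob A) *\<^sub>R (\<integral>\<omega>. indicator A \<omega> *\<^sub>R f \<omega> \<partial>M)"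
    by (rule integral_scaleR_right)
  finally show ?thesis .
qed

text \<open>Independence says that the joint law is the product of the marginals, and neither side
  notices null sets. It is needed because the estimators are functions of separate blocks only
  almost surely given the labels.\<close>

lemma (in prob_space) indep_vars_cong_AE:
  assumes I: "I \<noteq> {}" "finite I" and ind: "indep_vars M' X I"
    and Y: "\<And>i. i \<in> I \<Longrightarrow> Y i \<in> measurable M (M' i)"
    and ae: "\<And>i. i \<in> I \<Longrightarrow> AE \<omega> in M. X i \<omega> = Y i \<omega>"
  shows "indep_vars M' Y I"
proof -
  have X: "X i \<in> measurable M (M' i)" if "i \<in> I" for i
    using ind that by (auto simp: indep_vars_def)
  have ae': "AE \<omega> in M. \<forall>i\<in>I. X i \<omega> = Y i \<omega>"
    using ae by (intro AE_finite_allI I)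
  have "distr M (\<Pi>\<^sub>M i\<in>I. M' i) (\<lambda>x. \<lambda>i\<in>I. Y i x) = distr M (\<Pi>\<^sub>M i\<in>I. M' i) (\<lambda>x. \<lambda>i\<in>I. X i x)"
  proof (rule distr_cong_AE[OF refl refl])
    show "AE x in M. (\<lambda>i\<in>I. Y i x) = (\<lambda>i\<in>I. X i x)"
      using ae' by eventually_elim auto
  qed (auto intro!: measurable_restrict X Y)
  also have "\<dots> = (\<Pi>\<^sub>M i\<in>I. distr M (M' i) (X i))"
    using indep_vars_iff_distr_eq_PiM'[OF I(1) X] ind by auto
  also have "\<dots> = (\<Pi>\<^sub>M i\<in>I. distr M (M' i) (Y i))"
    using ae X Y by (intro PiM_cong refl distr_cong_AE) auto
  finally show ?thesis
    using indep_vars_iff_distr_eq_PiM'[OF I(1) Y] by auto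
qed

definition block :: "nat \<Rightarrow> nat \<Rightarrow> (nat \<Rightarrow> 'g) \<Rightarrow> (nat \<Rightarrow> 'm) \<Rightarrow> 'g \<times> 'm \<Rightarrow> (nat \<times> nat) set" where
  "block n d r c kl = {p. p \<in> {..<n} \<times> {..<d} \<and> (r (fst p), c (snd p)) = kl}"

lemma finite_block [simp]: "finite (block n d r c kl)"
  unfolding block_def by (rule finite_subset[of _ "{..<n} \<times> {..<d}"]) auto

lemma card_block: "card (block n d r c (k, l)) = label_count n r k * label_count d c l"
proof -
  have "block n d r c (k, l) = {i. i < n \<and> r i = k} \<times> {j. j < d \<and> c j = l}"
    by (auto simp: block_def)
  then show ?thesis by (simp add: label_count_def card_cartesian_product)
qed

lemma x_hat_labels:
  assumes z: "\<And>i. i < n \<Longrightarrow> z i = onehot (r i)" and w: "\<And>j. j < d \<Longrightarrow> w j = onehot (c j)"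
  shows "x_hat n d x z w k l
    = (\<Sum>p\<in>block n d r c (k, l). x (fst p) (snd p)) / (real (label_count n r k) * real (label_count d c l))"
proof -
  have "(\<Sum>i<n. \<Sum>j<d. x i j * z i $ k * w j $ l)
      = (\<Sum>i<n. \<Sum>j<d. if (r i, c j) = (k, l) then x i j else 0)"
    by (intro sum.cong refl) (auto simp: z w axis_def)
  also have "\<dots> = (\<Sum>p\<in>{..<n} \<times> {..<d}. if (r (fst p), c (snd p)) = (k, l) then x (fst p) (snd p) else 0)"
    by (simp add: sum.cartesian_product case_prod_beta)
  also have "\<dots> = (\<Sum>p\<in>block n d r c (k, l). x (fst p) (snd p))"
    unfolding block_def by (subst sum.inter_filter[symmetric]) auto
  moreover have "(\<Sum>i<n. z i $ k) = label_count n r k"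
    by (subst sum_label_count[symmetric], intro sum.cong refl) (auto simp: z axis_def)
  moreover have "(\<Sum>j<d. w j $ l) = label_count d c l"
    by (subst sum_label_count[symmetric], intro sum.cong refl) (auto simp: w axis_def)
  ultimately show ?thesis by (simp add: x_hat_def)
qed

locale lbm_model = ef \<mu> b \<psi> A
  for \<mu> :: "real measure" and b \<psi> :: "real \<Rightarrow> real" and A :: "real set" +
  fixes M :: "'a measure" and \<pi> :: "real^'g::finite" and \<rho> :: "real^'m::finite" and \<alpha> :: "real^'m^'g"
    and Z :: "nat \<Rightarrow> 'a \<Rightarrow> real^'g" and W :: "nat \<Rightarrow> 'a \<Rightarrow> real^'m" and X :: "nat \<Rightarrow> nat \<Rightarrow> 'a \<Rightarrow> real"
  assumes model: "\<And>n d. lbm M \<mu> b \<psi> (\<pi>, \<rho>, \<alpha>) n d Z W X"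
    and pv: "prob_vector \<pi>" "prob_vector \<rho>"
    and pos: "\<And>k. \<pi> $ k > 0" "\<And>l. \<rho> $ l > 0"
    and interior: "\<And>k l. \<alpha> $ k $ l \<in> interior A"
begin

sublocale prob_space M using model[of 0 0] by (simp add: lbm_def)

sublocale rows: labels M \<pi> Z
proof
  show "iid_assignment M n \<pi> Z" for n using model[of n 0] by (simp add: lbm_def)
qed (rule pv)

sublocale cols: labels M \<rho> W
proof
  show "iid_assignment M d \<rho> W" for d using model[of 0 d] by (simp add: lbm_def)
qed (rule pv)

lemma X_meas [measurable]: "X i j \<in> borel_measurable M"
  using model[of "Suc i" "Suc j"] unfolding lbm_def by simp

lemma alpha_in: "\<alpha> $ k $ l \<in> A"
  using interior interior_subset by blast

definition E :: "nat \<Rightarrow> nat \<Rightarrow> (nat \<Rightarrow> 'g) \<Rightarrow> (nat \<Rightarrow> 'm) \<Rightarrow> 'a set" where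
  "E n d r c = {\<omega> \<in> space M. (\<forall>i<n. Z i \<omega> = onehot (r i)) \<and> (\<forall>j<d. W j \<omega> = onehot (c j))}"

abbreviation given :: "nat \<Rightarrow> nat \<Rightarrow> (nat \<Rightarrow> 'g) \<Rightarrow> (nat \<Rightarrow> 'm) \<Rightarrow> 'a measure" where
  "given n d r c \<equiv> given_labels M Z W n d r c"

lemma given_eq: "given n d r c = uniform_measure M (E n d r c)"
  by (simp add: given_labels_def E_def)

lemma E_event [measurable]: "E n d r c \<in> events"
  unfolding E_def by measurable

lemma prob_E: "prob (E n d r c) = (\<Prod>i<n. \<pi> $ r i) * (\<Prod>j<d. \<rho> $ c j)"
proof -
  have "indep_set (assignment_events M n Z) (assignment_events M d W)"
    using model[of n d] by (simp add: lbm_def)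
  from indep_setD[OF this rows.label_event cols.label_event]
  have "prob ({\<omega> \<in> space M. \<forall>i<n. Z i \<omega> = onehot (r i)} \<inter> {\<omega> \<in> space M. \<forall>j<d. W j \<omega> = onehot (c j)})
      = (\<Prod>i<n. \<pi> $ r i) * (\<Prod>j<d. \<rho> $ c j)"
    by (simp add: rows.prob_label_event cols.prob_label_event)
  moreover have "{\<omega> \<in> space M. \<forall>i<n. Z i \<omega> = onehot (r i)} \<inter> {\<omega> \<in> space M. \<forall>j<d. W j \<omega> = onehot (c j)} = E n d r c"
    by (auto simp: E_def)
  ultimately show ?thesis by simp
qed

lemma prob_E_pos: "prob (E n d r c) > 0"
  unfolding prob_E by (intro mult_pos_pos prod_pos) (simp_all add: pos)

lemma prob_space_given: "prob_space (given n d r c)"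
  unfolding given_eq using prob_E_pos[of n d r c]
  by (intro prob_space_uniform_measure) (auto simp: emeasure_eq_measure)

lemma sets_given [simp, measurable_cong]: "sets (given n d r c) = events"
  by (simp add: given_eq)

lemma measurable_given [simp]: "measurable (given n d r c) N = measurable M N"
  by (rule measurable_cong_sets) auto

lemma indep_given: "prob_space.indep_vars (given n d r c) (\<lambda>_. borel) (\<lambda>p. X (fst p) (snd p)) ({..<n} \<times> {..<d})"
  using model[of n d] pos by (simp add: lbm_def case_prod_beta')

lemma distr_given: "i < n \<Longrightarrow> j < d \<Longrightarrow> distr (given n d r c) borel (X i j) = law (\<alpha> $ r i $ c j)"
  using model[of n d] pos by (simp add: lbm_def)

lemma AE_given: "AE \<omega> in given n d r c. \<omega> \<in> E n d r c"
  unfolding given_eq by (rule AE_uniform_measureI) auto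

lemma E_iff_labs:
  assumes "\<omega> \<in> space M" "r \<in> {..<n} \<rightarrow>\<^sub>E UNIV" "c \<in> {..<d} \<rightarrow>\<^sub>E UNIV"
  shows "\<omega> \<in> E n d r c \<longleftrightarrow> (r, c) = (rows.labs n \<omega>, cols.labs d \<omega>)"
  using rows.labs_eq_iff[OF assms(1,2)] cols.labs_eq_iff[OF assms(1,3)] assms(1)
  unfolding E_def by auto

text \<open>The events \<open>E n d r c\<close> partition the space, so exactly one summand
  survives. This yields measurability of functions of the labels and the formula of total
  expectation.\<close>

lemma sum_over_labels:
  fixes h :: "(nat \<Rightarrow> 'g) \<Rightarrow> (nat \<Rightarrow> 'm) \<Rightarrow> complex"
  assumes "\<omega> \<in> space M"
  shows "h (rows.labs n \<omega>) (cols.labs d \<omega>) = (\<Sum>(r, c)\<in>({..<n} \<rightarrow>\<^sub>E UNIV) \<times> ({..<d} \<rightarrow>\<^sub>E UNIV).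
    indicator (E n d r c) \<omega> *\<^sub>R h r c)"
proof -
  let ?S = "({..<n} \<rightarrow>\<^sub>E UNIV :: (nat \<Rightarrow> 'g) set) \<times> ({..<d} \<rightarrow>\<^sub>E UNIV :: (nat \<Rightarrow> 'm) set)"
  let ?rc = "(rows.labs n \<omega>, cols.labs d \<omega>)"
  have "(\<Sum>(r, c)\<in>?S. indicator (E n d r c) \<omega> *\<^sub>R h r c) = (\<Sum>rc\<in>?S. if rc = ?rc then h (fst rc) (snd rc) else 0)"
    using E_iff_labs[OF assms] by (intro sum.cong refl) (auto simp: indicator_def)
  also have "\<dots> = h (rows.labs n \<omega>) (cols.labs d \<omega>)"
    using rows.labs_in cols.labs_in by (subst sum.delta) (auto intro!: finite_PiE)
  finally show ?thesis by simp
qed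

lemma measurable_labs:
  fixes h :: "(nat \<Rightarrow> 'g) \<Rightarrow> (nat \<Rightarrow> 'm) \<Rightarrow> complex"
  shows "(\<lambda>\<omega>. h (rows.labs n \<omega>) (cols.labs d \<omega>)) \<in> borel_measurable M"
proof (subst measurable_cong[OF sum_over_labels])
  show "(\<lambda>\<omega>. \<Sum>(r, c)\<in>({..<n} \<rightarrow>\<^sub>E UNIV) \<times> ({..<d} \<rightarrow>\<^sub>E UNIV).
      indicator (E n d r c) \<omega> *\<^sub>R h r c) \<in> borel_measurable M"
    unfolding case_prod_beta by (intro borel_measurable_sum borel_measurable_scaleR) auto
qed

text \<open>The law of total expectation: \<open>h\<close> is the conditional expectation as a
  function of the labels. On each cell both sides integrate to \<open>prob (E n d r c)\<close> times
  \<open>h r c\<close>.\<close>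

lemma integral_by_labels:
  fixes F :: "'a \<Rightarrow> complex"
  assumes Fm: "F \<in> borel_measurable M" and F1: "\<And>\<omega>. norm (F \<omega>) \<le> 1"
    and h: "\<And>r c. (\<integral>\<omega>. F \<omega> \<partial>given n d r c) = h r c"
  shows "(\<integral>\<omega>. F \<omega> \<partial>M) = (\<integral>\<omega>. h (rows.labs n \<omega>) (cols.labs d \<omega>) \<partial>M)"
proof -
  let ?S = "({..<n} \<rightarrow>\<^sub>E UNIV :: (nat \<Rightarrow> 'g) set) \<times> ({..<d} \<rightarrow>\<^sub>E UNIV :: (nat \<Rightarrow> 'm) set)"
  have i1: "integrable M (\<lambda>\<omega>. indicator (E n d r c) \<omega> *\<^sub>R F \<omega>)" for r c
    using Fm F1 by (intro integrable_const_bound[of _ 1]) (auto simp: indicator_def)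
  have i2: "integrable M (\<lambda>\<omega>. indicator (E n d r c) \<omega> *\<^sub>R h r c)" for r c
    by (intro integrable_const_bound[of _ "norm (h r c)"]) (auto simp: indicator_def)
  have eq: "(\<integral>\<omega>. indicator (E n d r c) \<omega> *\<^sub>R F \<omega> \<partial>M) = (\<integral>\<omega>. indicator (E n d r c) \<omega> *\<^sub>R h r c \<partial>M)" for r c
  proof -
    have "h r c = (1 / prob (E n d r c)) *\<^sub>R (\<integral>\<omega>. indicator (E n d r c) \<omega> *\<^sub>R F \<omega> \<partial>M)"
      unfolding h[symmetric] given_eq by (rule integral_uniform_measure[OF E_event prob_E_pos Fm])
    then have "(\<integral>\<omega>. indicator (E n d r c) \<omega> *\<^sub>R F \<omega> \<partial>M) = prob (E n d r c) *\<^sub>R h r c"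
      using prob_E_pos[of n d r c] by simp
    also have "\<dots> = (\<integral>\<omega>. indicator (E n d r c) \<omega> *\<^sub>R h r c \<partial>M)"
    proof -
      have "E n d r c \<inter> space M = E n d r c" by (auto simp: E_def)
      moreover have "integrable M (indicator (E n d r c) :: 'a \<Rightarrow> real)"
        by (intro integrable_const_bound[of _ 1]) (auto simp: indicator_def)
      ultimately show ?thesis by (subst integral_scaleR_left) auto
    qed
    finally show ?thesis .
  qed
  \<comment> \<open>Here \<open>sum_over_labels\<close> is applied to the function of labels with
    constant value \<open>F \<omega>\<close>; it says that the indicators sum to 1.\<close>
  have "(\<integral>\<omega>. F \<omega> \<partial>M) = (\<integral>\<omega>. (\<Sum>(r, c)\<in>?S. indicator (E n d r c) \<omega> *\<^sub>R F \<omega>) \<partial>M)"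
    by (rule Bochner_Integration.integral_cong[OF refl]) (rule sum_over_labels)
  also have "\<dots> = (\<Sum>(r, c)\<in>?S. \<integral>\<omega>. indicator (E n d r c) \<omega> *\<^sub>R F \<omega> \<partial>M)"
    unfolding case_prod_beta by (rule Bochner_Integration.integral_sum) (rule i1)
  also have "\<dots> = (\<Sum>(r, c)\<in>?S. \<integral>\<omega>. indicator (E n d r c) \<omega> *\<^sub>R h r c \<partial>M)"
    by (simp only: eq)
  also have "\<dots> = (\<integral>\<omega>. (\<Sum>(r, c)\<in>?S. indicator (E n d r c) \<omega> *\<^sub>R h r c) \<partial>M)"
    unfolding case_prod_beta by (rule Bochner_Integration.integral_sum[symmetric]) (rule i2)
  also have "\<dots> = (\<integral>\<omega>. h (rows.labs n \<omega>) (cols.labs d \<omega>) \<partial>M)"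
    by (rule Bochner_Integration.integral_cong[OF refl sum_over_labels[symmetric]])
  finally show ?thesis .
qed

abbreviation xh :: "nat \<Rightarrow> nat \<Rightarrow> 'g \<Rightarrow> 'm \<Rightarrow> 'a \<Rightarrow> real" where
  "xh n d k l \<omega> \<equiv> x_hat n d (\<lambda>i j. X i j \<omega>) (\<lambda>i. Z i \<omega>) (\<lambda>j. W j \<omega>) k l"

abbreviation ah :: "nat \<Rightarrow> nat \<Rightarrow> 'g \<Rightarrow> 'm \<Rightarrow> 'a \<Rightarrow> real" where
  "ah n d k l \<omega> \<equiv> alpha_hat \<psi> A n d (\<lambda>i j. X i j \<omega>) (\<lambda>i. Z i \<omega>) (\<lambda>j. W j \<omega>) k l"

lemma xh_meas [measurable]: "xh n d k l \<in> borel_measurable M"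
  unfolding x_hat_def by measurable

lemma ah_meas [measurable]: "ah n d k l \<in> borel_measurable M"
  unfolding alpha_hat_def by (rule measurable_compose[OF xh_meas measurable_inverse])

lemma xh_on_E:
  assumes "\<omega> \<in> E n d r c"
  shows "xh n d k l \<omega> = (\<Sum>p\<in>block n d r c (k, l). X (fst p) (snd p) \<omega>)
    / (real (label_count n r k) * real (label_count d c l))"
  by (rule x_hat_labels) (use assms in \<open>auto simp: E_def\<close>)

lemma indep_alpha_hat_given:
  "prob_space.indep_vars (given n d r c) (\<lambda>_. borel) (\<lambda>(k, l). ah n d k l) UNIV"
proof -
  interpret Q: prob_space "given n d r c" by (rule prob_space_given)
  let ?f = "\<lambda>kl f. inv_into (interior A) (deriv \<psi>) ((\<Sum>p\<in>block n d r c kl. f p)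
    / (real (label_count n r (fst kl)) * real (label_count d c (snd kl))))"
  have "Q.indep_vars (\<lambda>kl. PiM (block n d r c kl) (\<lambda>_. borel))
      (\<lambda>kl \<omega>. \<lambda>p\<in>block n d r c kl. X (fst p) (snd p) \<omega>) UNIV"
    by (rule Q.indep_vars_restrict[OF indep_given]) (auto simp: block_def disjoint_family_on_def)
  then have "Q.indep_vars (\<lambda>_. borel)
      (\<lambda>kl \<omega>. ?f kl (\<lambda>p\<in>block n d r c kl. X (fst p) (snd p) \<omega>)) UNIV"
  proof (rule Q.indep_vars_compose2)
    fix kl :: "'g \<times> 'm"
    show "?f kl \<in> borel_measurable (PiM (block n d r c kl) (\<lambda>_. borel :: real measure))"
      by (rule measurable_compose[OF _ measurable_inverse]) measurable
  qed
  \<comment> \<open>In \<open>?f\<close> the block and its size are frozen at \<open>r\<close> and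
    \<open>c\<close>, whereas the estimator reads them from the random labels. The two agree on
    \<open>E n d r c\<close>, which has conditional probability 1.\<close>
  then show ?thesis
  proof (rule Q.indep_vars_cong_AE[rotated 2])
    fix kl :: "'g \<times> 'm"
    show "(case kl of (k, l) \<Rightarrow> ah n d k l) \<in> borel_measurable (given n d r c)"
      by (cases kl) simp
    show "AE \<omega> in given n d r c. ?f kl (\<lambda>p\<in>block n d r c kl. X (fst p) (snd p) \<omega>)
        = (case kl of (k, l) \<Rightarrow> ah n d k l) \<omega>"
      using AE_given[of n d r c]
    proof eventually_elim
      case (elim \<omega>)
      then show ?case by (cases kl) (simp add: alpha_hat_def xh_on_E)
    qed
  qed auto
qed

end

section \<open>Asymptotic normality of the block estimators\<close>

lemma matrix_inv_diag_mat:
  fixes v :: "real^'k"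
  assumes "\<And>i. v $ i \<noteq> 0"
  shows "matrix_inv (diag_mat v) = diag_mat (\<chi> i. 1 / v $ i)"
proof -
  let ?w = "\<chi> i. 1 / v $ i"
  have mult: "diag_mat x ** diag_mat y = diag_mat (\<chi> i. x $ i * y $ i)" for x y :: "real^'k"
    by (simp add: diag_mat_def matrix_matrix_mult_def vec_eq_iff if_distrib[of "\<lambda>z. z * _"]
        if_distrib[of "\<lambda>z. _ * z"] cong: if_cong)
  have "diag_mat (\<chi> i. 1) = (mat 1 :: real^'k^'k)"
    by (simp add: diag_mat_def mat_def vec_eq_iff)
  then have inv: "diag_mat v ** diag_mat ?w = mat 1" "diag_mat ?w ** diag_mat v = mat 1"
    using assms by (simp_all add: mult)
  let ?P = "\<lambda>B. diag_mat v ** B = mat 1 \<and> B ** diag_mat v = mat 1"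
  have "?P (SOME B. ?P B)" by (rule someI[of ?P "diag_mat ?w"]) (simp add: inv)
  then have "diag_mat v ** matrix_inv (diag_mat v) = mat 1" by (simp add: matrix_inv_def)
  then have "diag_mat ?w ** (diag_mat v ** matrix_inv (diag_mat v)) = diag_mat ?w"
    by (simp add: matrix_mul_rid)
  then show ?thesis
    unfolding matrix_mul_assoc inv(2) matrix_mul_lid .
qed

lemma Sigma_alpha_nth:
  assumes "\<And>k. \<pi> $ k > 0" "\<And>l. \<rho> $ l > 0"
  shows "Sigma_alpha \<psi> (\<pi>, \<rho>, \<alpha>) $ k $ l = 1 / (\<pi> $ k * \<rho> $ l * deriv (deriv \<psi>) (\<alpha> $ k $ l))"
proof -
  have nz: "\<pi> $ i \<noteq> 0" "\<rho> $ j \<noteq> 0" for i j using assms(1)[of i] assms(2)[of j] by auto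
  show ?thesis
    unfolding Sigma_alpha_def prod.case matrix_inv_diag_mat[OF nz(1)] matrix_inv_diag_mat[OF nz(2)]
    by (simp add: diag_mat_def V_mat_def matrix_matrix_mult_def
        if_distrib[of "\<lambda>z. z * _"] if_distrib[of "\<lambda>z. _ * z"]
        if_distrib[of "\<lambda>z. z / _"] sum.delta sum.delta' cong: if_cong)
qed

lemma inv_sqrt_tendsto_0:
  assumes "filterlim n sequentially F"
  shows "((\<lambda>x. 1 / sqrt (real (n x))) \<longlongrightarrow> 0) F"
proof -
  have "(\<lambda>n. sqrt (1 / real n)) \<longlonglongrightarrow> sqrt 0"
    by (intro tendsto_real_sqrt lim_1_over_n)
  then have "(\<lambda>n. 1 / sqrt (real n)) \<longlonglongrightarrow> 0" by (simp add: real_sqrt_divide)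
  then show ?thesis using assms by (rule filterlim_compose)
qed

text \<open>A limit along this filter is a deterministic statement; combined with the convergence of the
  class proportions in probability it yields the limit of an expectation over random labels.\<close>

definition label_filter ::
    "real^'g \<Rightarrow> real^'m \<Rightarrow> ((nat \<times> nat) \<times> (nat \<Rightarrow> 'g) \<times> (nat \<Rightarrow> 'm)) filter" where
  "label_filter p q = filtercomap
     (\<lambda>x. (fst x, (\<chi> k. real (label_count (fst (fst x)) (fst (snd x)) k) / real (fst (fst x))),
        (\<chi> l. real (label_count (snd (fst x)) (snd (snd x)) l) / real (snd (fst x)))))
     ((sequentially \<times>\<^sub>F sequentially) \<times>\<^sub>F nhds p \<times>\<^sub>F nhds q)"

lemma label_filter_limits:
  shows "filterlim (\<lambda>x. fst (fst x)) sequentially (label_filter p q)"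
    and "filterlim (\<lambda>x. snd (fst x)) sequentially (label_filter p q)"
    and "((\<lambda>x. real (label_count (fst (fst x)) (fst (snd x)) k) / real (fst (fst x))) \<longlongrightarrow> p $ k) (label_filter p q)"
    and "((\<lambda>x. real (label_count (snd (fst x)) (snd (snd x)) l) / real (snd (fst x))) \<longlongrightarrow> q $ l) (label_filter p q)"
proof -
  let ?f = "(\<lambda>x. (fst x, (\<chi> k. real (label_count (fst (fst x)) (fst (snd x)) k) / real (fst (fst x))),
        (\<chi> l. real (label_count (snd (fst x)) (snd (snd x)) l) / real (snd (fst x)))))"
  have *: "filterlim ?f ((sequentially \<times>\<^sub>F sequentially) \<times>\<^sub>F nhds p \<times>\<^sub>F nhds q) (label_filter p q)"
    unfolding label_filter_def by (rule filterlim_filtercomap)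
  have 1: "filterlim fst (sequentially \<times>\<^sub>F sequentially) (label_filter p q)"
    using filterlim_compose[OF filterlim_fst *] by simp
  show "filterlim (\<lambda>x. fst (fst x)) sequentially (label_filter p q)"
    using filterlim_compose[OF filterlim_fst 1] by simp
  show "filterlim (\<lambda>x. snd (fst x)) sequentially (label_filter p q)"
    using filterlim_compose[OF filterlim_snd 1] by simp
  have 2: "filterlim (\<lambda>x. snd (?f x)) (nhds p \<times>\<^sub>F nhds q) (label_filter p q)"
    using filterlim_compose[OF filterlim_snd *] by simp
  show "((\<lambda>x. real (label_count (fst (fst x)) (fst (snd x)) k) / real (fst (fst x))) \<longlongrightarrow> p $ k) (label_filter p q)"
    using tendsto_vec_nth[OF filterlim_compose[OF filterlim_fst 2], of k] by simp
  show "((\<lambda>x. real (label_count (snd (fst x)) (snd (snd x)) l) / real (snd (fst x))) \<longlongrightarrow> q $ l) (label_filter p q)"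
    using tendsto_vec_nth[OF filterlim_compose[OF filterlim_snd 2], of l] by simp
qed

text \<open>Puts a property along the filter into the form that convergence in probability can feed:
  a condition on the sizes and one radius for both vectors of proportions.\<close>

lemma eventually_label_filterD:
  assumes "eventually P (label_filter p q)"
  shows "\<exists>Q \<delta>. eventually Q (sequentially \<times>\<^sub>F sequentially) \<and> \<delta> > 0 \<and>
    (\<forall>n d r c. Q (n, d) \<longrightarrow> dist (\<chi> k. real (label_count n r k) / real n) p < \<delta> \<longrightarrow>
      dist (\<chi> l. real (label_count d c l) / real d) q < \<delta> \<longrightarrow> P ((n, d), r, c))"
proof -
  obtain R where R: "eventually R ((sequentially \<times>\<^sub>F sequentially) \<times>\<^sub>F nhds p \<times>\<^sub>F nhds q)"
    "\<And>n d r c. R ((n, d), (\<chi> k. real (label_count n r k) / real n), (\<chi> l. real (label_count d c l) / real d))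
      \<Longrightarrow> P ((n, d), r, c)"
    using assms unfolding label_filter_def eventually_filtercomap by auto
  then obtain Q S where Q: "eventually Q (sequentially \<times>\<^sub>F sequentially)" "eventually S (nhds p \<times>\<^sub>F nhds q)"
    "\<And>x y. Q x \<Longrightarrow> S y \<Longrightarrow> R (x, y)"
    unfolding eventually_prod_filter[of R] by blast
  then obtain S1 S2 where S: "eventually S1 (nhds p)" "eventually S2 (nhds q)" "\<And>x y. S1 x \<Longrightarrow> S2 y \<Longrightarrow> S (x, y)"
    unfolding eventually_prod_filter[of S] by blast
  obtain d1 where d1: "d1 > 0" "\<And>x. dist x p < d1 \<Longrightarrow> S1 x"
    using S(1) unfolding eventually_nhds_metric by blast
  obtain d2 where d2: "d2 > 0" "\<And>x. dist x q < d2 \<Longrightarrow> S2 x"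
    using S(2) unfolding eventually_nhds_metric by blast
  show ?thesis
    by (rule exI[of _ Q], rule exI[of _ "min d1 d2"]) (auto intro!: Q(1) R(2) Q(3) S(3) d1 d2)
qed

context lbm_model
begin

section \<open>Characteristic functions of the rescaled block means\<close>

abbreviation V :: "'g \<Rightarrow> 'm \<Rightarrow> real" where "V k l \<equiv> deriv (deriv \<psi>) (\<alpha> $ k $ l)"

abbreviation m :: "'g \<Rightarrow> 'm \<Rightarrow> real" where "m k l \<equiv> mean (\<alpha> $ k $ l)"

abbreviation N\<^sub>r where "N\<^sub>r x k \<equiv> label_count (fst (fst x)) (fst (snd x)) k"

abbreviation N\<^sub>c where "N\<^sub>c x l \<equiv> label_count (snd (fst x)) (snd (snd x)) l"

lemma V_pos: "V k l > 0"
  using interior by (rule variance_pos)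

text \<open>Dividing by the variance makes the limit law that of the estimators of \<open>\<alpha>\<close> themselves.\<close>

definition Y :: "nat \<times> nat \<Rightarrow> 'a \<Rightarrow> real^'m^'g" where
  "Y nd \<omega> = (\<chi> k l. sqrt (real (fst nd) * real (snd nd)) * (xh (fst nd) (snd nd) k l \<omega> - m k l) / V k l)"

lemma Y_meas [measurable]: "Y nd \<in> borel_measurable M"
  unfolding Y_def by (intro measurable_vecI) (simp only: vec_lambda_beta, measurable)

definition cent :: "'g \<Rightarrow> 'm \<Rightarrow> real measure" where
  "cent k l = distr (law (\<alpha> $ k $ l)) borel (\<lambda>x. x - m k l)"

lemma cent:
  shows "real_distribution (cent k l)" and "integrable (cent k l) (\<lambda>x. x)" and "integral\<^sup>L (cent k l) (\<lambda>x. x) = 0"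
    and "integrable (cent k l) (\<lambda>x. x\<^sup>2)" and "integral\<^sup>L (cent k l) (\<lambda>x. x\<^sup>2) = V k l"
proof -
  interpret P: prob_space "law (\<alpha> $ k $ l)" by (rule prob_space_law[OF alpha_in])
  have sub: "(\<lambda>x. x - m k l) \<in> measurable (law (\<alpha> $ k $ l)) borel" by simp
  show "real_distribution (cent k l)"
    unfolding cent_def by (rule P.real_distribution_distr) simp
  have i1: "integrable (law (\<alpha> $ k $ l)) (\<lambda>x. x)" and i2: "integrable (law (\<alpha> $ k $ l)) (\<lambda>x. x\<^sup>2)"
    by (rule integrable_id[OF interior] moments(1)[OF interior])+
  have one: "measure (law (\<alpha> $ k $ l)) UNIV = 1" using P.prob_space by simp
  have j1: "integrable (law (\<alpha> $ k $ l)) (\<lambda>x. x - m k l)"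
    by (intro Bochner_Integration.integrable_diff P.integrable_const i1)
  have j2: "integrable (law (\<alpha> $ k $ l)) (\<lambda>x. (x - m k l)\<^sup>2)"
    unfolding power2_diff
    by (intro Bochner_Integration.integrable_diff Bochner_Integration.integrable_add
        P.integrable_const i2 integrable_mult_left integrable_mult_right i1)
  show "integrable (cent k l) (\<lambda>x. x)"
    unfolding cent_def by (subst integrable_distr_eq[OF sub]) (simp_all only: j1 measurable_ident_sets)
  show "integral\<^sup>L (cent k l) (\<lambda>x. x) = 0"
    unfolding cent_def
    by (subst integral_distr[OF sub]) (simp_all add: Bochner_Integration.integral_diff[OF i1] one measurable_ident_sets)
  have sq: "(\<lambda>x::real. x\<^sup>2) \<in> borel_measurable borel" by measurable
  show "integrable (cent k l) (\<lambda>x. x\<^sup>2)"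
    unfolding cent_def by (subst integrable_distr_eq[OF sub sq]) (rule j2)
  show "integral\<^sup>L (cent k l) (\<lambda>x. x\<^sup>2) = V k l"
    unfolding cent_def law_variance[OF interior, symmetric] by (rule integral_distr[OF sub sq])
qed

text \<open>The factor of one block in the conditional characteristic function of \<open>Y\<close>.
  For an empty block \<open>x_hat\<close> is 0, so the entry of \<open>Y\<close> is a constant and
  the factor a pure phase; its modulus is still 1, which is all that is needed of these rare
  configurations.\<close>

definition block_char :: "real^'m^'g \<Rightarrow> 'g \<Rightarrow> 'm \<Rightarrow> (nat \<times> nat) \<times> (nat \<Rightarrow> 'g) \<times> (nat \<Rightarrow> 'm) \<Rightarrow> complex" where
  "block_char T k l x =
    (if N\<^sub>r x k * N\<^sub>c x l = 0
     then cis (- (T $ k $ l / V k l * sqrt (real (fst (fst x)) * real (snd (fst x))) * m k l))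
     else char (cent k l) (T $ k $ l / V k l * sqrt (real (fst (fst x)) * real (snd (fst x)))
       / (real (N\<^sub>r x k) * real (N\<^sub>c x l))) ^ (N\<^sub>r x k * N\<^sub>c x l))"

lemma norm_block_char_le: "norm (block_char T k l x) \<le> 1"
  using real_distribution.cmod_char_le_1[OF cent(1)] by (auto simp: block_char_def norm_power power_le_one)

text \<open>Given the labels, \<open>T \<bullet> Y (n, d)\<close> is a constant plus a sum of
  independent centred terms, one for each cell of the data matrix. Within a block these terms have
  the same law and the same weight.\<close>

lemma char_Y_given:
  "(\<integral>\<omega>. cis (T \<bullet> Y (n, d) \<omega>) \<partial>given n d r c) = (\<Prod>k\<in>UNIV. \<Prod>l\<in>UNIV. block_char T k l ((n, d), r, c))"
proof -
  interpret Q: prob_space "given n d r c" by (rule prob_space_given)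
  define rt where "rt = sqrt (real n * real d)"
  define q where "q k l = label_count n r k * label_count d c l" for k l
  define a where "a k l = T $ k $ l / V k l" for k l
  \<comment> \<open>The weight of a cell. In an empty block the division by 0 gives weight 0, and
    \<open>C\<close> below carries the deterministic contribution instead.\<close>
  define s where "s k l = a k l * rt / real (q k l)" for k l
  define C where "C k l = (if q k l = 0 then - (a k l * rt * m k l) else 0)" for k l
  let ?S = "{..<n} \<times> {..<d}"
  let ?kl = "\<lambda>p. (r (fst p), c (snd p))"
  define \<xi> where "\<xi> p \<omega> = s (r (fst p)) (c (snd p)) * (X (fst p) (snd p) \<omega> - m (r (fst p)) (c (snd p)))" for p \<omega>
  have \<xi>m [measurable]: "\<xi> p \<in> borel_measurable M" for p unfolding \<xi>_def by measurable
  have card: "card (block n d r c (k, l)) = q k l" for k l by (simp add: card_block q_def)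
  have term_eq: "T $ k $ l * (rt * (xh n d k l \<omega> - m k l) / V k l)
      = C k l + (\<Sum>p\<in>block n d r c (k, l). \<xi> p \<omega>)" if "\<omega> \<in> E n d r c" for k l \<omega>
  proof -
    let ?x = "\<Sum>p\<in>block n d r c (k, l). X (fst p) (snd p) \<omega>"
    have xh: "xh n d k l \<omega> = ?x / real (q k l)"
      using xh_on_E[OF that] by (simp add: q_def)
    have "(\<Sum>p\<in>block n d r c (k, l). \<xi> p \<omega>) = (\<Sum>p\<in>block n d r c (k, l). s k l * (X (fst p) (snd p) \<omega> - m k l))"
      by (intro sum.cong refl) (auto simp: block_def \<xi>_def)
    also have "\<dots> = s k l * (?x - real (q k l) * m k l)"
      by (simp add: sum_subtractf card flip: sum_distrib_left)
    finally show ?thesis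
      by (cases "q k l = 0") (simp_all add: xh s_def C_def a_def field_simps)
  qed
  \<comment> \<open>Each cell lies in exactly one block, the one given by its pair of
    labels.\<close>
  have sum_block: "(\<Sum>k\<in>UNIV. \<Sum>l\<in>UNIV. \<Sum>p\<in>block n d r c (k, l). f p) = (\<Sum>p\<in>?S. f p)" for f :: "_ \<Rightarrow> real"
  proof -
    have "(\<Sum>k\<in>UNIV. \<Sum>l\<in>UNIV. \<Sum>p\<in>block n d r c (k, l). f p) = (\<Sum>kl\<in>UNIV. \<Sum>p\<in>block n d r c kl. f p)"
      by (simp add: sum.cartesian_product case_prod_beta' flip: UNIV_Times_UNIV)
    also have "\<dots> = (\<Sum>p\<in>?S. f p)"
      unfolding block_def by (rule sum.group) auto
    finally show ?thesis .
  qed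
  have prod_block: "(\<Prod>k\<in>UNIV. \<Prod>l\<in>UNIV. \<Prod>p\<in>block n d r c (k, l). f p) = (\<Prod>p\<in>?S. f p)" for f :: "_ \<Rightarrow> complex"
  proof -
    have "(\<Prod>k\<in>UNIV. \<Prod>l\<in>UNIV. \<Prod>p\<in>block n d r c (k, l). f p) = (\<Prod>kl\<in>UNIV. \<Prod>p\<in>block n d r c kl. f p)"
      by (simp add: prod.cartesian_product case_prod_beta' flip: UNIV_Times_UNIV)
    also have "\<dots> = (\<Prod>p\<in>?S. f p)"
      unfolding block_def by (rule prod.group) auto
    finally show ?thesis .
  qed
  have TY: "T \<bullet> Y (n, d) \<omega> = (\<Sum>k\<in>UNIV. \<Sum>l\<in>UNIV. C k l) + (\<Sum>p\<in>?S. \<xi> p \<omega>)" if "\<omega> \<in> E n d r c" for \<omega>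
  proof -
    have "T \<bullet> Y (n, d) \<omega> = (\<Sum>k\<in>UNIV. \<Sum>l\<in>UNIV. T $ k $ l * (rt * (xh n d k l \<omega> - m k l) / V k l))"
      by (simp add: inner_vec_def Y_def rt_def)
    also have "\<dots> = (\<Sum>k\<in>UNIV. \<Sum>l\<in>UNIV. C k l + (\<Sum>p\<in>block n d r c (k, l). \<xi> p \<omega>))"
      by (simp only: term_eq[OF that])
    also have "\<dots> = (\<Sum>k\<in>UNIV. \<Sum>l\<in>UNIV. C k l) + (\<Sum>k\<in>UNIV. \<Sum>l\<in>UNIV. \<Sum>p\<in>block n d r c (k, l). \<xi> p \<omega>)"
      by (simp only: sum.distrib)
    finally show ?thesis by (simp only: sum_block)
  qed
  have char_\<xi>: "char (distr (given n d r c) borel (\<xi> p)) 1 = char (cent k l) (s k l)"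
    if "p \<in> block n d r c (k, l)" for p k l
  proof -
    have kl: "r (fst p) = k" "c (snd p) = l" and lt: "fst p < n" "snd p < d"
      using that by (auto simp: block_def)
    have "char (distr (given n d r c) borel (\<xi> p)) 1
        = (\<integral>\<omega>. cis (s k l * (X (fst p) (snd p) \<omega> - m k l)) \<partial>given n d r c)"
      by (simp add: char_def integral_distr cis_conv_exp \<xi>_def kl)
    also have "\<dots> = (\<integral>x. cis (s k l * (x - m k l)) \<partial>distr (given n d r c) borel (X (fst p) (snd p)))"
      by (subst integral_distr) auto
    also have "distr (given n d r c) borel (X (fst p) (snd p)) = law (\<alpha> $ k $ l)"
      using distr_given[OF lt, of r c] kl by simp
    also have "(\<integral>x. cis (s k l * (x - m k l)) \<partial>law (\<alpha> $ k $ l)) = char (cent k l) (s k l)"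
      by (simp add: char_def cent_def integral_distr cis_conv_exp)
    finally show ?thesis .
  qed
  have "(\<integral>\<omega>. cis (T \<bullet> Y (n, d) \<omega>) \<partial>given n d r c)
      = (\<integral>\<omega>. cis (\<Sum>k\<in>UNIV. \<Sum>l\<in>UNIV. C k l) * cis (\<Sum>p\<in>?S. \<xi> p \<omega>) \<partial>given n d r c)"
  proof (rule integral_cong_AE)
    show "AE \<omega> in given n d r c. cis (T \<bullet> Y (n, d) \<omega>) = cis (\<Sum>k\<in>UNIV. \<Sum>l\<in>UNIV. C k l) * cis (\<Sum>p\<in>?S. \<xi> p \<omega>)"
      using AE_given[of n d r c] by eventually_elim (simp only: TY cis_mult)
  qed simp_all
  also have "\<dots> = cis (\<Sum>k\<in>UNIV. \<Sum>l\<in>UNIV. C k l) * (\<integral>\<omega>. cis (\<Sum>p\<in>?S. \<xi> p \<omega>) \<partial>given n d r c)"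
    by simp
  also have "(\<integral>\<omega>. cis (\<Sum>p\<in>?S. \<xi> p \<omega>) \<partial>given n d r c) = char (distr (given n d r c) borel (\<lambda>\<omega>. \<Sum>p\<in>?S. \<xi> p \<omega>)) 1"
    by (simp add: char_def integral_distr cis_conv_exp)
  also have "\<dots> = (\<Prod>p\<in>?S. char (distr (given n d r c) borel (\<xi> p)) 1)"
  proof (rule Q.char_distr_sum)
    show "Q.indep_vars (\<lambda>i. borel) \<xi> ?S"
      unfolding \<xi>_def
      by (rule Q.indep_vars_compose2[OF indep_given,
            where Y = "\<lambda>p x. s (r (fst p)) (c (snd p)) * (x - m (r (fst p)) (c (snd p)))"]) measurable
  qed
  also have "\<dots> = (\<Prod>k\<in>UNIV. \<Prod>l\<in>UNIV. \<Prod>p\<in>block n d r c (k, l). char (distr (given n d r c) borel (\<xi> p)) 1)"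
    by (rule prod_block[symmetric])
  also have "\<dots> = (\<Prod>k\<in>UNIV. \<Prod>l\<in>UNIV. char (cent k l) (s k l) ^ q k l)"
    by (intro prod.cong refl) (simp add: char_\<xi> card)
  also have "cis (\<Sum>k\<in>UNIV. \<Sum>l\<in>UNIV. C k l) * \<dots> = (\<Prod>k\<in>UNIV. \<Prod>l\<in>UNIV. cis (C k l) * char (cent k l) (s k l) ^ q k l)"
    by (simp add: cis_sum prod.distrib)
  also have "\<dots> = (\<Prod>k\<in>UNIV. \<Prod>l\<in>UNIV. block_char T k l ((n, d), r, c))"
    by (intro prod.cong refl) (simp add: block_char_def C_def s_def a_def q_def rt_def)
  finally show ?thesis .
qed

lemma char_Y:
  "(\<integral>\<omega>. cis (T \<bullet> Y nd \<omega>) \<partial>M)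
    = (\<integral>\<omega>. (\<Prod>k\<in>UNIV. \<Prod>l\<in>UNIV. block_char T k l (nd, rows.labs (fst nd) \<omega>, cols.labs (snd nd) \<omega>)) \<partial>M)"
proof -
  obtain n d where nd: "nd = (n, d)" by (cases nd)
  show ?thesis
    unfolding nd fst_conv snd_conv
    by (rule integral_by_labels[where h = "\<lambda>r c. \<Prod>k\<in>UNIV. \<Prod>l\<in>UNIV. block_char T k l ((n, d), r, c)"])
       (simp_all add: char_Y_given)
qed

text \<open>Supplies the assumption on \<open>J\<close> in
  \<open>expectation_tendsto_in_prob\<close>. The exceptional event collects the large deviations of
  the row and the column proportions, each of probability below \<open>e / 2\<close>.\<close>

lemma labels_in_prob:
  assumes "eventually P (label_filter \<pi> \<rho>)" and e: "e > 0"
  shows "\<forall>\<^sub>F nd in sequentially \<times>\<^sub>F sequentially. \<exists>B\<in>events. prob B < e \<and>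
    (\<forall>\<omega>\<in>space M - B. P (nd, rows.labs (fst nd) \<omega>, cols.labs (snd nd) \<omega>))"
proof -
  obtain Q \<delta> where Q: "eventually Q (sequentially \<times>\<^sub>F sequentially)" and \<delta>: "\<delta> > 0"
    and P: "\<And>n d r c. Q (n, d) \<Longrightarrow> dist (\<chi> k. real (label_count n r k) / real n) \<pi> < \<delta> \<Longrightarrow>
      dist (\<chi> l. real (label_count d c l) / real d) \<rho> < \<delta> \<Longrightarrow> P ((n, d), r, c)"
    using eventually_label_filterD[OF assms(1)] by blast
  let ?B1 = "\<lambda>n. {\<omega> \<in> space M. \<delta> \<le> dist (prop_hat n (\<lambda>i. Z i \<omega>)) \<pi>}"
  let ?B2 = "\<lambda>d. {\<omega> \<in> space M. \<delta> \<le> dist (prop_hat d (\<lambda>j. W j \<omega>)) \<rho>}"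
  have "\<forall>\<^sub>F nd in sequentially \<times>\<^sub>F sequentially. prob (?B1 (fst nd)) < e / 2"
    using rows.prop_hat_in_prob[of "e / 2" \<delta>] e \<delta> by (intro eventually_compose_filterlim[OF _ filterlim_fst]) auto
  moreover have "\<forall>\<^sub>F nd in sequentially \<times>\<^sub>F sequentially. prob (?B2 (snd nd)) < e / 2"
    using cols.prop_hat_in_prob[of "e / 2" \<delta>] e \<delta> by (intro eventually_compose_filterlim[OF _ filterlim_snd]) auto
  ultimately show ?thesis using Q
  proof eventually_elim
    case (elim nd)
    obtain n d where nd: "nd = (n, d)" by (cases nd)
    have meas: "?B1 n \<in> events" "?B2 d \<in> events" by measurable
    have "prob (?B1 n \<union> ?B2 d) \<le> prob (?B1 n) + prob (?B2 d)"
      by (rule measure_Un_le) (rule meas)+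
    then have "prob (?B1 n \<union> ?B2 d) < e" using elim by (simp add: nd)
    moreover have "P (nd, rows.labs n \<omega>, cols.labs d \<omega>)" if "\<omega> \<in> space M - (?B1 n \<union> ?B2 d)" for \<omega>
      unfolding nd using that elim(3)
      by (intro P) (auto simp: nd rows.prop_hat_labs cols.prop_hat_labs)
    ultimately show ?case
      using meas by (intro bexI[of _ "?B1 n \<union> ?B2 d"]) (auto simp: nd)
  qed
qed

text \<open>An instance of \<open>char_power_tendsto\<close>: along the filter the frequency of a
  cell tends to 0, while the number of cells times its square equals \<open>a\<^sup>2\<close> over
  the product of the two observed proportions, which converges.\<close>

lemma block_char_tendsto:
  "(block_char T k l \<longlongrightarrow> of_real (exp (- ((T $ k $ l)\<^sup>2 / (\<pi> $ k * \<rho> $ l * V k l)) / 2))) (label_filter \<pi> \<rho>)"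
proof -
  let ?F = "label_filter \<pi> \<rho>"
  define a where "a = T $ k $ l / V k l"
  define n d where "n x = fst (fst x)" and "d x = snd (fst x)"
    for x :: "(nat \<times> nat) \<times> (nat \<Rightarrow> 'g) \<times> (nat \<Rightarrow> 'm)"
  define u v where "u x = real (N\<^sub>r x k) / n x" and "v x = real (N\<^sub>c x l) / d x"
    for x :: "(nat \<times> nat) \<times> (nat \<Rightarrow> 'g) \<times> (nat \<Rightarrow> 'm)"
  define s where "s x = a * sqrt (real (n x) * real (d x)) / (real (N\<^sub>r x k) * real (N\<^sub>c x l))" for x
  have u: "(u \<longlongrightarrow> \<pi> $ k) ?F" and v: "(v \<longlongrightarrow> \<rho> $ l) ?F"
    unfolding u_def v_def n_def d_def by (rule label_filter_limits)+
  have nz: "\<pi> $ k * \<rho> $ l \<noteq> 0" using pos(1)[of k] pos(2)[of l] by simp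
  \<comment> \<open>The limiting proportions are positive, so eventually the block is nonempty and
    the phase in \<open>block_char\<close> does not occur.\<close>
  have ev: "\<forall>\<^sub>F x in ?F. u x > 0 \<and> v x > 0"
    using pos(1)[of k] pos(2)[of l] by (intro eventually_conj order_tendstoD(1)[OF u] order_tendstoD(1)[OF v])
  have gt: "N\<^sub>r x k > 0" "N\<^sub>c x l > 0" "n x > 0" "d x > 0" if "u x > 0 \<and> v x > 0" for x
    using that by (auto simp: u_def v_def zero_less_divide_iff)
  \<comment> \<open>This is \<open>s x\<close> written through the proportions, which shows that it
    decays like the inverse root of the number of entries of the data matrix.\<close>
  have "((\<lambda>x. a * (1 / sqrt (n x)) * (1 / sqrt (d x)) / (u x * v x)) \<longlongrightarrow> a * 0 * 0 / (\<pi> $ k * \<rho> $ l)) ?F"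
    unfolding n_def d_def
    by (intro tendsto_intros inv_sqrt_tendsto_0 label_filter_limits u v nz)
  moreover have "\<forall>\<^sub>F x in ?F. a * (1 / sqrt (n x)) * (1 / sqrt (d x)) / (u x * v x) = s x"
    using ev
  proof eventually_elim
    case (elim x)
    note g = gt[OF elim]
    have r: "1 / sqrt (n x) * (1 / sqrt (d x)) * (real (n x) * real (d x)) = sqrt (real (n x) * real (d x))"
    proof -
      have "1 / sqrt (n x) * (1 / sqrt (d x)) * (real (n x) * real (d x))
          = (real (n x) / sqrt (n x)) * (real (d x) / sqrt (d x))" by simp
      then show ?thesis by (simp only: real_div_sqrt[OF of_nat_0_le_iff] real_sqrt_mult)
    qed
    have "a * (1 / sqrt (n x)) * (1 / sqrt (d x)) / (u x * v x)
        = a * (1 / sqrt (n x) * (1 / sqrt (d x)) * (real (n x) * real (d x))) / (real (N\<^sub>r x k) * real (N\<^sub>c x l))"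
      by (simp add: u_def v_def)
    then show ?case by (simp only: r s_def)
  qed
  ultimately have s0: "(s \<longlongrightarrow> 0) ?F"
    using Lim_transform_eventually by fastforce
  have "((\<lambda>x. a\<^sup>2 / (u x * v x)) \<longlongrightarrow> a\<^sup>2 / (\<pi> $ k * \<rho> $ l)) ?F"
    by (intro tendsto_intros u v nz)
  moreover have "\<forall>\<^sub>F x in ?F. a\<^sup>2 / (u x * v x) = real (N\<^sub>r x k * N\<^sub>c x l) * (s x)\<^sup>2"
    using ev
  proof eventually_elim
    case (elim x)
    note g = gt[OF elim]
    have "(s x)\<^sup>2 = a\<^sup>2 * (real (n x) * real (d x)) / (real (N\<^sub>r x k) * real (N\<^sub>c x l))\<^sup>2"
      by (simp add: s_def power_divide power_mult_distrib)
    then show ?case using g by (simp add: u_def v_def power2_eq_square)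
  qed
  ultimately have qs: "((\<lambda>x. real (N\<^sub>r x k * N\<^sub>c x l) * (s x)\<^sup>2) \<longlongrightarrow> a\<^sup>2 / (\<pi> $ k * \<rho> $ l)) ?F"
    by (rule Lim_transform_eventually)
  have "((\<lambda>x. char (cent k l) (s x) ^ (N\<^sub>r x k * N\<^sub>c x l))
      \<longlongrightarrow> of_real (exp (- (a\<^sup>2 / (\<pi> $ k * \<rho> $ l)) * V k l / 2))) ?F"
    by (rule real_distribution.char_power_tendsto[OF cent s0 qs])
  moreover have "- (a\<^sup>2 / (\<pi> $ k * \<rho> $ l)) * V k l / 2 = - ((T $ k $ l)\<^sup>2 / (\<pi> $ k * \<rho> $ l * V k l)) / 2"
    using V_pos[of k l] by (simp add: a_def power_divide power2_eq_square)
  moreover have "\<forall>\<^sub>F x in ?F. char (cent k l) (s x) ^ (N\<^sub>r x k * N\<^sub>c x l) = block_char T k l x"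
    using ev
  proof eventually_elim
    case (elim x)
    then show ?case using gt[OF elim] by (simp add: block_char_def s_def a_def n_def d_def)
  qed
  ultimately show ?thesis
    by (simp only:) (rule Lim_transform_eventually)
qed

section \<open>The joint limit law\<close>

abbreviation S :: "'g \<Rightarrow> 'm \<Rightarrow> real" where "S k l \<equiv> Sigma_alpha \<psi> (\<pi>, \<rho>, \<alpha>) $ k $ l"

lemma S_eq: "S k l = 1 / (\<pi> $ k * \<rho> $ l * V k l)"
  by (rule Sigma_alpha_nth) (rule pos)+

lemma S_pos: "S k l > 0"
  unfolding S_eq using pos(1)[of k] pos(2)[of l] V_pos[of k l] by simp

abbreviation limit_law :: "(real^'m^'g) measure" where
  "limit_law \<equiv> distr (\<Pi>\<^sub>M (k, l)\<in>UNIV. normal_law (S k l)) borel (\<lambda>y. \<chi> k l. y (k, l))"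

lemma vec_meas [measurable]:
  "(\<lambda>y. \<chi> k l. y (k, l)) \<in> measurable (\<Pi>\<^sub>M (k, l)\<in>UNIV. normal_law (S k l)) (borel :: (real^'m^'g) measure)"
proof (intro measurable_vecI)
  fix k l
  have "(\<lambda>y. y (k, l)) \<in> measurable (\<Pi>\<^sub>M (k, l)\<in>UNIV. normal_law (S k l)) (case (k, l) of (k, l) \<Rightarrow> normal_law (S k l))"
    by (rule measurable_component_singleton) simp
  then show "(\<lambda>y. (\<chi> k l. y (k, l)) $ k $ l) \<in> borel_measurable (\<Pi>\<^sub>M (k, l)\<in>UNIV. normal_law (S k l))"
    by (simp cong: measurable_cong_sets)
qed

lemma prob_space_limit_law: "prob_space limit_law"
proof (rule prob_space.prob_space_distr[OF _ vec_meas])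
  show "prob_space (\<Pi>\<^sub>M (k, l)\<in>UNIV. normal_law (S k l))"
    by (rule prob_space_PiM) (auto intro: prob_space_normal_law S_pos)
qed

lemma char_limit_law:
  "(\<integral>y. cis (T \<bullet> y) \<partial>limit_law) = (\<Prod>k\<in>UNIV. \<Prod>l\<in>UNIV. of_real (exp (- ((T $ k $ l)\<^sup>2 / (\<pi> $ k * \<rho> $ l * V k l)) / 2)))"
proof -
  have "(\<lambda>y. cis (T \<bullet> y)) \<in> borel_measurable borel" by measurable
  then have "(\<integral>y. cis (T \<bullet> y) \<partial>limit_law)
      = (\<integral>y. cis (T \<bullet> (\<chi> k l. y (k, l))) \<partial>(\<Pi>\<^sub>M (k, l)\<in>UNIV. normal_law (S k l)))"
    by (rule integral_distr[OF vec_meas])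
  also have "\<dots> = (\<integral>y. cis (\<Sum>kl\<in>UNIV. T $ fst kl $ snd kl * y kl) \<partial>(\<Pi>\<^sub>M kl\<in>UNIV. normal_law (S (fst kl) (snd kl))))"
    by (simp add: inner_vec_def sum.cartesian_product case_prod_beta' flip: UNIV_Times_UNIV)
  also have "\<dots> = of_real (exp (- (\<Sum>kl\<in>UNIV. S (fst kl) (snd kl) * (T $ fst kl $ snd kl)\<^sup>2) / 2))"
    by (rule char_PiM_normal_law) (rule S_pos)
  also have "(\<Sum>kl\<in>UNIV. S (fst kl) (snd kl) * (T $ fst kl $ snd kl)\<^sup>2) = (\<Sum>k\<in>UNIV. \<Sum>l\<in>UNIV. S k l * (T $ k $ l)\<^sup>2)"
    by (simp add: sum.cartesian_product case_prod_beta' flip: UNIV_Times_UNIV)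
  also have "complex_of_real (exp (- \<dots> / 2))
      = (\<Prod>k\<in>UNIV. \<Prod>l\<in>UNIV. of_real (exp (- (S k l * (T $ k $ l)\<^sup>2) / 2)))"
    by (simp add: exp_sum[symmetric] sum_negf sum_divide_distrib flip: of_real_prod)
  finally show ?thesis by (simp add: S_eq)
qed

lemma conv_Y: "conv_in_dist M Y (sequentially \<times>\<^sub>F sequentially) limit_law"
proof (rule conv_in_dist_prod_sequentiallyI[OF prob_space_axioms prob_space_limit_law _ Y_meas])
  fix T :: "real^'m^'g"
  show "((\<lambda>nd. \<integral>\<omega>. cis (T \<bullet> Y nd \<omega>) \<partial>M) \<longlongrightarrow> (\<integral>y. cis (T \<bullet> y) \<partial>limit_law)) (sequentially \<times>\<^sub>F sequentially)"
    unfolding char_Y char_limit_law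
  proof (rule expectation_tendsto_in_prob[where H = "\<lambda>x. \<Prod>k\<in>UNIV. \<Prod>l\<in>UNIV. block_char T k l x"])
    show "((\<lambda>x. \<Prod>k\<in>UNIV. \<Prod>l\<in>UNIV. block_char T k l x) \<longlongrightarrow>
        (\<Prod>k\<in>UNIV. \<Prod>l\<in>UNIV. of_real (exp (- ((T $ k $ l)\<^sup>2 / (\<pi> $ k * \<rho> $ l * V k l)) / 2)))) (label_filter \<pi> \<rho>)"
      by (intro tendsto_prod block_char_tendsto)
    show "norm (\<Prod>k\<in>UNIV. \<Prod>l\<in>UNIV. block_char T k l x) \<le> 1" for x
      unfolding prod_norm[symmetric]
      by (intro prod_le_1 conjI prod_nonneg ballI norm_ge_zero norm_block_char_le)
    show "(\<lambda>\<omega>. \<Prod>k\<in>UNIV. \<Prod>l\<in>UNIV. block_char T k l (nd, rows.labs (fst nd) \<omega>, cols.labs (snd nd) \<omega>))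
        \<in> borel_measurable M" for nd
      by (rule measurable_labs)
  qed (rule labels_in_prob)
qed simp

end

section \<open>The delta method\<close>

lemma norm_matrix_le_sum:
  fixes x :: "real^'m^'g"
  shows "norm x \<le> (\<Sum>k\<in>UNIV. \<Sum>l\<in>UNIV. \<bar>x $ k $ l\<bar>)"
proof -
  have "norm x \<le> (\<Sum>k\<in>UNIV. norm (x $ k))"
    unfolding norm_vec_def by (rule L2_set_le_sum) simp
  also have "\<dots> \<le> (\<Sum>k\<in>UNIV. \<Sum>l\<in>UNIV. \<bar>x $ k $ l\<bar>)"
    by (intro sum_mono norm_le_l1_cart)
  finally show ?thesis .
qed

text \<open>The increment \<open>v * y / R i\<close> is uniformly small for bounded
  \<open>y\<close>. The linear part of \<open>h\<close>, multiplied by \<open>R i\<close>, is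
  exactly \<open>y\<close>, so only the first-order remainder is left, and it is small relative to
  the increment.\<close>

lemma delta_uniform:
  fixes h :: "real \<Rightarrow> real"
  assumes h: "(h has_real_derivative 1 / v) (at x)" and v: "v > 0" and K: "K > 0" and e: "e > 0"
    and R: "filterlim R at_top F"
  shows "\<forall>\<^sub>F i in F. \<forall>y. \<bar>y\<bar> \<le> K \<longrightarrow> \<bar>R i * (h (x + v * y / R i) - h x) - y\<bar> \<le> e"
proof -
  \<comment> \<open>The relative error allowed in the definition of the derivative: after
    multiplication by \<open>R i\<close> the remainder is at most \<open>e' * (v * K)\<close>, which
    is \<open>e\<close>.\<close>
  define e' where "e' = e / (v * K)"
  have "e' > 0" using v K e by (simp add: e'_def)
  moreover have "(h has_derivative (*) (1 / v)) (at x)"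
    using h by (simp add: has_field_derivative_def)
  ultimately obtain \<delta> where \<delta>: "\<delta> > 0"
    "\<And>y. \<bar>y - x\<bar> < \<delta> \<Longrightarrow> \<bar>h y - h x - 1 / v * (y - x)\<bar> \<le> e' * \<bar>y - x\<bar>"
    unfolding has_derivative_at_alt real_norm_def by blast
  have "\<forall>\<^sub>F i in F. R i > v * K / \<delta>"
    using R by (simp add: filterlim_at_top_dense)
  then show ?thesis
  proof (eventually_elim, intro allI impI)
    fix i y assume Ri: "R i > v * K / \<delta>" and y: "\<bar>y\<bar> \<le> K"
    have pos: "R i > 0" using Ri v K \<delta>(1) by (meson divide_pos_pos less_trans mult_pos_pos)
    define w where "w = v * y / R i"
    have vy: "\<bar>v * y\<bar> \<le> v * K" using y v by (simp add: abs_mult)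
    have "v * K < R i * \<delta>" using Ri \<delta>(1) by (simp add: field_simps)
    then have "\<bar>w\<bar> < \<delta>" using vy pos by (simp add: w_def abs_divide field_simps)
    then have 1: "\<bar>h (x + w) - h x - 1 / v * w\<bar> \<le> e' * \<bar>w\<bar>"
      using \<delta>(2)[of "x + w"] by simp
    have "R i * (h (x + w) - h x) - y = R i * (h (x + w) - h x - 1 / v * w)"
      using pos v by (simp add: w_def field_simps)
    also have "\<bar>\<dots>\<bar> \<le> R i * (e' * \<bar>w\<bar>)"
      using 1 pos by (simp add: abs_mult)
    also have "\<dots> = e' * \<bar>v * y\<bar>" using pos by (simp add: w_def abs_divide)
    also have "\<dots> \<le> e' * (v * K)" using vy \<open>e' > 0\<close> by simp
    also have "\<dots> = e" using v K by (simp add: e'_def)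
    finally show "\<bar>R i * (h (x + v * y / R i) - h x) - y\<bar> \<le> e" by (simp add: w_def)
  qed
qed

lemma filterlim_sqrt_mult_at_top:
  "filterlim (\<lambda>nd. sqrt (real (fst nd) * real (snd nd))) at_top (sequentially \<times>\<^sub>F sequentially)"
proof -
  have "filterlim (\<lambda>nd. real (fst nd)) at_top (sequentially \<times>\<^sub>F (sequentially :: nat filter))"
    "filterlim (\<lambda>nd. real (snd nd)) at_top ((sequentially :: nat filter) \<times>\<^sub>F sequentially)"
    by (rule filterlim_compose[OF filterlim_real_sequentially] filterlim_fst filterlim_snd)+
  then have "filterlim (\<lambda>nd. real (fst nd) * real (snd nd)) at_top (sequentially \<times>\<^sub>F sequentially)"
    by (rule filterlim_at_top_mult_at_top)
  with sqrt_at_top show ?thesis by (rule filterlim_compose)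
qed

context lbm_model
begin

abbreviation h :: "real \<Rightarrow> real" where "h \<equiv> inv_into (interior A) (deriv \<psi>)"

lemma h_mean: "h (m k l) = \<alpha> $ k $ l"
  using inv_into_f_f[OF inj_deriv_psi interior[of k l]] deriv_psi[OF interior[of k l]] by simp

abbreviation rate :: "nat \<times> nat \<Rightarrow> real" where "rate nd \<equiv> sqrt (real (fst nd) * real (snd nd))"

text \<open>The deterministic map from rescaled block means to rescaled estimators. The argument of
  \<open>h\<close> recovers the block mean from an entry of \<open>Y\<close>.\<close>

definition G :: "nat \<times> nat \<Rightarrow> real^'m^'g \<Rightarrow> real^'m^'g" where
  "G nd y = (\<chi> k l. rate nd * (h (m k l + V k l * y $ k $ l / rate nd) - \<alpha> $ k $ l))"

lemma G_Y: "G nd (Y nd \<omega>) = (\<chi> k l. rate nd * (ah (fst nd) (snd nd) k l \<omega> - \<alpha> $ k $ l))"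
proof (cases "rate nd = 0")
  \<comment> \<open>With no rows or no columns, \<open>Y\<close> does not determine the block mean,
    but the factor \<open>rate nd\<close> makes both sides 0.\<close>
  case True
  then show ?thesis unfolding G_def True by simp
next
  case False
  have "m k l + V k l * (Y nd \<omega> $ k $ l) / rate nd = xh (fst nd) (snd nd) k l \<omega>" for k l
    unfolding Y_def vec_lambda_beta using False V_pos[of k l] by (simp add: field_simps)
  then show ?thesis by (simp add: G_def alpha_hat_def)
qed

lemma uniform_limit_G: 
  assumes K: "K > 0"
  shows "uniform_limit (cball 0 K) G (\<lambda>y. y) (sequentially \<times>\<^sub>F sequentially)"
proof (rule uniform_limitI)
  fix e :: real assume e: "e > 0"
  \<comment> \<open>The norm of a matrix is bounded by the sum over its entries, of which there are
    \<open>CARD('g) * CARD('m)\<close>; the factor 2 gives the strict inequality.\<close>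
  define e' where "e' = e / (2 * (CARD('g) * CARD('m)))"
  have e': "e' > 0" using e by (simp add: e'_def)
  have "\<forall>\<^sub>F nd in sequentially \<times>\<^sub>F sequentially. \<forall>y. \<bar>y\<bar> \<le> K \<longrightarrow>
      \<bar>rate nd * (h (m k l + V k l * y / rate nd) - h (m k l)) - y\<bar> \<le> e'" for k l
    using deriv_inverse[OF interior[of k l]]
    by (intro delta_uniform V_pos K e' filterlim_sqrt_mult_at_top) (simp add: inverse_eq_divide)
  then have "\<forall>\<^sub>F nd in sequentially \<times>\<^sub>F sequentially. \<forall>k l. \<forall>y. \<bar>y\<bar> \<le> K \<longrightarrow>
      \<bar>rate nd * (h (m k l + V k l * y / rate nd) - h (m k l)) - y\<bar> \<le> e'"
    by (intro eventually_all_finite)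
  then show "\<forall>\<^sub>F nd in sequentially \<times>\<^sub>F sequentially. \<forall>y\<in>cball 0 K. dist (G nd y) y < e"
  proof (eventually_elim, intro ballI)
    fix nd and y :: "real^'m^'g"
    assume *: "\<forall>k l. \<forall>y. \<bar>y\<bar> \<le> K \<longrightarrow> \<bar>rate nd * (h (m k l + V k l * y / rate nd) - h (m k l)) - y\<bar> \<le> e'"
      and y: "y \<in> cball 0 K"
    have "\<bar>y $ k $ l\<bar> \<le> K" for k l
    proof -
      have "\<bar>y $ k $ l\<bar> \<le> norm (y $ k)" by (rule component_le_norm_cart)
      also have "\<dots> \<le> norm y" by (rule Finite_Cartesian_Product.norm_nth_le)
      finally show ?thesis using y by simp
    qed
    then have le: "\<bar>(G nd y - y) $ k $ l\<bar> \<le> e'" for k l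
      using * by (simp add: G_def h_mean)
    have "dist (G nd y) y \<le> (\<Sum>k\<in>(UNIV :: 'g set). \<Sum>l\<in>(UNIV :: 'm set). \<bar>(G nd y - y) $ k $ l\<bar>)"
      unfolding dist_norm by (rule norm_matrix_le_sum)
    also have "\<dots> \<le> (\<Sum>k\<in>(UNIV :: 'g set). \<Sum>l\<in>(UNIV :: 'm set). e')"
      by (intro sum_mono le)
    also have "\<dots> = e / 2" by (simp add: e'_def)
    also have "\<dots> < e" using e by simp
    finally show "dist (G nd y) y < e" .
  qed
qed

lemma conv_alpha_hat:
  "conv_in_dist M (\<lambda>nd \<omega>. \<chi> k l. rate nd * (ah (fst nd) (snd nd) k l \<omega> - \<alpha> $ k $ l))
    (sequentially \<times>\<^sub>F sequentially) limit_law"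
proof -
  have "conv_in_dist M (\<lambda>nd \<omega>. G nd (Y nd \<omega>)) (sequentially \<times>\<^sub>F sequentially) (distr limit_law borel (\<lambda>y. y))"
  proof (rule conv_in_dist_compose_uniform[OF prob_space_axioms prob_space_limit_law _ conv_Y _ uniform_limit_G])
    show "(\<lambda>\<omega>. G nd (Y nd \<omega>)) \<in> borel_measurable M" for nd
      unfolding G_Y by (intro measurable_vecI) (simp only: vec_lambda_beta, measurable)
  qed simp_all
  moreover have "distr limit_law borel (\<lambda>y. y) = limit_law"
    by (rule distr_id2) simp
  ultimately show ?thesis by (simp only: G_Y)
qed

text \<open>A marginal of the joint statement: projection to an entry is continuous, and it maps the
  product limit law to its factor.\<close>

lemma conv_alpha_hat_component:
  "conv_in_dist M (\<lambda>nd \<omega>. rate nd * (ah (fst nd) (snd nd) k l \<omega> - \<alpha> $ k $ l))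
    (sequentially \<times>\<^sub>F sequentially) (normal_law (S k l))"
proof -
  let ?P = "\<Pi>\<^sub>M (k, l)\<in>UNIV. normal_law (S k l)"
  have m: "(\<lambda>y::real^'m^'g. y $ k $ l) \<in> borel_measurable borel" by measurable
  have c: "continuous_on UNIV (\<lambda>y::real^'m^'g. y $ k $ l)" by (intro continuous_intros)
  have "distr limit_law borel (\<lambda>y. y $ k $ l) = distr ?P borel (\<lambda>y. y (k, l))"
    by (subst distr_distr[OF m vec_meas]) (simp add: comp_def)
  also have "\<dots> = distr ?P (case (k, l) of (k, l) \<Rightarrow> normal_law (S k l)) (\<lambda>y. y (k, l))"
    by (intro distr_cong) auto
  also have "\<dots> = normal_law (S k l)"
    by (subst distr_PiM_component) (auto intro: prob_space_normal_law S_pos)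
  finally show ?thesis
    using conv_in_dist_compose[OF _ conv_alpha_hat c] by simp
qed

end

theorem proposition3p1:
  fixes M :: "'a measure" and \<mu> :: "real measure" and b \<psi> :: "real \<Rightarrow> real" and A :: "real set"
    and \<Theta> :: "('g::finite, 'm::finite) lbm_param set"
    and \<pi> :: "real^'g" and \<rho> :: "real^'m" and \<alpha> :: "real^'m^'g"
    and Z :: "nat \<Rightarrow> 'a \<Rightarrow> real^'g" and W :: "nat \<Rightarrow> 'a \<Rightarrow> real^'m"
    and X :: "nat \<Rightarrow> nat \<Rightarrow> 'a \<Rightarrow> real"
  assumes family: "exponential_family \<mu> b \<psi> A"
    and params: "\<forall>(p, q, a)\<in>\<Theta>. prob_vector p \<and> prob_vector q"
    and H1: "\<exists>c>0. \<exists>C. compact C \<and> C \<subseteq> interior A \<and>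
      (\<forall>(p, q, a)\<in>\<Theta>. (\<forall>k. p $ k \<in> {c..1 - c}) \<and> (\<forall>l. q $ l \<in> {c..1 - c}) \<and>
         (\<forall>k l. a $ k $ l \<in> C))"
    and H2: "(\<pi>, \<rho>, \<alpha>) \<in> rel_interior \<Theta>"
    and H3: "identifiable \<mu> b \<psi> A \<Theta> (\<pi>, \<rho>, \<alpha>)"
    and model: "\<forall>n d. lbm M \<mu> b \<psi> (\<pi>, \<rho>, \<alpha>) n d Z W X"
  shows
    "pos_semidef (Sigma_prop \<pi>) \<and> rank (Sigma_prop \<pi>) = CARD('g) - 1 \<and>
     pos_semidef (Sigma_prop \<rho>) \<and> rank (Sigma_prop \<rho>) = CARD('m) - 1 \<and>
     conv_in_dist M (\<lambda>n \<omega>. sqrt (real n) *\<^sub>R (prop_hat n (\<lambda>i. Z i \<omega>) - \<pi>))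
       sequentially (mvn_law (Sigma_prop \<pi>)) \<and>
     conv_in_dist M (\<lambda>d \<omega>. sqrt (real d) *\<^sub>R (prop_hat d (\<lambda>j. W j \<omega>) - \<rho>))
       sequentially (mvn_law (Sigma_prop \<rho>)) \<and>
     (\<forall>k l. conv_in_dist M
       (\<lambda>(n, d) \<omega>. sqrt (real n * real d) *
          (alpha_hat \<psi> A n d (\<lambda>i j. X i j \<omega>) (\<lambda>i. Z i \<omega>) (\<lambda>j. W j \<omega>) k l - \<alpha> $ k $ l))
       (sequentially \<times>\<^sub>F sequentially)
       (normal_law (Sigma_alpha \<psi> (\<pi>, \<rho>, \<alpha>) $ k $ l))) \<and>
     \<comment> \<open>for all \<open>n\<close> and \<open>d\<close>, the components are independent given the labels\<close>
     (\<forall>n d r c. prob_space.indep_vars (given_labels M Z W n d r c) (\<lambda>_. borel)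
       (\<lambda>(k, l) \<omega>. alpha_hat \<psi> A n d (\<lambda>i j. X i j \<omega>) (\<lambda>i. Z i \<omega>) (\<lambda>j. W j \<omega>) k l)
       UNIV) \<and>
     \<comment> \<open>unconditionally, they are independent in the limit: the joint limit law is a product\<close>
     conv_in_dist M
       (\<lambda>(n, d) \<omega>. \<chi> k l. sqrt (real n * real d) *
          (alpha_hat \<psi> A n d (\<lambda>i j. X i j \<omega>) (\<lambda>i. Z i \<omega>) (\<lambda>j. W j \<omega>) k l - \<alpha> $ k $ l))
       (sequentially \<times>\<^sub>F sequentially)
       (distr (\<Pi>\<^sub>M (k, l)\<in>UNIV. normal_law (Sigma_alpha \<psi> (\<pi>, \<rho>, \<alpha>) $ k $ l)) borel
          (\<lambda>y. \<chi> k l. y (k, l)))"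
proof -
  have \<theta>: "(\<pi>, \<rho>, \<alpha>) \<in> \<Theta>" using H2 rel_interior_subset by blast
  obtain c C where c: "c > 0" "C \<subseteq> interior A"
    "\<And>p q a. (p, q, a) \<in> \<Theta> \<Longrightarrow> (\<forall>k. p $ k \<in> {c..1 - c}) \<and> (\<forall>l. q $ l \<in> {c..1 - c}) \<and> (\<forall>k l. a $ k $ l \<in> C)"
    using H1 by fast
  \<comment> \<open>The lower bound \<open>c\<close> keeps all true proportions away from 0; this
    makes every label configuration possible and gives the covariance matrices their full rank on
    the hyperplane.\<close>
  have pos: "\<pi> $ k > 0" "\<rho> $ l > 0" for k l
  proof -
    have "c \<le> \<pi> $ k" "c \<le> \<rho> $ l" using c(3)[OF \<theta>] by auto
    then show "\<pi> $ k > 0" "\<rho> $ l > 0" using c(1) by auto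
  qed
  have pv: "prob_vector \<pi>" "prob_vector \<rho>" using params \<theta> by auto
  interpret lbm_model \<mu> b \<psi> A M \<pi> \<rho> \<alpha> Z W X
  proof
    show "exponential_family \<mu> b \<psi> A" by (rule family)
    show "inj_on (ef_law \<mu> b \<psi>) A" using H3 by (simp add: identifiable_def)
    show "lbm M \<mu> b \<psi> (\<pi>, \<rho>, \<alpha>) n d Z W X" for n d using model by blast
    show "\<alpha> $ k $ l \<in> interior A" for k l using c(2) c(3)[OF \<theta>] by blast
  qed (use pv pos in auto)
  show ?thesis
    using pos_semidef_Sigma_prop[OF pv(1)] pos_semidef_Sigma_prop[OF pv(2)]
      rank_Sigma_prop[OF pv(1) pos(1)] rank_Sigma_prop[OF pv(2) pos(2)]
      rows.conv_prop_hat cols.conv_prop_hat conv_alpha_hat_component indep_alpha_hat_given conv_alpha_hat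
    unfolding case_prod_beta' by blast
qed

end
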